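(* Let $\Gamma$ be a compact connected metric graph, let $\kappa\in L_\infty(\Gamma)$ satisfy $\operatorname{ess\,inf}_\Gamma\kappa\ge\kappa_0>0$, let $a:\Gamma\to\mathbb R$ be Lipschitz and positive with $a_0=\min_\Gamma a>0$, and for each vertex $v$ let $A_v,B_v$ be $d_v\times d_v$ matrices such that $(A_v,B_v)$ has maximal rank $d_v$ and $A_vB_v^*$ is self-adjoint. Let $L$ be the operator on $L_2(\Gamma)$ acting on each edge by $(Lu)_e=-(a_eu_e')'+\kappa_e^2u_e$ with domain $$D(L)=\{u\in\widetilde H^2(\Gamma): A_vF(v)+a(v)B_vF'(v)=0\ \ \forall v\in\mathcal V\}.$$ Suppose at least one of the following holds: (A1) with $S=\max_v\|\Lambda_v\|_2$ one has $\kappa_0^2>4S/\min_el_e$ and $2S\max_el_e\le a_0$; (A2) $\Lambda_v$ is non-positive definite for every $v\in\mathcal V$. Then, for any $f\in L_2(\Gamma)$ and any $\beta>0$, there exists a unique solution $u\in\dot H_L^{2\beta}(\Gamma)$ to $$L^\beta u=f\quad\text{on }\Gamma.$$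
   Context: A compact metric graph $\Gamma$ consists of a finite vertex set $\mathcal V$ and a finite edge set $\mathcal E$ (loops and multiple edges allowed); each edge $e$ is identified with an interval $[0,l_e]$, $0<l_e<\infty$; $\Gamma$ carries the shortest-path metric. $\mathcal E_v$ is the set of edges incident to $v$ (a loop at $v$ counted twice, once per end) and $d_v=|\mathcal E_v|$. $u_e$ is the restriction of $u$ to $e$; $L_2(\Gamma)=\bigoplus_eL_2(e)$ with inner product $(\cdot,\cdot)$, $\widetilde H^2(\Gamma)=\bigoplus_eH^2(e)$. $\partial_eu(v)$ is the derivative of $u$ along $e$ at $v$ in the direction away from $v$ ($u_e'(0)$ if $v$ sits at $0$, $-u_e'(l_e)$ if $v$ sits at $l_e$). $F(v)\in\mathbb R^{d_v}$ is the vector of values $u_e(v)$, $e\in\mathcal E_v$, and $F'(v)$ the vector of the $\partial_eu(v)$. Definition of $\Lambda_v$: let $R_v=\operatorname{Range}(B_v^* )$ and $R_{1v}=\operatorname{Range}(B_v)$, with orthogonal projections $Q_v,Q_{1v}$; $Q_{1v}B_vQ_v:R_v\to R_{1v}$ is invertible with inverse $B_v^{(-1)}$, and $\Lambda_v=B_v^{(-1)}A_v$, a self-adjoint operator on $R_v$; $\|\cdot\|_2$ is the spectral norm. Under (A1) or (A2), $L$ is self-adjoint and positive definite with compact inverse; let $\{e_k\}_{k\in\mathbb N}$ be an orthonormal basis of $L_2(\Gamma)$ of eigenvectors with eigenvalues $\lambda_k>0$. For $\beta>0$, $\dot H_L^{2\beta}(\Gamma)=D(L^\beta)=\{u\in L_2(\Gamma):\sum_k\lambda_k^{2\beta}(u,e_k)^2<\infty\}$,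 and $L^\beta u=\sum_k\lambda_k^\beta(u,e_k)e_k$. *)

theory Defs
  imports "HOL-Analysis.Analysis" "Graph_Theory.Digraph_Component" "Jordan_Normal_Form.DL_Rank"
begin

section \<open>Compact metric graphs\<close>

text \<open>
  The graph is a finite multidigraph; the orientation of an arc \<open>e\<close> only records which
  end of \<open>e\<close> sits at \<open>0\<close> (the tail) and which at \<open>len e\<close> (the head).
  A graph without edges carries no function space and is excluded.
\<close>

definition compact_metric_graph :: "('v,'e) pre_digraph \<Rightarrow> ('e \<Rightarrow> real) \<Rightarrow> bool" where
  "compact_metric_graph G len \<longleftrightarrow>
     fin_digraph G \<and> arcs G \<noteq> {} \<and> (\<forall>e\<in>arcs G. 0 < len e)"

datatype ('v,'e) gpoint = Vertex 'v | Interior 'e real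

definition gpoints :: "('v,'e) pre_digraph \<Rightarrow> ('e \<Rightarrow> real) \<Rightarrow> ('v,'e) gpoint set" where
  "gpoints G len = Vertex ` verts G \<union> {Interior e t | e t. e \<in> arcs G \<and> 0 < t \<and> t < len e}"

definition edge_pt :: "('v,'e) pre_digraph \<Rightarrow> ('e \<Rightarrow> real) \<Rightarrow> 'e \<Rightarrow> real \<Rightarrow> ('v,'e) gpoint" where
  "edge_pt G len e t =
     (if t = 0 then Vertex (tail G e) else if t = len e then Vertex (head G e) else Interior e t)"

text \<open>\<open>path_length G len p q r\<close>: some path from \<open>p\<close> to \<open>q\<close>, composed of finitely many
  segments of edges, has length \<open>r\<close>.\<close>

inductive path_length ::
    "('v,'e) pre_digraph \<Rightarrow> ('e \<Rightarrow> real) \<Rightarrow> ('v,'e) gpoint \<Rightarrow> ('v,'e) gpoint \<Rightarrow> real \<Rightarrow> bool"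
  for G len where
  stay: "p \<in> gpoints G len \<Longrightarrow> path_length G len p p 0"
| segment: "\<lbrakk>e \<in> arcs G; s \<in> {0..len e}; t \<in> {0..len e}; path_length G len (edge_pt G len e t) q r\<rbrakk>
    \<Longrightarrow> path_length G len (edge_pt G len e s) q (\<bar>s - t\<bar> + r)"

definition gdist ::
    "('v,'e) pre_digraph \<Rightarrow> ('e \<Rightarrow> real) \<Rightarrow> ('v,'e) gpoint \<Rightarrow> ('v,'e) gpoint \<Rightarrow> real" where
  "gdist G len p q = Inf {r. path_length G len p q r}"

definition lipschitz_graph ::
    "('v,'e) pre_digraph \<Rightarrow> ('e \<Rightarrow> real) \<Rightarrow> (('v,'e) gpoint \<Rightarrow> real) \<Rightarrow> bool" where
  "lipschitz_graph G len a \<longleftrightarrow>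
     (\<exists>C. \<forall>p\<in>gpoints G len. \<forall>q\<in>gpoints G len. \<bar>a p - a q\<bar> \<le> C * gdist G len p q)"

text \<open>Ends of edges at \<open>v\<close>: \<open>(e, False)\<close> is the end of \<open>e\<close> at \<open>0\<close>, \<open>(e, True)\<close> the end at
  \<open>len e\<close>. A loop contributes both of its ends.\<close>

definition edge_ends :: "('v,'e) pre_digraph \<Rightarrow> 'v \<Rightarrow> ('e \<times> bool) set" where
  "edge_ends G v = {(e, b). e \<in> arcs G \<and> (if b then head G e else tail G e) = v}"

definition deg :: "('v,'e) pre_digraph \<Rightarrow> 'v \<Rightarrow> nat" where
  "deg G v = card (edge_ends G v)"

section \<open>Function spaces\<close>

definition L2_on :: "real \<Rightarrow> (real \<Rightarrow> real) \<Rightarrow> bool" where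
  "L2_on l u \<longleftrightarrow> u \<in> borel_measurable (lebesgue_on {0..l}) \<and>
     integrable (lebesgue_on {0..l}) (\<lambda>x. (u x)\<^sup>2)"

text \<open>Sobolev spaces on \<open>(0, l)\<close> through weak derivatives, with \<open>C\<^sup>1\<close> test functions of
  compact support as in Brezis' textbook.\<close>

definition test_fun :: "real \<Rightarrow> (real \<Rightarrow> real) \<Rightarrow> bool" where
  "test_fun l \<phi> \<longleftrightarrow> \<phi> C1_differentiable_on UNIV \<and>
     (\<exists>s t. 0 < s \<and> t < l \<and> (\<forall>x. x \<notin> {s..t} \<longrightarrow> \<phi> x = 0))"

definition weak_deriv_on :: "real \<Rightarrow> (real \<Rightarrow> real) \<Rightarrow> (real \<Rightarrow> real) \<Rightarrow> bool" where
  "weak_deriv_on l u g \<longleftrightarrow> (\<forall>\<phi>. test_fun l \<phi> \<longrightarrow>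
     integral\<^sup>L (lebesgue_on {0..l}) (\<lambda>x. u x * deriv \<phi> x) =
     - integral\<^sup>L (lebesgue_on {0..l}) (\<lambda>x. g x * \<phi> x))"

definition H1_on :: "real \<Rightarrow> (real \<Rightarrow> real) \<Rightarrow> bool" where
  "H1_on l u \<longleftrightarrow> L2_on l u \<and> (\<exists>g. L2_on l g \<and> weak_deriv_on l u g)"

definition H2_on :: "real \<Rightarrow> (real \<Rightarrow> real) \<Rightarrow> bool" where
  "H2_on l u \<longleftrightarrow> L2_on l u \<and> (\<exists>g. H1_on l g \<and> weak_deriv_on l u g)"

text \<open>The weak derivative, determined up to a null set when \<open>u\<close> is in \<open>H\<^sup>1\<close>.\<close>

definition wderiv :: "real \<Rightarrow> (real \<Rightarrow> real) \<Rightarrow> real \<Rightarrow> real" where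
  "wderiv l u = (SOME g. L2_on l g \<and> weak_deriv_on l u g)"

text \<open>The value at \<open>t\<close> of the continuous representative of an \<open>H\<^sup>1\<close> function.\<close>

definition pt_value :: "real \<Rightarrow> (real \<Rightarrow> real) \<Rightarrow> real \<Rightarrow> real" where
  "pt_value l u t = (THE c. \<exists>w. continuous_on {0..l} w \<and>
     (AE x in lebesgue_on {0..l}. u x = w x) \<and> w t = c)"

text \<open>A (class of a) function on the graph is a family \<open>u\<close> indexed by edges, \<open>u e\<close> being a
  function on \<open>{0..len e}\<close>.\<close>

definition L2_graph :: "('v,'e) pre_digraph \<Rightarrow> ('e \<Rightarrow> real) \<Rightarrow> ('e \<Rightarrow> real \<Rightarrow> real) set" where
  "L2_graph G len = {u. \<forall>e\<in>arcs G. L2_on (len e) (u e)}"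

definition ae_eq ::
    "('v,'e) pre_digraph \<Rightarrow> ('e \<Rightarrow> real) \<Rightarrow> ('e \<Rightarrow> real \<Rightarrow> real) \<Rightarrow> ('e \<Rightarrow> real \<Rightarrow> real) \<Rightarrow> bool" where
  "ae_eq G len u w \<longleftrightarrow> (\<forall>e\<in>arcs G. AE x in lebesgue_on {0..len e}. u e x = w e x)"

definition L2_inner ::
    "('v,'e) pre_digraph \<Rightarrow> ('e \<Rightarrow> real) \<Rightarrow> ('e \<Rightarrow> real \<Rightarrow> real) \<Rightarrow> ('e \<Rightarrow> real \<Rightarrow> real) \<Rightarrow> real" where
  "L2_inner G len u w =
     (\<Sum>e\<in>arcs G. integral\<^sup>L (lebesgue_on {0..len e}) (\<lambda>x. u e x * w e x))"

definition L2_norm :: "('v,'e) pre_digraph \<Rightarrow> ('e \<Rightarrow> real) \<Rightarrow> ('e \<Rightarrow> real \<Rightarrow> real) \<Rightarrow> real" where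
  "L2_norm G len u = sqrt (L2_inner G len u u)"

definition L2_sums :: "('v,'e) pre_digraph \<Rightarrow> ('e \<Rightarrow> real) \<Rightarrow>
    (nat \<Rightarrow> 'e \<Rightarrow> real \<Rightarrow> real) \<Rightarrow> ('e \<Rightarrow> real \<Rightarrow> real) \<Rightarrow> bool" where
  "L2_sums G len w u \<longleftrightarrow>
     (\<lambda>n. L2_norm G len (\<lambda>e x. u e x - (\<Sum>k<n. w k e x))) \<longlonglongrightarrow> 0"

section \<open>Vertex conditions\<close>

text \<open>\<open>enum v\<close> enumerates the edge ends at \<open>v\<close>; it fixes the identification of functions on
  these ends with vectors of dimension \<open>deg G v\<close>.\<close>

definition end_value :: "('e \<Rightarrow> real) \<Rightarrow> ('e \<Rightarrow> real \<Rightarrow> real) \<Rightarrow> 'e \<times> bool \<Rightarrow> real" where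
  "end_value len u = (\<lambda>(e, b). pt_value (len e) (u e) (if b then len e else 0))"

definition end_deriv :: "('e \<Rightarrow> real) \<Rightarrow> ('e \<Rightarrow> real \<Rightarrow> real) \<Rightarrow> 'e \<times> bool \<Rightarrow> real" where
  "end_deriv len u = (\<lambda>(e, b).
     if b then - pt_value (len e) (wderiv (len e) (u e)) (len e)
     else pt_value (len e) (wderiv (len e) (u e)) 0)"

definition F_vec :: "('v,'e) pre_digraph \<Rightarrow> ('e \<Rightarrow> real) \<Rightarrow> ('v \<Rightarrow> nat \<Rightarrow> 'e \<times> bool) \<Rightarrow>
    ('e \<Rightarrow> real \<Rightarrow> real) \<Rightarrow> 'v \<Rightarrow> real Matrix.vec" where
  "F_vec G len enum u v = Matrix.vec (deg G v) (\<lambda>i. end_value len u (enum v i))"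

definition F'_vec :: "('v,'e) pre_digraph \<Rightarrow> ('e \<Rightarrow> real) \<Rightarrow> ('v \<Rightarrow> nat \<Rightarrow> 'e \<times> bool) \<Rightarrow>
    ('e \<Rightarrow> real \<Rightarrow> real) \<Rightarrow> 'v \<Rightarrow> real Matrix.vec" where
  "F'_vec G len enum u v = Matrix.vec (deg G v) (\<lambda>i. end_deriv len u (enum v i))"

definition range_mat :: "real Matrix.mat \<Rightarrow> real Matrix.vec set" where
  "range_mat M = (\<lambda>x. mult_mat_vec M x) ` carrier_vec (dim_col M)"

definition orth_proj :: "real Matrix.vec set \<Rightarrow> real Matrix.vec \<Rightarrow> real Matrix.vec" where
  "orth_proj W x = (THE y. y \<in> W \<and> (\<forall>w\<in>W. scalar_prod (x - y) w = 0))"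

text \<open>\<open>part_inv B\<close> is the inverse of \<open>Q\<^sub>1 B Q\<close> as a map from \<open>R = range B\<^sup>T\<close> to
  \<open>R\<^sub>1 = range B\<close>, with \<open>Q\<close>, \<open>Q\<^sub>1\<close> the orthogonal projections onto \<open>R\<close>, \<open>R\<^sub>1\<close>.\<close>

definition part_inv :: "real Matrix.mat \<Rightarrow> real Matrix.vec \<Rightarrow> real Matrix.vec" where
  "part_inv B = inv_into (range_mat (transpose_mat B))
     (\<lambda>y. orth_proj (range_mat B) (mult_mat_vec B (orth_proj (range_mat (transpose_mat B)) y)))"

text \<open>To be used on \<open>range_mat (transpose_mat B)\<close> only.\<close>

definition Lam :: "real Matrix.mat \<Rightarrow> real Matrix.mat \<Rightarrow> real Matrix.vec \<Rightarrow> real Matrix.vec" where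
  "Lam A B y = part_inv B (mult_mat_vec A y)"

definition vnorm :: "real Matrix.vec \<Rightarrow> real" where
  "vnorm x = sqrt (scalar_prod x x)"

definition Lam_norm :: "real Matrix.mat \<Rightarrow> real Matrix.mat \<Rightarrow> real" where
  "Lam_norm A B = Sup {vnorm (Lam A B y) | y. y \<in> range_mat (transpose_mat B) \<and> vnorm y \<le> 1}"

definition Lam_nonpos :: "real Matrix.mat \<Rightarrow> real Matrix.mat \<Rightarrow> bool" where
  "Lam_nonpos A B \<longleftrightarrow> (\<forall>y\<in>range_mat (transpose_mat B). scalar_prod (Lam A B y) y \<le> 0)"

definition max_rank :: "nat \<Rightarrow> real Matrix.mat \<Rightarrow> real Matrix.mat \<Rightarrow> bool" where
  "max_rank d A B \<longleftrightarrow> vec_space.rank d (mat_of_cols d (cols A @ cols B)) = d"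

definition admissible_vertex_conditions :: "('v,'e) pre_digraph \<Rightarrow>
    ('v \<Rightarrow> real Matrix.mat) \<Rightarrow> ('v \<Rightarrow> real Matrix.mat) \<Rightarrow> bool" where
  "admissible_vertex_conditions G A B \<longleftrightarrow> (\<forall>v\<in>verts G.
     A v \<in> carrier_mat (deg G v) (deg G v) \<and> B v \<in> carrier_mat (deg G v) (deg G v) \<and>
     max_rank (deg G v) (A v) (B v) \<and>
     transpose_mat (A v * transpose_mat (B v)) = A v * transpose_mat (B v))"

section \<open>The operator and its fractional powers\<close>

definition dom_L :: "('v,'e) pre_digraph \<Rightarrow> ('e \<Rightarrow> real) \<Rightarrow> ('v \<Rightarrow> nat \<Rightarrow> 'e \<times> bool) \<Rightarrow>
    (('v,'e) gpoint \<Rightarrow> real) \<Rightarrow> ('v \<Rightarrow> real Matrix.mat) \<Rightarrow> ('v \<Rightarrow> real Matrix.mat) \<Rightarrow>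
    ('e \<Rightarrow> real \<Rightarrow> real) set" where
  "dom_L G len enum a A B = {u. (\<forall>e\<in>arcs G. H2_on (len e) (u e)) \<and>
     (\<forall>v\<in>verts G. mult_mat_vec (A v) (F_vec G len enum u v) +
        smult_vec (a (Vertex v)) (mult_mat_vec (B v) (F'_vec G len enum u v)) = 0\<^sub>v (deg G v))}"

definition op_L :: "('v,'e) pre_digraph \<Rightarrow> ('e \<Rightarrow> real) \<Rightarrow> (('v,'e) gpoint \<Rightarrow> real) \<Rightarrow>
    ('e \<Rightarrow> real \<Rightarrow> real) \<Rightarrow> ('e \<Rightarrow> real \<Rightarrow> real) \<Rightarrow> 'e \<Rightarrow> real \<Rightarrow> real" where
  "op_L G len a \<kappa> u = (\<lambda>e x.
     - wderiv (len e) (\<lambda>t. a (edge_pt G len e t) * wderiv (len e) (u e) t) x + (\<kappa> e x)\<^sup>2 * u e x)"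

definition orthonormal_basis :: "('v,'e) pre_digraph \<Rightarrow> ('e \<Rightarrow> real) \<Rightarrow>
    (nat \<Rightarrow> 'e \<Rightarrow> real \<Rightarrow> real) \<Rightarrow> bool" where
  "orthonormal_basis G len b \<longleftrightarrow> (\<forall>k. b k \<in> L2_graph G len) \<and>
     (\<forall>j k. L2_inner G len (b j) (b k) = (if j = k then 1 else 0)) \<and>
     (\<forall>u\<in>L2_graph G len. L2_sums G len (\<lambda>k e x. L2_inner G len u (b k) * b k e x) u)"

definition eigenbasis :: "('v,'e) pre_digraph \<Rightarrow> ('e \<Rightarrow> real) \<Rightarrow> ('v \<Rightarrow> nat \<Rightarrow> 'e \<times> bool) \<Rightarrow>
    (('v,'e) gpoint \<Rightarrow> real) \<Rightarrow> ('e \<Rightarrow> real \<Rightarrow> real) \<Rightarrow>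
    ('v \<Rightarrow> real Matrix.mat) \<Rightarrow> ('v \<Rightarrow> real Matrix.mat) \<Rightarrow>
    (nat \<Rightarrow> 'e \<Rightarrow> real \<Rightarrow> real) \<Rightarrow> (nat \<Rightarrow> real) \<Rightarrow> bool" where
  "eigenbasis G len enum a \<kappa> A B b lam \<longleftrightarrow> orthonormal_basis G len b \<and>
     (\<forall>k. 0 < lam k \<and> b k \<in> dom_L G len enum a A B \<and>
        ae_eq G len (op_L G len a \<kappa> (b k)) (\<lambda>e x. lam k * b k e x))"

definition Hdot :: "('v,'e) pre_digraph \<Rightarrow> ('e \<Rightarrow> real) \<Rightarrow>
    (nat \<Rightarrow> 'e \<Rightarrow> real \<Rightarrow> real) \<Rightarrow> (nat \<Rightarrow> real) \<Rightarrow> real \<Rightarrow> ('e \<Rightarrow> real \<Rightarrow> real) set" where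
  "Hdot G len b lam s = {u \<in> L2_graph G len. summable (\<lambda>k. lam k powr s * (L2_inner G len u (b k))\<^sup>2)}"

definition frac_power_eq :: "('v,'e) pre_digraph \<Rightarrow> ('e \<Rightarrow> real) \<Rightarrow>
    (nat \<Rightarrow> 'e \<Rightarrow> real \<Rightarrow> real) \<Rightarrow> (nat \<Rightarrow> real) \<Rightarrow> real \<Rightarrow>
    ('e \<Rightarrow> real \<Rightarrow> real) \<Rightarrow> ('e \<Rightarrow> real \<Rightarrow> real) \<Rightarrow> bool" where
  "frac_power_eq G len b lam \<beta> u f \<longleftrightarrow>
     L2_sums G len (\<lambda>k e x. lam k powr \<beta> * L2_inner G len u (b k) * b k e x) f"

end

(*  Eigenfunctions are obtained variationally. On the space of edgewise absolutely continuous
    functions with square integrable derivative whose boundary values lie in the ranges of the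
    B_v^T, the form int a u' w' + kappa^2 u w - sum_v (Lambda_v F(v), F(v)) is coercive: under (A2)
    trivially, under (A1) by a trace inequality. Its unit balls are precompact in L_2 by
    Arzela-Ascoli, so it can be minimised successively on orthogonal complements. The minimisers
    satisfy the weak eigenvalue equation; testing with bumps inside the edges gives their
    regularity, and testing with prescribed boundary values gives the vertex conditions, since
    A_v F + a B_v F' = 0 says that F is in the range of B_v^T and that aF' + Lambda_v F is
    orthogonal to this range. Conversely the eigenvalues of any eigenbasis are values of the
    form on unit vectors and hence bounded below by a positive constant, so the coefficients
    lambda_k^(-beta) (f, e_k) are square summable and define the solution. *)

theory Submission
  imports Defs "HOL-Complex_Analysis.Great_Picard" "HOL-Library.Function_Algebras"
begin

text \<open>Functions are never identified up to null sets. An element of L2 is a plain function, so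
  functions carry the pointwise vector space structure, every scalar product is only positive
  semidefinite, and in the abstract part equality of classes is the vanishing of
  \<open>ip (x - y) (x - y)\<close>. Weak derivatives and point values come from choice operators;
  statements about them are moved to pairs (u, g) in which u is literally the primitive of g, so
  that u has genuine boundary values.

  The constants of (A1) come from averaging over an interval of length s next to an end p of an
  edge: \<open>u(p)^2 \<le> (2/s) |u|^2 + s |u'|^2\<close>. An edge has two ends, so with s its
  length l the vertex terms cost at most \<open>(4S/l) |u|^2 + 2Sl |u'|^2\<close>. The second
  condition of (A1) permits equality, which would use up the whole gradient term; a slightly smaller
  s repairs this at the expense of the first condition, which is strict.\<close>

instantiation "fun" :: (type, real_vector) real_vector
begin

definition "scaleR c f = (\<lambda>x. c *\<^sub>R f x)"

instance
  by standard (simp_all add: scaleR_fun_def fun_eq_iff scaleR_add_right scaleR_add_left)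

end

lemma scaleR_fun_apply [simp]: "(c *\<^sub>R f) x = c *\<^sub>R f x"
  by (simp add: scaleR_fun_def)

lemma sum_fun_apply [simp]: "(\<Sum>i\<in>I. f i) x = (\<Sum>i\<in>I. f i x)"
  by (induction I rule: infinite_finite_induct) auto

section \<open>Semi-inner products\<close>

text \<open>The form lives on a subspace of a type rather than on a type, and it may vanish on
  nonzero vectors. Typical instances are functions that differ on a null set, index functions of
  which only the first \<open>d\<close> values count, and pairs of which only the first component is
  seen.\<close>

locale semi_inner =
  fixes V :: "'a::real_vector set" and ip :: "'a \<Rightarrow> 'a \<Rightarrow> real"
  assumes subsp: "Real_Vector_Spaces.subspace V"
    and sym: "\<lbrakk>x \<in> V; y \<in> V\<rbrakk> \<Longrightarrow> ip x y = ip y x"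
    and add_left: "\<lbrakk>x \<in> V; y \<in> V; z \<in> V\<rbrakk> \<Longrightarrow> ip (x + y) z = ip x z + ip y z"
    and scale_left: "\<lbrakk>x \<in> V; y \<in> V\<rbrakk> \<Longrightarrow> ip (c *\<^sub>R x) y = c * ip x y"
    and nonneg: "x \<in> V \<Longrightarrow> 0 \<le> ip x x"
begin

lemma mem [simp, intro]:
  "0 \<in> V" "x \<in> V \<Longrightarrow> y \<in> V \<Longrightarrow> x + y \<in> V" "x \<in> V \<Longrightarrow> c *\<^sub>R x \<in> V"
  "x \<in> V \<Longrightarrow> y \<in> V \<Longrightarrow> x - y \<in> V" "(\<And>i. i \<in> I \<Longrightarrow> f i \<in> V) \<Longrightarrow> sum f I \<in> V"
  using subsp by (auto simp: Real_Vector_Spaces.subspace_def real_vector.subspace_diff real_vector.subspace_sum)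

lemma add_right: "\<lbrakk>x \<in> V; y \<in> V; z \<in> V\<rbrakk> \<Longrightarrow> ip z (x + y) = ip z x + ip z y"
  using add_left[of x y z] by (simp add: sym[of z])

lemma scale_right: "\<lbrakk>x \<in> V; y \<in> V\<rbrakk> \<Longrightarrow> ip y (c *\<^sub>R x) = c * ip y x"
  using scale_left[of x y c] by (simp add: sym[of y])

lemma diff_left: "\<lbrakk>x \<in> V; y \<in> V; z \<in> V\<rbrakk> \<Longrightarrow> ip (x - y) z = ip x z - ip y z"
  using add_left[of x "(-1) *\<^sub>R y" z] scale_left[of y z "-1"] mem(3)[of y "-1"] by simp

lemma diff_right: "\<lbrakk>x \<in> V; y \<in> V; z \<in> V\<rbrakk> \<Longrightarrow> ip z (x - y) = ip z x - ip z y"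
  using diff_left[of x y z] by (simp add: sym[of z])

lemma zero_left: "x \<in> V \<Longrightarrow> ip 0 x = 0"
  using scale_left[of x x 0] by simp

lemma sum_left: "\<lbrakk>\<And>i. i \<in> I \<Longrightarrow> f i \<in> V; z \<in> V\<rbrakk> \<Longrightarrow> ip (sum f I) z = (\<Sum>i\<in>I. ip (f i) z)"
  by (induction I rule: infinite_finite_induct) (auto simp: zero_left add_left)

lemma sum_right: "\<lbrakk>\<And>i. i \<in> I \<Longrightarrow> f i \<in> V; z \<in> V\<rbrakk> \<Longrightarrow> ip z (sum f I) = (\<Sum>i\<in>I. ip z (f i))"
  using sum_left[of I f z] by (subst sym) (auto simp: sym[of z] intro!: sum.cong)

lemmas bilin = add_left add_right scale_left scale_right diff_left diff_right

lemma sq_add: "\<lbrakk>x \<in> V; y \<in> V\<rbrakk> \<Longrightarrow> ip (x + y) (x + y) = ip x x + 2 * ip x y + ip y y"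
  using sym[of x y] by (simp add: bilin)

lemma sq_diff: "\<lbrakk>x \<in> V; y \<in> V\<rbrakk> \<Longrightarrow> ip (x - y) (x - y) = ip x x - 2 * ip x y + ip y y"
  using sym[of x y] by (simp add: bilin)

lemma sq_scale: "x \<in> V \<Longrightarrow> ip (c *\<^sub>R x) (c *\<^sub>R x) = c\<^sup>2 * ip x x"
  by (simp add: bilin power2_eq_square)

lemma sq_add_le: "\<lbrakk>x \<in> V; y \<in> V\<rbrakk> \<Longrightarrow> ip (x + y) (x + y) \<le> 2 * ip x x + 2 * ip y y"
  using nonneg[of "x - y"] by (simp add: sq_add sq_diff)

lemma sq_diff_le: "\<lbrakk>x \<in> V; y \<in> V\<rbrakk> \<Longrightarrow> ip (x - y) (x - y) \<le> 2 * ip x x + 2 * ip y y"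
  using nonneg[of "x + y"] by (simp add: sq_add sq_diff)

lemma sq_diff_commute: "\<lbrakk>x \<in> V; y \<in> V\<rbrakk> \<Longrightarrow> ip (x - y) (x - y) = ip (y - x) (y - x)"
  using sym[of x y] by (simp add: sq_diff)

lemma Cauchy_Schwarz:
  assumes "x \<in> V" "y \<in> V"
  shows "(ip x y)\<^sup>2 \<le> ip x x * ip y y"
proof (cases "ip y y = 0")
  case True
  have "0 \<le> ip x x + 2 * t * ip x y" for t
    using nonneg[of "x + t *\<^sub>R y"] assms True sym[OF assms] by (simp add: sq_add bilin sq_scale)
  \<comment> \<open>A null vector \<open>y\<close> need not be zero, so this case is not trivial.
    The squared seminorm of \<open>x + t *\<^sub>R y\<close> is affine in \<open>t\<close>, and the
    chosen \<open>t\<close> would make it \<open>- ip x x - 2\<close>.\<close>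
  from this[of "- (ip x x + 1) / ip x y"] nonneg[OF assms(1)] have "ip x y = 0"
    by (cases "ip x y = 0") auto
  then show ?thesis by (simp add: True)
next
  case False
  then have pos: "ip y y > 0" using nonneg[OF assms(2)] by simp
  have "0 \<le> ip (ip y y *\<^sub>R x - ip x y *\<^sub>R y) (ip y y *\<^sub>R x - ip x y *\<^sub>R y)"
    using assms by (intro nonneg) auto
  also have "\<dots> = ip y y * (ip x x * ip y y - (ip x y)\<^sup>2)"
    using assms sym[OF assms]
    by (simp add: sq_diff sq_scale bilin) (simp add: power2_eq_square algebra_simps)
  finally show ?thesis using pos by (simp add: zero_le_mult_iff)
qed

lemma null_left: "\<lbrakk>x \<in> V; y \<in> V; ip x x = 0\<rbrakk> \<Longrightarrow> ip x y = 0"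
  using Cauchy_Schwarz[of x y] by simp

lemma null_right: "\<lbrakk>x \<in> V; y \<in> V; ip y y = 0\<rbrakk> \<Longrightarrow> ip x y = 0"
  using Cauchy_Schwarz[of x y] by simp

lemma tendsto_left:
  assumes V: "\<And>n. f n \<in> V" "x \<in> V" "y \<in> V"
    and lim: "(\<lambda>n. ip (f n - x) (f n - x)) \<longlonglongrightarrow> 0"
  shows "(\<lambda>n. ip (f n) y) \<longlonglongrightarrow> ip x y"
proof -
  have "(\<lambda>n. (ip (f n - x) y)\<^sup>2) \<longlonglongrightarrow> 0"
  proof (rule tendsto_sandwich[OF _ _ tendsto_const])
    show "\<forall>\<^sub>F n in sequentially. 0 \<le> (ip (f n - x) y)\<^sup>2" by simp
    show "\<forall>\<^sub>F n in sequentially. (ip (f n - x) y)\<^sup>2 \<le> ip (f n - x) (f n - x) * ip y y"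
      using V by (intro always_eventually allI Cauchy_Schwarz) auto
    show "(\<lambda>n. ip (f n - x) (f n - x) * ip y y) \<longlonglongrightarrow> 0"
      using tendsto_mult_left_zero[OF lim] by simp
  qed
  then have "(\<lambda>n. ip (f n - x) y) \<longlonglongrightarrow> 0" by simp
  then show ?thesis using V by (simp add: diff_left LIM_zero_iff)
qed

lemma tendsto_sq:
  assumes V: "\<And>n. f n \<in> V" "x \<in> V"
    and lim: "(\<lambda>n. ip (f n - x) (f n - x)) \<longlonglongrightarrow> 0"
  shows "(\<lambda>n. ip (f n) (f n)) \<longlonglongrightarrow> ip x x"
proof -
  have "(\<lambda>n. ip (f n - x) (f n - x) + 2 * ip (f n) x - ip x x) \<longlonglongrightarrow> 0 + 2 * ip x x - ip x x"
    by (intro tendsto_intros lim tendsto_left V)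
  then show ?thesis using V by (simp add: sq_diff)
qed

text \<open>Only the first \<open>n\<close> terms of a sequence are constrained, so that partially
  built systems in a recursion and complete sequences (the case of all \<open>n\<close>) are covered
  by one notion.\<close>

definition orthonormal_upto :: "nat \<Rightarrow> (nat \<Rightarrow> 'a) \<Rightarrow> bool" where
  "orthonormal_upto n b \<longleftrightarrow> (\<forall>j<n. b j \<in> V) \<and> (\<forall>j<n. \<forall>k<n. ip (b j) (b k) = (if j = k then 1 else 0))"

definition residual :: "nat \<Rightarrow> (nat \<Rightarrow> 'a) \<Rightarrow> 'a \<Rightarrow> 'a" where
  "residual n b u = u - (\<Sum>k<n. ip u (b k) *\<^sub>R b k)"

lemma residual_in [intro]: "orthonormal_upto n b \<Longrightarrow> u \<in> V \<Longrightarrow> residual n b u \<in> V"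
  unfolding residual_def orthonormal_upto_def by auto

lemma orthonormal_sum:
  assumes "orthonormal_upto n b" "j < n"
  shows "ip (\<Sum>k<n. c k *\<^sub>R b k) (b j) = c j"
proof -
  have "ip (\<Sum>k<n. c k *\<^sub>R b k) (b j) = (\<Sum>k<n. c k * (if k = j then 1 else 0))"
    using assms unfolding orthonormal_upto_def by (subst sum_left) (auto simp: scale_left intro!: sum.cong)
  also have "\<dots> = c j" using assms(2) by (simp add: if_distrib cong: if_cong)
  finally show ?thesis .
qed

lemma orthonormal_sum_sq:
  assumes "orthonormal_upto n b"
  shows "ip (\<Sum>k<n. c k *\<^sub>R b k) (\<Sum>k<n. c k *\<^sub>R b k) = (\<Sum>k<n. (c k)\<^sup>2)"
proof -
  have V: "\<And>j. j < n \<Longrightarrow> b j \<in> V" using assms unfolding orthonormal_upto_def by auto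
  have "ip (\<Sum>k<n. c k *\<^sub>R b k) (\<Sum>k<n. c k *\<^sub>R b k) = (\<Sum>j<n. ip (\<Sum>k<n. c k *\<^sub>R b k) (c j *\<^sub>R b j))"
    using V by (intro sum_right) auto
  also have "\<dots> = (\<Sum>j<n. (c j)\<^sup>2)"
    using V orthonormal_sum[OF assms]
    by (intro sum.cong refl) (subst scale_right, auto simp: power2_eq_square)
  finally show ?thesis .
qed

lemma residual_orth:
  assumes "orthonormal_upto n b" "u \<in> V" "j < n"
  shows "ip (residual n b u) (b j) = 0"
  using assms orthonormal_sum[OF assms(1,3)] unfolding residual_def
  by (subst diff_left) (auto simp: orthonormal_upto_def)

lemma residual_sq:
  assumes "orthonormal_upto n b" "u \<in> V"
  shows "ip (residual n b u) (residual n b u) = ip u u - (\<Sum>k<n. (ip u (b k))\<^sup>2)"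
proof -
  have V: "\<And>j. j < n \<Longrightarrow> b j \<in> V" using assms unfolding orthonormal_upto_def by auto
  have "ip u (\<Sum>k<n. ip u (b k) *\<^sub>R b k) = (\<Sum>k<n. (ip u (b k))\<^sup>2)"
    using V assms by (subst sum_right) (auto simp: scale_right power2_eq_square intro!: sum.cong)
  then show ?thesis
    using V assms orthonormal_sum_sq[OF assms(1)] unfolding residual_def by (subst sq_diff) auto
qed

lemma Bessel:
  assumes "orthonormal_upto n b" "u \<in> V"
  shows "(\<Sum>k<n. (ip u (b k))\<^sup>2) \<le> ip u u"
  using residual_sq[OF assms] nonneg[of "residual n b u"] residual_in[OF assms] by simp

lemma Bessel_summable:
  assumes "\<And>n. orthonormal_upto n b" "u \<in> V"
  shows "summable (\<lambda>k. (ip u (b k))\<^sup>2)"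
  using Bessel[OF assms] by (intro summableI_nonneg_bounded[where x="ip u u"]) auto

text \<open>For a degenerate form a vector in the span need not equal its expansion; only the
  seminorm of its residual vanishes. The result later supplies orthonormal bases of the boundary
  spaces at the vertices.\<close>

lemma Gram_Schmidt:
  assumes "finite X" "X \<subseteq> V"
  obtains n b where "orthonormal_upto n b" "\<And>k. k < n \<Longrightarrow> b k \<in> Real_Vector_Spaces.span X"
    "\<And>x. x \<in> Real_Vector_Spaces.span X \<Longrightarrow> ip (residual n b x) (residual n b x) = 0"
proof -
  have "\<exists>n b. orthonormal_upto n b \<and> (\<forall>k<n. b k \<in> Real_Vector_Spaces.span X) \<and>
      (\<forall>x\<in>Real_Vector_Spaces.span X. ip (residual n b x) (residual n b x) = 0)"
    using assms
  proof (induction X)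
    case empty
    show ?case
      by (rule exI[of _ 0]) (auto simp: orthonormal_upto_def residual_def zero_left)
  next
    case (insert v X)
    then obtain n b where b: "orthonormal_upto n b" "\<forall>k<n. b k \<in> Real_Vector_Spaces.span X"
      "\<forall>x\<in>Real_Vector_Spaces.span X. ip (residual n b x) (residual n b x) = 0" and v: "v \<in> V" by auto
    have bV: "b k \<in> V" if "k < n" for k using b that unfolding orthonormal_upto_def by auto
    have spX: "Real_Vector_Spaces.span X \<subseteq> V" using insert subsp by (simp add: real_vector.span_minimal)
    have spvX: "Real_Vector_Spaces.span (insert v X) \<subseteq> V" using insert subsp by (simp add: real_vector.span_minimal)
    define r where "r = residual n b v"
    have rV: "r \<in> V" unfolding r_def using b v by auto
    \<comment> \<open>Taking residuals is linear. As the residual of \<open>x\<close> in the old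
      span is null, the residual of \<open>x + c *\<^sub>R v\<close> is \<open>c *\<^sub>R r\<close>
      up to a null vector, and everything depends on whether \<open>r\<close> is null.\<close>
    have res_add: "residual n b (x + c *\<^sub>R v) = residual n b x + c *\<^sub>R r" if "x \<in> V" for x c
      using that v bV unfolding residual_def r_def
      by (simp add: bilin algebra_simps sum.distrib scaleR_sum_right)
    have dec: "\<exists>x\<in>Real_Vector_Spaces.span X. \<exists>c. y = x + c *\<^sub>R v" if "y \<in> Real_Vector_Spaces.span (insert v X)" for y
      using that unfolding real_vector.span_insert by force
    have sp_mono: "Real_Vector_Spaces.span X \<subseteq> Real_Vector_Spaces.span (insert v X)" by (simp add: real_vector.span_mono subset_insertI)
    show ?case
    proof (cases "ip r r = 0")
      case True
      have "ip (residual n b y) (residual n b y) = 0" if "y \<in> Real_Vector_Spaces.span (insert v X)" for y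
      proof -
        obtain x c where x: "x \<in> Real_Vector_Spaces.span X" "y = x + c *\<^sub>R v" using dec[OF \<open>y \<in> _\<close>] by blast
        have xV: "x \<in> V" using x spX by auto
        have rx: "residual n b x \<in> V" using b xV by auto
        have "ip (residual n b x) r = 0" using null_right[OF rx rV True] .
        then show ?thesis using x xV rx rV True b(3) res_add sym[OF rx rV] by (simp add: sq_add bilin)
      qed
      then show ?thesis using b sp_mono by blast
    next
      case False
      then have pos: "ip r r > 0" using nonneg[OF rV] by simp
      define s where "s = (1 / sqrt (ip r r)) *\<^sub>R r"
      have sV: "s \<in> V" unfolding s_def using rV by auto
      have ss: "ip s s = 1" unfolding s_def using pos rV by (simp add: sq_scale power_divide)
      have sb: "ip s (b k) = 0" if "k < n" for k
        unfolding s_def using rV bV[OF that] residual_orth[OF b(1) v that] by (simp add: scale_left r_def)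
      define b' where "b' = b(n := s)"
      have on: "orthonormal_upto (Suc n) b'"
        using b(1) sV ss sb sym[OF sV bV] unfolding orthonormal_upto_def b'_def
        by (auto simp: less_Suc_eq)
      have "r \<in> Real_Vector_Spaces.span (insert v X)"
        unfolding r_def residual_def using b(2) sp_mono
        by (intro real_vector.span_diff real_vector.span_sum real_vector.span_scale) (auto simp: real_vector.span_base)
      then have "\<forall>k<Suc n. b' k \<in> Real_Vector_Spaces.span (insert v X)"
        using b(2) sp_mono by (auto simp: b'_def less_Suc_eq s_def real_vector.span_scale)
      moreover have "ip (residual (Suc n) b' y) (residual (Suc n) b' y) = 0"
        if "y \<in> Real_Vector_Spaces.span (insert v X)" for y
      proof -
        obtain x c where x: "x \<in> Real_Vector_Spaces.span X" "y = x + c *\<^sub>R v" using dec[OF \<open>y \<in> _\<close>] by blast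
        have xV: "x \<in> V" using x spX by auto
        have yV: "y \<in> V" using that spvX by auto
        have rx: "residual n b x \<in> V" using b xV by auto
        have "ip (residual n b x) r = 0" using null_left[OF rx rV] b(3) x by auto
        then have y2: "ip (residual n b y) (residual n b y) = c\<^sup>2 * ip r r"
          using x xV rx rV b(3) res_add sym[OF rx rV] by (simp add: sq_add bilin power2_eq_square)
        have "ip (residual n b y) r = c * ip r r"
          using x xV rx rV b(3) res_add \<open>ip (residual n b x) r = 0\<close> by (simp add: bilin)
        moreover have "ip (residual n b y) r = ip y r"
        proof -
          have "ip (b k) r = 0" if "k < n" for k
            using residual_orth[OF b(1) v that] sym[OF bV[OF that] rV] by (simp add: r_def)
          then have "ip (\<Sum>k<n. ip y (b k) *\<^sub>R b k) r = 0"
            using bV rV by (subst sum_left) (auto simp: scale_left)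
          then show ?thesis using bV yV rV unfolding residual_def by (subst diff_left) auto
        qed
        \<comment> \<open>The coefficient along the new vector \<open>s\<close> removes exactly the
          \<open>c\<^sup>2 * ip r r\<close> that the old residual left over.\<close>
        ultimately have "ip y s = c * sqrt (ip r r)"
          unfolding s_def using yV rV pos by (simp add: scale_right field_simps)
        then have "(ip y s)\<^sup>2 = c\<^sup>2 * ip r r" using pos by (simp add: power_mult_distrib)
        moreover have "(\<Sum>k<n. (ip y (b' k))\<^sup>2) = (\<Sum>k<n. (ip y (b k))\<^sup>2)"
          by (intro sum.cong) (auto simp: b'_def)
        ultimately show ?thesis
          using residual_sq[OF on yV] residual_sq[OF b(1) yV] y2 by (simp add: b'_def)
      qed
      ultimately show ?thesis using on by blast
    qed
  qed
  then show thesis using that by blast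
qed

end

text \<open>Completeness is stated for the squared seminorm, which avoids square roots.\<close>

locale complete_semi_inner = semi_inner +
  assumes complete: "\<lbrakk>\<And>n. f n \<in> V;
      \<And>e. 0 < e \<Longrightarrow> \<exists>N. \<forall>m\<ge>N. \<forall>n\<ge>N. ip (f m - f n) (f m - f n) < e\<rbrakk>
    \<Longrightarrow> \<exists>x\<in>V. (\<lambda>n. ip (f n - x) (f n - x)) \<longlonglongrightarrow> 0"
begin

text \<open>The squared distance of two partial sums is a block of the convergent series of
  \<open>(c k)\<^sup>2\<close>, so the partial sums are Cauchy; the coefficients of the limit are
  read off by continuity of \<open>ip\<close>.\<close>

lemma Riesz_Fischer:
  assumes on: "\<And>n. orthonormal_upto n b" and c: "summable (\<lambda>k. (c k)\<^sup>2)"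
  obtains u where "u \<in> V" "\<And>k. ip u (b k) = c k"
    "(\<lambda>n. ip (u - (\<Sum>k<n. c k *\<^sub>R b k)) (u - (\<Sum>k<n. c k *\<^sub>R b k))) \<longlonglongrightarrow> 0"
proof -
  have bV: "b k \<in> V" for k using on[of "Suc k"] unfolding orthonormal_upto_def by auto
  define s where "s n = (\<Sum>k<n. c k *\<^sub>R b k)" for n
  have sV: "s n \<in> V" for n unfolding s_def using bV by auto
  have diff: "ip (s n - s m) (s n - s m) = (\<Sum>k=m..<n. (c k)\<^sup>2)" if "m \<le> n" for m n
  proof -
    \<comment> \<open>Padding the coefficients with zeros below \<open>m\<close> turns the
      difference into a single sum over \<open>k < n\<close>, to which
      \<open>orthonormal_sum_sq\<close> applies.\<close>
    have "s n - s m = (\<Sum>k<n. (if k < m then 0 else c k) *\<^sub>R b k)"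
    proof -
      have "s m = (\<Sum>k<n. if k < m then c k *\<^sub>R b k else 0)"
        unfolding s_def by (rule sum.mono_neutral_cong_left) (use that in auto)
      then show ?thesis unfolding s_def by (auto simp flip: sum_subtractf intro!: sum.cong)
    qed
    then have "ip (s n - s m) (s n - s m) = (\<Sum>k<n. (if k < m then 0 else c k)\<^sup>2)"
      using orthonormal_sum_sq[OF on] by simp
    also have "\<dots> = (\<Sum>k=m..<n. (c k)\<^sup>2)"
      by (rule sum.mono_neutral_cong_right) (use that in auto)
    finally show ?thesis .
  qed
  have "\<exists>x\<in>V. (\<lambda>n. ip (s n - x) (s n - x)) \<longlonglongrightarrow> 0"
  proof (rule complete[OF sV])
    fix e :: real assume "0 < e"
    from c[unfolded summable_Cauchy, rule_format, OF this] obtain N where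
      N: "\<And>m n. m \<ge> N \<Longrightarrow> norm (\<Sum>k=m..<n. (c k)\<^sup>2) < e" by blast
    have "ip (s m - s n) (s m - s n) < e" if "m \<ge> N" "n \<ge> N" for m n
    proof (cases "m \<le> n")
      case True
      then show ?thesis using N[OF that(1), of n] diff[OF True] sq_diff_commute[OF sV sV, of m n] by simp
    next
      case False
      then show ?thesis using N[OF that(2), of m] diff[of n m] by simp
    qed
    then show "\<exists>N. \<forall>m\<ge>N. \<forall>n\<ge>N. ip (s m - s n) (s m - s n) < e" by blast
  qed
  then obtain u where u: "u \<in> V" "(\<lambda>n. ip (s n - u) (s n - u)) \<longlonglongrightarrow> 0" by blast
  have "ip u (b k) = c k" for k
  proof (rule LIMSEQ_unique)
    show "(\<lambda>n. ip (s n) (b k)) \<longlonglongrightarrow> ip u (b k)" by (rule tendsto_left[OF sV u(1) bV u(2)])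
    have "\<forall>\<^sub>F n in sequentially. ip (s n) (b k) = c k"
      using eventually_gt_at_top[of k] by eventually_elim (simp add: s_def orthonormal_sum[OF on])
    then show "(\<lambda>n. ip (s n) (b k)) \<longlonglongrightarrow> c k" by (rule tendsto_eventually)
  qed
  moreover have "(\<lambda>n. ip (u - s n) (u - s n)) \<longlonglongrightarrow> 0"
    using u by (simp add: sq_diff_commute[OF sV u(1)])
  ultimately show thesis using that u(1) unfolding s_def by blast
qed

end

section \<open>A variational spectral theorem\<close>

text \<open>\<open>ip\<close> plays the part of the L2 product and \<open>q\<close> that of the
  energy. Only \<open>q\<close> is complete on \<open>V\<close>; a limit in \<open>ip\<close> may
  leave \<open>V\<close>, which is why compactness is stated as a Cauchy property. The infinite
  orthogonal family ensures that splitting off eigenvectors never comes to an end.\<close>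

locale coercive_form = ip: semi_inner V ip + q: complete_semi_inner V q
  for V :: "'a::real_vector set" and ip q :: "'a \<Rightarrow> 'a \<Rightarrow> real" +
  fixes c :: real
  assumes c_pos: "0 < c" and coercive: "u \<in> V \<Longrightarrow> c * ip u u \<le> q u u"
    and compact: "\<lbrakk>\<And>n. f n \<in> V; \<And>n. q (f n) (f n) \<le> K\<rbrakk> \<Longrightarrow>
      \<exists>r. strict_mono (r :: nat \<Rightarrow> nat) \<and>
        (\<forall>e>0. \<exists>N. \<forall>m\<ge>N. \<forall>n\<ge>N. ip (f (r m) - f (r n)) (f (r m) - f (r n)) < e)"
    and infinite_dim: "\<exists>\<psi>. (\<forall>i. \<psi> i \<in> V \<and> 0 < ip (\<psi> i) (\<psi> i)) \<and>
      (\<forall>i j. i \<noteq> (j::nat) \<longrightarrow> ip (\<psi> i) (\<psi> j) = 0)"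
begin

text \<open>By Bessel, the coefficients of each \<open>b k\<close> tend to 0 along the infinite
  orthonormal family \<open>\<phi>\<close>. Far out, some \<open>\<phi> i\<close> has less than unit
  mass in the span of the \<open>b k\<close>, so its residual is not null and can be
  normalised.\<close>

lemma exists_orthogonal:
  assumes on: "ip.orthonormal_upto n b"
  shows "\<exists>u\<in>V. ip u u = 1 \<and> (\<forall>j<n. ip u (b j) = 0)"
proof -
  have bV: "b k \<in> V" if "k < n" for k using on that unfolding ip.orthonormal_upto_def by auto
  obtain \<psi> where \<psi>: "\<And>i. \<psi> i \<in> V" "\<And>i. 0 < ip (\<psi> i) (\<psi> i)"
    "\<And>i j. i \<noteq> (j::nat) \<Longrightarrow> ip (\<psi> i) (\<psi> j) = 0" using infinite_dim by blast
  define \<phi> where "\<phi> i = (1 / sqrt (ip (\<psi> i) (\<psi> i))) *\<^sub>R \<psi> i" for i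
  have \<phi>V: "\<phi> i \<in> V" for i using \<psi> unfolding \<phi>_def by auto
  have \<phi>1: "ip (\<phi> i) (\<phi> i) = 1" for i
    using \<psi>(1)[of i] \<psi>(2)[of i] unfolding \<phi>_def by (simp add: ip.sq_scale power_divide)
  have \<phi>0: "ip (\<phi> i) (\<phi> j) = 0" if "i \<noteq> j" for i j
    using \<psi>(1) \<psi>(3)[OF that] unfolding \<phi>_def by (simp add: ip.scale_left ip.scale_right)
  have on\<phi>: "ip.orthonormal_upto m \<phi>" for m
    unfolding ip.orthonormal_upto_def using \<phi>V \<phi>1 \<phi>0 by auto
  have "(\<lambda>i. ip (b k) (\<phi> i) ^ 2) \<longlonglongrightarrow> 0" if "k < n" for k
    using ip.Bessel_summable[OF on\<phi> bV[OF that]] by (rule summable_LIMSEQ_zero)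
  then have "(\<lambda>i. \<Sum>k<n. ip (b k) (\<phi> i) ^ 2) \<longlonglongrightarrow> (\<Sum>k<n. 0)"
    by (intro tendsto_sum) auto
  then have "\<forall>\<^sub>F i in sequentially. (\<Sum>k<n. ip (b k) (\<phi> i) ^ 2) < 1"
    by (auto intro: order_tendstoD(2))
  then obtain i where i: "(\<Sum>k<n. ip (b k) (\<phi> i) ^ 2) < 1"
    unfolding eventually_sequentially by blast
  define r where "r = ip.residual n b (\<phi> i)"
  have rV: "r \<in> V" unfolding r_def using on \<phi>V by auto
  have "(\<Sum>k<n. ip (\<phi> i) (b k) ^ 2) = (\<Sum>k<n. ip (b k) (\<phi> i) ^ 2)"
    using bV \<phi>V by (intro sum.cong refl) (auto simp: ip.sym)
  then have pos: "0 < ip r r"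
    using ip.residual_sq[OF on \<phi>V[of i]] i \<phi>1[of i] unfolding r_def by simp
  show ?thesis
  proof (intro bexI conjI allI impI)
    let ?u = "(1 / sqrt (ip r r)) *\<^sub>R r"
    show "?u \<in> V" using rV by auto
    show "ip ?u ?u = 1" using rV pos by (simp add: ip.sq_scale power_divide)
    show "ip ?u (b j) = 0" if "j < n" for j
      using ip.residual_orth[OF on \<phi>V that] rV bV[OF that] by (simp add: ip.scale_left r_def)
  qed
qed

text \<open>The Rayleigh quotient is minimised on the orthogonal complement \<open>W\<close> of the
  vectors found so far. Besides the eigenvalue equation, the minimality of \<open>\<mu>\<close> over
  \<open>W\<close> is recorded, since it gives the monotonicity of the eigenvalues and the decay of
  residuals.\<close>

lemma exists_next_eigenvector:
  assumes on: "ip.orthonormal_upto n b"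
    and eig: "\<And>j w. j < n \<Longrightarrow> w \<in> V \<Longrightarrow> q (b j) w = mu j * ip (b j) w"
  shows "\<exists>y\<in>V. ip y y = 1 \<and> (\<forall>j<n. ip y (b j) = 0) \<and> (\<exists>\<mu>. (\<forall>w\<in>V. q y w = \<mu> * ip y w) \<and>
     (\<forall>w\<in>V. (\<forall>j<n. ip w (b j) = 0) \<longrightarrow> \<mu> * ip w w \<le> q w w))"
proof -
  have bV: "b k \<in> V" if "k < n" for k using on that unfolding ip.orthonormal_upto_def by auto
  define W where "W = {u \<in> V. \<forall>j<n. ip u (b j) = 0}"
  have WV: "W \<subseteq> V" unfolding W_def by auto
  have Wadd: "u + w \<in> W" "u - w \<in> W" "t *\<^sub>R u \<in> W" if "u \<in> W" "w \<in> W" for u w t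
    using that bV unfolding W_def by (auto simp: ip.bilin)
  define Q where "Q = {q u u | u. u \<in> W \<and> ip u u = 1}"
  define \<mu> where "\<mu> = Inf Q"
  have Qne: "Q \<noteq> {}" using exists_orthogonal[OF on] unfolding Q_def W_def by blast
  have Qbdd: "bdd_below Q" unfolding Q_def W_def by (rule bdd_belowI[of _ 0]) (auto intro: q.nonneg)
  have \<mu>_le: "\<mu> * ip w w \<le> q w w" if "w \<in> W" for w
  proof (cases "ip w w = 0")
    case True then show ?thesis using that WV q.nonneg by auto
  next
    case False
    have wV: "w \<in> V" using that WV by auto
    with False have pos: "ip w w > 0" using ip.nonneg[OF wV] by simp
    let ?v = "(1 / sqrt (ip w w)) *\<^sub>R w"
    have "ip ?v ?v = 1" using wV pos by (simp add: ip.sq_scale power_divide)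
    then have "q ?v ?v \<in> Q" unfolding Q_def using Wadd(3)[OF that that] by blast
    then have "\<mu> \<le> q ?v ?v" unfolding \<mu>_def using Qbdd by (rule cInf_lower)
    also have "\<dots> = q w w / ip w w" using wV pos by (simp add: q.sq_scale power_divide)
    finally show ?thesis using pos by (simp add: field_simps)
  qed
  have "\<exists>u. u \<in> W \<and> ip u u = 1 \<and> q u u < \<mu> + 1 / real (Suc i)" for i
    using cInf_lessD[OF Qne, of "\<mu> + 1 / real (Suc i)"] unfolding \<mu>_def Q_def by fastforce
  then obtain u where u: "\<And>i. u i \<in> W" "\<And>i. ip (u i) (u i) = 1"
    "\<And>i. q (u i) (u i) < \<mu> + 1 / real (Suc i)" by metis
  have uV: "u i \<in> V" for i using u(1) WV by auto
  have "q (u i) (u i) \<le> \<mu> + 1" for i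
    using u(3)[of i] by (smt (verit) divide_le_eq_1 of_nat_0_le_iff of_nat_Suc)
  from compact[of u, OF uV this] obtain r :: "nat \<Rightarrow> nat" where r: "strict_mono r" and
    ipC: "\<forall>e>0. \<exists>N. \<forall>m\<ge>N. \<forall>n\<ge>N. ip (u (r m) - u (r n)) (u (r m) - u (r n)) < e"
    by blast
  define v where "v i = u (r i)" for i
  have v: "v i \<in> W" "v i \<in> V" "ip (v i) (v i) = 1" "q (v i) (v i) \<le> \<mu> + 1 / real (Suc i)" for i
  proof -
    have "1 / real (Suc (r i)) \<le> 1 / real (Suc i)"
      using seq_suble[OF r, of i] by (intro divide_left_mono) auto
    then show "q (v i) (v i) \<le> \<mu> + 1 / real (Suc i)" using u(3)[of "r i"] unfolding v_def by simp
  qed (auto simp: v_def u uV)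
  have \<mu>0: "\<mu> \<ge> 0"
    unfolding \<mu>_def using Qne by (rule cInf_greatest) (auto simp: Q_def W_def intro: q.nonneg)
  \<comment> \<open>Parallelogram law for both forms: the lower bound on \<open>q\<close> at
    \<open>v m + v k\<close> converts closeness in \<open>ip\<close> into closeness in
    \<open>q\<close>, the form that is complete.\<close>
  have par: "q (v m - v k) (v m - v k) \<le> 2 / real (Suc m) + 2 / real (Suc k) + \<mu> * ip (v m - v k) (v m - v k)" for m k
  proof -
    have "\<mu> * ip (v m + v k) (v m + v k) \<le> q (v m + v k) (v m + v k)"
      using v by (intro \<mu>_le Wadd)
    moreover have "ip (v m + v k) (v m + v k) = 4 - ip (v m - v k) (v m - v k)"
      using v by (simp add: ip.sq_add ip.sq_diff)
    moreover have "q (v m + v k) (v m + v k) + q (v m - v k) (v m - v k) = 2 * q (v m) (v m) + 2 * q (v k) (v k)"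
      using v by (simp add: q.sq_add q.sq_diff)
    ultimately have "q (v m - v k) (v m - v k) \<le> 2 * q (v m) (v m) + 2 * q (v k) (v k)
        - (4 * \<mu> - \<mu> * ip (v m - v k) (v m - v k))"
      by (simp add: right_diff_distrib)
    moreover have "2 / real (Suc i) = 2 * (1 / real (Suc i))" for i by simp
    ultimately show ?thesis using v(4)[of m] v(4)[of k] by linarith
  qed
  have "\<exists>y\<in>V. (\<lambda>i. q (v i - y) (v i - y)) \<longlonglongrightarrow> 0"
  proof (rule q.complete[OF v(2)])
    fix e :: real assume e: "0 < e"
    then have "0 < e / (2 * (\<mu> + 1))" using \<mu>0 by simp
    from ipC[rule_format, OF this, folded v_def] obtain N1 where
      N1: "\<And>m k. m \<ge> N1 \<Longrightarrow> k \<ge> N1 \<Longrightarrow> ip (v m - v k) (v m - v k) < e / (2 * (\<mu> + 1))"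
      by auto
    obtain N2 where N2: "8 / e < real N2" using reals_Archimedean2 by blast
    show "\<exists>N. \<forall>m\<ge>N. \<forall>n\<ge>N. q (v m - v n) (v m - v n) < e"
    proof (intro exI allI impI)
      fix m k assume m: "max N1 N2 \<le> m" and k: "max N1 N2 \<le> k"
      have small: "2 / real (Suc i) < e / 4" if "max N1 N2 \<le> i" for i
      proof -
        have "8 / e < real (Suc i)" using N2 that by linarith
        then show ?thesis using e by (simp add: field_simps)
      qed
      have "\<mu> * ip (v m - v k) (v m - v k) \<le> (\<mu> + 1) * ip (v m - v k) (v m - v k)"
        using v by (intro mult_right_mono ip.nonneg) auto
      also have "\<dots> < (\<mu> + 1) * (e / (2 * (\<mu> + 1)))"
        using N1[of m k] m k \<mu>0 by (intro mult_strict_left_mono) auto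
      also have "\<dots> = e / 2" using \<mu>0 by (simp add: field_simps)
      finally show "q (v m - v k) (v m - v k) < e"
        using par[of m k] small[OF m] small[OF k] by linarith
    qed
  qed
  then obtain y where y: "y \<in> V" "(\<lambda>i. q (v i - y) (v i - y)) \<longlonglongrightarrow> 0" by blast
  have ipy: "(\<lambda>i. ip (v i - y) (v i - y)) \<longlonglongrightarrow> 0"
  proof (rule tendsto_sandwich[OF _ _ tendsto_const])
    show "\<forall>\<^sub>F i in sequentially. 0 \<le> ip (v i - y) (v i - y)"
      using v y by (intro always_eventually allI ip.nonneg) auto
    show "\<forall>\<^sub>F i in sequentially. ip (v i - y) (v i - y) \<le> q (v i - y) (v i - y) / c"
      using coercive[of "v _ - y"] v y c_pos
      by (intro always_eventually allI) (auto simp: field_simps)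
    show "(\<lambda>i. q (v i - y) (v i - y) / c) \<longlonglongrightarrow> 0"
      using tendsto_divide[OF y(2) tendsto_const[of c]] c_pos by simp
  qed
  have yy: "ip y y = 1"
    using ip.tendsto_sq[OF v(2) y(1) ipy] v(3) by (simp add: LIMSEQ_const_iff)
  have yb: "ip y (b j) = 0" if "j < n" for j
  proof -
    have "ip (v i) (b j) = 0" for i using v(1)[of i] that unfolding W_def by auto
    then show ?thesis
      using ip.tendsto_left[OF v(2) y(1) bV[OF that] ipy] by (simp add: LIMSEQ_const_iff)
  qed
  have yW: "y \<in> W" unfolding W_def using y yb by auto
  have "q y y \<le> \<mu>"
  proof (rule LIMSEQ_le[OF q.tendsto_sq[OF v(2) y(1) y(2)]])
    show "(\<lambda>i. \<mu> + 1 / real (Suc i)) \<longlonglongrightarrow> \<mu>"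
      using tendsto_add[OF tendsto_const LIMSEQ_Suc[OF lim_1_over_n], of \<mu>] by simp
    show "\<exists>N. \<forall>i\<ge>N. q (v i) (v i) \<le> \<mu> + 1 / real (Suc i)" using v(4) by blast
  qed
  then have qy: "q y y = \<mu>" using \<mu>_le[OF yW] yy by simp
  have EL: "q y w = \<mu> * ip y w" if "w \<in> W" for w
  proof -
    have wV: "w \<in> V" using that WV by auto
    define a where "a = q y w - \<mu> * ip y w"
    define d where "d = q w w - \<mu> * ip w w"
    have d0: "d \<ge> 0" using \<mu>_le[OF that] unfolding d_def by simp
    have "0 \<le> 2 * t * a + t\<^sup>2 * d" for t
    proof -
      have "y + t *\<^sub>R w \<in> W" using yW that Wadd by auto
      from \<mu>_le[OF this] show ?thesis
        using y wV by (simp add: ip.sq_add q.sq_add ip.scale_left q.scale_left ip.scale_right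
          q.scale_right yy qy a_def d_def algebra_simps power2_eq_square)
    qed
    \<comment> \<open>First variation. The quadratic is minimal at \<open>- a / d\<close>; the
      denominator \<open>d + 1\<close> covers \<open>d = 0\<close> and still produces a negative
      multiple of \<open>a\<^sup>2\<close>.\<close>
    from this[of "- a / (d + 1)"] have "0 \<le> - 2 * a\<^sup>2 / (d + 1) + a\<^sup>2 * d / (d + 1)\<^sup>2"
      by (simp add: power2_eq_square)
    also have "\<dots> = a\<^sup>2 * (- d - 2) / (d + 1)\<^sup>2"
      using d0 by (simp add: divide_simps) (simp add: power2_eq_square algebra_simps)
    finally have "0 \<le> a\<^sup>2 * (- d - 2)" using d0 by (simp add: zero_le_divide_iff)
    then have "a = 0" using d0 by (simp add: zero_le_mult_iff)
    then show ?thesis unfolding a_def by simp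
  qed
  \<comment> \<open>For test vectors outside \<open>W\<close>: \<open>y\<close> is orthogonal to the
    earlier \<open>b k\<close> in \<open>ip\<close>, hence also in \<open>q\<close> by their own
    eigenvalue equations, so only the residual of \<open>w\<close> counts.\<close>
  have "q y w = \<mu> * ip y w" if "w \<in> V" for w
  proof -
    let ?w = "ip.residual n b w"
    have rw: "?w \<in> W" unfolding W_def using on that ip.residual_orth by auto
    let ?s = "\<Sum>k<n. ip w (b k) *\<^sub>R b k"
    have sV: "?s \<in> V" using bV by auto
    have w: "w = ?w + ?s" unfolding ip.residual_def by simp
    have "q y (b k) = 0" if "k < n" for k
      using eig[OF that y(1)] yb[OF that] q.sym[OF y(1) bV[OF that]] ip.sym[OF y(1) bV[OF that]] by simp
    then have "q y ?s = 0" using bV y by (subst q.sum_right) (auto simp: q.scale_right)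
    moreover have "ip y ?s = 0" using bV y yb by (subst ip.sum_right) (auto simp: ip.scale_right)
    moreover have "?w \<in> V" using rw WV by auto
    ultimately show ?thesis
      by (subst (1 2) w) (simp add: q.add_right ip.add_right y(1) sV EL[OF rw])
  qed
  then show ?thesis using y(1) yy yb \<mu>_le unfolding W_def by blast
qed

text \<open>Bounded eigenvalues would give the orthonormal sequence a Cauchy subsequence, although
  distinct members are at squared distance 2; so the eigenvalues are unbounded. For the
  \<open>n\<close>-th residual \<open>r\<close> of \<open>u\<close>, minimality yields
  \<open>mu n * ip r r \<le> q r r \<le> q u u\<close>, which forces the residuals to 0.\<close>

theorem spectral:
  obtains b mu where "\<And>n. ip.orthonormal_upto n b" "\<And>k. c \<le> mu k"
    "\<And>k w. w \<in> V \<Longrightarrow> q (b k) w = mu k * ip (b k) w"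
    "\<And>u. u \<in> V \<Longrightarrow> (\<lambda>n. ip (ip.residual n b u) (ip.residual n b u)) \<longlonglongrightarrow> 0"
proof -
  define P where "P b n y \<longleftrightarrow> y \<in> V \<and> ip y y = 1 \<and> (\<forall>j<n. ip y (b j) = 0) \<and>
     (\<exists>\<mu>. (\<forall>w\<in>V. q y w = \<mu> * ip y w) \<and> (\<forall>w\<in>V. (\<forall>j<n. ip w (b j) = 0) \<longrightarrow> \<mu> * ip w w \<le> q w w))"
    for b :: "nat \<Rightarrow> 'a" and n :: nat and y
  have on: "ip.orthonormal_upto n b" if "\<And>j. j < n \<Longrightarrow> P b j (b j)" for n b
    unfolding ip.orthonormal_upto_def
  proof (intro conjI allI impI)
    fix j k assume jk: "j < n" "k < n"
    consider "j = k" | "j < k" | "k < j" by linarith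
    then show "ip (b j) (b k) = (if j = k then 1 else 0)"
      using that[OF jk(1)] that[OF jk(2)] ip.sym[of "b j" "b k"] unfolding P_def by cases auto
  qed (use that in \<open>auto simp: P_def\<close>)
  have "\<exists>b. \<forall>n. P b n (b n)"
  \<comment> \<open>The condition on \<open>b n\<close> involves all earlier vectors and not just
    the preceding one, hence choice along the well-founded order.\<close>
  proof (rule dependent_wf_choice[OF wf_less])
    show "P f x r = P g x r" if "\<And>z. (z, x) \<in> {(x, y). x < y} \<Longrightarrow> f z = g z" for f g x r
      using that unfolding P_def by simp
    show "\<exists>r. P b n r" if prev: "\<And>y. (y, n) \<in> {(x, y). x < y} \<Longrightarrow> P b y (b y)" for b n
    proof -
      have Pj: "P b j (b j)" if "j < n" for j using prev[of j] that by simp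
      then have "\<forall>j. \<exists>\<mu>. j < n \<longrightarrow> (\<forall>w\<in>V. q (b j) w = \<mu> * ip (b j) w)" unfolding P_def by blast
      then have "\<exists>mu. \<forall>j. j < n \<longrightarrow> (\<forall>w\<in>V. q (b j) w = mu j * ip (b j) w)" by (rule choice)
      then obtain mu where mu: "\<forall>j. j < n \<longrightarrow> (\<forall>w\<in>V. q (b j) w = mu j * ip (b j) w)" by (rule exE)
      have "\<exists>y\<in>V. ip y y = 1 \<and> (\<forall>j<n. ip y (b j) = 0) \<and> (\<exists>\<mu>. (\<forall>w\<in>V. q y w = \<mu> * ip y w) \<and>
          (\<forall>w\<in>V. (\<forall>j<n. ip w (b j) = 0) \<longrightarrow> \<mu> * ip w w \<le> q w w))"
        by (rule exists_next_eigenvector[OF on[OF Pj]]) (use mu in auto)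
      then show ?thesis unfolding P_def by (simp add: Bex_def)
    qed
  qed
  then obtain b where b: "\<And>n. P b n (b n)" by blast
  then have "\<forall>n. \<exists>\<mu>. (\<forall>w\<in>V. q (b n) w = \<mu> * ip (b n) w) \<and>
      (\<forall>w\<in>V. (\<forall>j<n. ip w (b j) = 0) \<longrightarrow> \<mu> * ip w w \<le> q w w)" unfolding P_def by blast
  then have "\<exists>mu. \<forall>n. (\<forall>w\<in>V. q (b n) w = mu n * ip (b n) w) \<and>
      (\<forall>w\<in>V. (\<forall>j<n. ip w (b j) = 0) \<longrightarrow> mu n * ip w w \<le> q w w)" by (rule choice)
  then obtain mu where mu': "\<forall>n. (\<forall>w\<in>V. q (b n) w = mu n * ip (b n) w) \<and>
      (\<forall>w\<in>V. (\<forall>j<n. ip w (b j) = 0) \<longrightarrow> mu n * ip w w \<le> q w w)" by (rule exE)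
  have mu: "q (b n) w = mu n * ip (b n) w" if "w \<in> V" for n w using mu' that by simp
  have min: "mu n * ip w w \<le> q w w" if "w \<in> V" "\<And>j. j < n \<Longrightarrow> ip w (b j) = 0" for n w
    using mu' that by simp
  have bV: "b n \<in> V" and b1: "ip (b n) (b n) = 1" for n using b[of n] unfolding P_def by auto
  have onb: "ip.orthonormal_upto n b" for n using on b by blast
  have qb: "q (b n) (b n) = mu n" for n using mu[OF bV] b1 by simp
  have mu_c: "c \<le> mu n" for n using coercive[OF bV[of n]] b1[of n] qb[of n] by simp
  have mono: "mu m \<le> mu n" if "m \<le> n" for m n
    using min[of "b n" m, OF bV] b[of n] that b1 qb unfolding P_def by auto
  have unbdd: "\<exists>n. K < mu n" for K
  proof (rule ccontr)
    assume "\<not> ?thesis"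
    then have "q (b n) (b n) \<le> K" for n using qb by (simp add: not_less)
    from compact[of b, OF bV this] obtain r :: "nat \<Rightarrow> nat" where r: "strict_mono r" and
      C: "\<forall>e>0. \<exists>N. \<forall>m\<ge>N. \<forall>n\<ge>N. ip (b (r m) - b (r n)) (b (r m) - b (r n)) < e" by blast
    from C[rule_format, of 1] obtain N where N: "\<forall>m\<ge>N. \<forall>n\<ge>N. ip (b (r m) - b (r n)) (b (r m) - b (r n)) < 1" by auto
    have "r (Suc N) \<noteq> r N" using r by (simp add: strict_mono_eq)
    then have "ip (b (r (Suc N))) (b (r N)) = 0"
      using onb[of "max (Suc (r (Suc N))) (Suc (r N))"] unfolding ip.orthonormal_upto_def by auto
    then have "ip (b (r (Suc N)) - b (r N)) (b (r (Suc N)) - b (r N)) = 2"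
      using bV b1 by (simp add: ip.sq_diff)
    then show False using N[rule_format, of "Suc N" N] by simp
  qed
  have "(\<lambda>n. ip (ip.residual n b u) (ip.residual n b u)) \<longlonglongrightarrow> 0" if u: "u \<in> V" for u
  proof -
    have bound: "ip (ip.residual n b u) (ip.residual n b u) \<le> q u u / mu n" for n
    proof -
      let ?r = "ip.residual n b u"
      let ?s = "\<Sum>k<n. ip u (b k) *\<^sub>R b k"
      have rV: "?r \<in> V" using onb u by auto
      have sV: "?s \<in> V" using bV by auto
      have "mu n * ip ?r ?r \<le> q ?r ?r"
        by (rule min[OF rV]) (rule ip.residual_orth[OF onb u])
      \<comment> \<open>The expansion and its residual are orthogonal in \<open>q\<close> as well,
        because the \<open>b k\<close> are eigenvectors; so the energy splits.\<close>
      also have "\<dots> \<le> q u u"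
      proof -
        have "q (b k) ?r = 0" if "k < n" for k
          using mu[OF rV] ip.residual_orth[OF onb u that] ip.sym[OF rV bV] by simp
        then have "q ?s ?r = 0" using bV rV by (subst q.sum_left) (auto simp: q.scale_left)
        moreover have "u = ?s + ?r" unfolding ip.residual_def by simp
        ultimately have "q u u = q ?s ?s + q ?r ?r"
          using q.sq_add[OF sV rV] by simp
        then show ?thesis using q.nonneg[OF sV] by simp
      qed
      finally show ?thesis using mu_c[of n] c_pos by (simp add: field_simps)
    qed
    show ?thesis
    proof (rule LIMSEQ_I)
      fix e :: real assume e: "0 < e"
      obtain N where N: "q u u / e < mu N" using unbdd by blast
      have "norm (ip (ip.residual n b u) (ip.residual n b u) - 0) < e" if "n \<ge> N" for n
      proof -
        have pos: "0 < mu n" using mu_c[of n] c_pos by simp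
        have "q u u / e < mu n" using N mono[OF that] by simp
        then have "q u u / mu n < e" using e pos by (simp add: field_simps)
        moreover have "0 \<le> ip (ip.residual n b u) (ip.residual n b u)"
          by (intro ip.nonneg ip.residual_in onb u)
        ultimately show ?thesis using bound[of n] by simp
      qed
      then show "\<exists>N. \<forall>n\<ge>N. norm (ip (ip.residual n b u) (ip.residual n b u) - 0) < e" by blast
    qed
  qed
  then show thesis using that onb mu_c mu by blast
qed

end

section \<open>Square integrable functions on an interval\<close>

abbreviation leb :: "real \<Rightarrow> real measure" where "leb l \<equiv> lebesgue_on {0..l}"

definition ip2 :: "real \<Rightarrow> (real \<Rightarrow> real) \<Rightarrow> (real \<Rightarrow> real) \<Rightarrow> real" where
  "ip2 l u w = integral\<^sup>L (leb l) (\<lambda>x. u x * w x)"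

lemma finite_measure_leb: "finite_measure (leb l)"
  by (rule finite_measure_lebesgue_on) auto

lemma L2_on_measurable: "L2_on l u \<Longrightarrow> u \<in> borel_measurable (leb l)"
  and L2_on_integrable_sq: "L2_on l u \<Longrightarrow> integrable (leb l) (\<lambda>x. (u x)\<^sup>2)"
  by (auto simp: L2_on_def)

lemma L2_on_mult_integrable:
  assumes "L2_on l u" "L2_on l w"
  shows "integrable (leb l) (\<lambda>x. u x * w x)"
proof (rule Bochner_Integration.integrable_bound)
  show "integrable (leb l) (\<lambda>x. (u x)\<^sup>2 + (w x)\<^sup>2)"
    using assms by (intro Bochner_Integration.integrable_add L2_on_integrable_sq)
  show "(\<lambda>x. u x * w x) \<in> borel_measurable (leb l)"
    using assms by (intro borel_measurable_times L2_on_measurable)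
  have "\<bar>a * b\<bar> \<le> \<bar>a\<^sup>2 + b\<^sup>2\<bar>" for a b :: real
  proof -
    have "0 \<le> \<bar>a\<bar> * \<bar>b\<bar>" by simp
    moreover have "2 * \<bar>a\<bar> * \<bar>b\<bar> \<le> a\<^sup>2 + b\<^sup>2" using sum_squares_bound[of "\<bar>a\<bar>" "\<bar>b\<bar>"] by simp
    moreover have "\<bar>a * b\<bar> = \<bar>a\<bar> * \<bar>b\<bar>" "\<bar>a\<^sup>2 + b\<^sup>2\<bar> = a\<^sup>2 + b\<^sup>2" by (auto simp: abs_mult)
    ultimately show ?thesis by linarith
  qed
  then show "AE x in leb l. norm (u x * w x) \<le> norm ((u x)\<^sup>2 + (w x)\<^sup>2)" by simp
qed

lemma L2_on_const [simp]: "L2_on l (\<lambda>x. c)"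
  by (simp add: L2_on_def integrable_const_ivl)

lemma L2_on_integrable: "L2_on l u \<Longrightarrow> integrable (leb l) u"
  using L2_on_mult_integrable[of l u "\<lambda>_. 1"] by simp

lemma L2_on_add [intro]:
  assumes "L2_on l u" "L2_on l w"
  shows "L2_on l (\<lambda>x. u x + w x)"
proof -
  have "integrable (leb l) (\<lambda>x. (u x)\<^sup>2 + 2 * (u x * w x) + (w x)\<^sup>2)"
    using assms L2_on_mult_integrable[OF assms]
    by (intro Bochner_Integration.integrable_add L2_on_integrable_sq) auto
  also have "(\<lambda>x. (u x)\<^sup>2 + 2 * (u x * w x) + (w x)\<^sup>2) = (\<lambda>x. (u x + w x)\<^sup>2)"
    by (auto simp: power2_eq_square algebra_simps)
  finally show ?thesis using assms by (auto simp: L2_on_def)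
qed

lemma L2_on_scale [intro]: "L2_on l u \<Longrightarrow> L2_on l (\<lambda>x. c * u x)"
  by (auto simp: L2_on_def power_mult_distrib)

lemma L2_on_uminus [intro]: "L2_on l u \<Longrightarrow> L2_on l (\<lambda>x. - u x)"
  using L2_on_scale[of l u "-1"] by simp

lemma L2_on_diff [intro]: "L2_on l u \<Longrightarrow> L2_on l w \<Longrightarrow> L2_on l (\<lambda>x. u x - w x)"
  using L2_on_add[of l u "\<lambda>x. - w x"] by auto

lemma L2_on_bounded_mult:
  assumes u: "L2_on l u" and k: "k \<in> borel_measurable (leb l)" "AE x in leb l. \<bar>k x\<bar> \<le> C"
  shows "L2_on l (\<lambda>x. k x * u x)"
proof -
  have "integrable (leb l) (\<lambda>x. (k x * u x)\<^sup>2)"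
  proof (rule Bochner_Integration.integrable_bound)
    show "integrable (leb l) (\<lambda>x. C\<^sup>2 * (u x)\<^sup>2)" using L2_on_integrable_sq[OF u] by auto
    show "(\<lambda>x. (k x * u x)\<^sup>2) \<in> borel_measurable (leb l)"
      using L2_on_measurable[OF u] k by auto
    show "AE x in leb l. norm ((k x * u x)\<^sup>2) \<le> norm (C\<^sup>2 * (u x)\<^sup>2)"
      using k(2)
    proof eventually_elim
      case (elim x)
      then have "(k x)\<^sup>2 \<le> C\<^sup>2" by (metis abs_ge_zero power2_abs power_mono)
      then show ?case by (simp add: power_mult_distrib mult_right_mono)
    qed
  qed
  then show ?thesis using L2_on_measurable[OF u] k by (auto simp: L2_on_def)
qed

lemma L2_on_bounded:
  assumes "k \<in> borel_measurable (leb l)" "AE x in leb l. \<bar>k x\<bar> \<le> C"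
  shows "L2_on l k"
  using L2_on_bounded_mult[OF L2_on_const[of l 1] assms] by simp

lemma continuous_imp_measurable_leb:
  "continuous_on {0..l} u \<Longrightarrow> u \<in> borel_measurable (leb l)"
  by (rule continuous_imp_measurable_on_sets_lebesgue) auto

lemma continuous_on_bounded_interval:
  fixes u :: "real \<Rightarrow> real"
  assumes "continuous_on {0..l} u"
  obtains C where "\<And>x. x \<in> {0..l} \<Longrightarrow> \<bar>u x\<bar> \<le> C"
proof -
  have "bounded (u ` {0..l})"
    using assms by (intro compact_imp_bounded compact_continuous_image) auto
  then show thesis using that unfolding bounded_iff by (metis image_eqI real_norm_def)
qed

lemma continuous_imp_L2_on:
  assumes "continuous_on {0..l} u"
  shows "L2_on l u"
proof -
  obtain C where "\<And>x. x \<in> {0..l} \<Longrightarrow> \<bar>u x\<bar> \<le> C"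
    using continuous_on_bounded_interval[OF assms] by blast
  then have "AE x in leb l. \<bar>u x\<bar> \<le> C" by (intro AE_I2) simp
  then show ?thesis by (rule L2_on_bounded[OF continuous_imp_measurable_leb[OF assms]])
qed

lemma L2_on_AE_cong:
  assumes "L2_on l u" "w \<in> borel_measurable (leb l)" "AE x in leb l. u x = w x"
  shows "L2_on l w"
proof -
  have "integrable (leb l) (\<lambda>x. (w x)\<^sup>2) \<longleftrightarrow> integrable (leb l) (\<lambda>x. (u x)\<^sup>2)"
    by (rule Bochner_Integration.integrable_cong_AE)
      (use assms in \<open>auto simp: L2_on_def\<close>)
  then show ?thesis using assms by (auto simp: L2_on_def)
qed

lemma ip2_semi_inner: "semi_inner {u. L2_on l u} (ip2 l)"
proof
  show "Real_Vector_Spaces.subspace {u. L2_on l u}"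
    unfolding Real_Vector_Spaces.subspace_def plus_fun_def scaleR_fun_def zero_fun_def by auto
  show "ip2 l x y = ip2 l y x" for x y by (simp add: ip2_def mult.commute)
  show "ip2 l (x + y) z = ip2 l x z + ip2 l y z" if "x \<in> {u. L2_on l u}" "y \<in> {u. L2_on l u}" "z \<in> {u. L2_on l u}" for x y z
    using that L2_on_mult_integrable[of l] by (simp add: ip2_def distrib_right)
  show "ip2 l (c *\<^sub>R x) y = c * ip2 l x y" for c x y
    by (simp add: ip2_def mult.assoc)
  show "0 \<le> ip2 l x x" for x by (simp add: ip2_def)
qed

lemma ip2_commute: "ip2 l u w = ip2 l w u"
  by (simp add: ip2_def mult.commute)

lemma ip2_AE_cong:
  assumes "L2_on l u" "L2_on l u'" "L2_on l w" "L2_on l w'"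
    "AE x in leb l. u x = u' x" "AE x in leb l. w x = w' x"
  shows "ip2 l u w = ip2 l u' w'"
  unfolding ip2_def
proof (rule integral_cong_AE)
  show "AE x in leb l. u x * w x = u' x * w' x" using assms(5,6) by eventually_elim simp
qed (use assms in \<open>auto simp: L2_on_def\<close>)

lemma ip2_eq_0_iff:
  assumes "L2_on l u"
  shows "ip2 l u u = 0 \<longleftrightarrow> (AE x in leb l. u x = 0)"
proof -
  have "ip2 l u u = 0 \<longleftrightarrow> (AE x in leb l. (u x)\<^sup>2 = 0)"
    unfolding ip2_def power2_eq_square[symmetric]
    by (rule integral_nonneg_eq_0_iff_AE) (use assms in \<open>auto simp: L2_on_def\<close>)
  then show ?thesis by simp
qed

text \<open>Cauchy-Schwarz against the constant 1. It converts L2 smallness into L1 smallness, which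
  the summation of increments in the completeness proof requires.\<close>

lemma integral_abs_le_ip2:
  assumes "L2_on l u"
  shows "(\<integral>x. \<bar>u x\<bar> \<partial>leb l)\<^sup>2 \<le> l * ip2 l u u"
proof -
  interpret semi_inner "{u. L2_on l u}" "ip2 l" by (rule ip2_semi_inner)
  have L: "L2_on l (\<lambda>x. \<bar>u x\<bar>)" using assms by (auto simp: L2_on_def)
  have "ip2 l (\<lambda>x. \<bar>u x\<bar>) (\<lambda>x. \<bar>u x\<bar>) = ip2 l u u" by (simp add: ip2_def)
  moreover have "ip2 l (\<lambda>x. 1) (\<lambda>x. 1) = measure lebesgue {0..l}"
    unfolding ip2_def by (simp add: measure_restrict_space)
  moreover have "0 \<le> ip2 l u u" using nonneg assms by simp
  ultimately show ?thesis
    using Cauchy_Schwarz[of "\<lambda>x. \<bar>u x\<bar>" "\<lambda>x. 1"] L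
    by (cases "0 \<le> l") (auto simp: ip2_def mult.commute)
qed

text \<open>The classical argument of Riesz and Fischer: along a rapidly Cauchy subsequence the
  increments are summable in L1, hence pointwise almost everywhere, and Fatou's lemma carries the
  Cauchy estimate over to the pointwise limit.\<close>

lemma ip2_complete: "complete_semi_inner {u. L2_on l u} (ip2 l)"
proof -
  interpret semi_inner "{u. L2_on l u}" "ip2 l" by (rule ip2_semi_inner)
  interpret M: finite_measure "leb l" by (rule finite_measure_leb)
  show ?thesis
  proof
    fix f :: "nat \<Rightarrow> real \<Rightarrow> real"
    assume f: "\<And>n. f n \<in> {u. L2_on l u}"
      and C: "\<And>e. 0 < e \<Longrightarrow> \<exists>N. \<forall>m\<ge>N. \<forall>n\<ge>N. ip2 l (f m - f n) (f m - f n) < e"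
    have fL: "L2_on l (f n)" for n using f by simp
    have fm [measurable]: "f n \<in> borel_measurable (leb l)" for n using fL L2_on_measurable by auto
    have dL: "L2_on l (\<lambda>x. f m x - f n x)" for m n using fL by auto
    have ipd: "ip2 l (f m - f n) (f m - f n) = (\<integral>x. (f m x - f n x)\<^sup>2 \<partial>leb l)" for m n
      by (simp add: ip2_def power2_eq_square)
    \<comment> \<open>Squared seminorms below \<open>(1/4)^n\<close> give L1 norms of the increments
      of order \<open>(1/2)^n\<close>, a summable sequence.\<close>
    have "\<exists>r. \<forall>n. (\<forall>m\<ge>r n. \<forall>m'\<ge>r n. ip2 l (f m - f m') (f m - f m') < (1/4)^n) \<and> r n < r (Suc n)"
    proof (rule dependent_nat_choice)
      show "\<exists>x. \<forall>m\<ge>x. \<forall>m'\<ge>x. ip2 l (f m - f m') (f m - f m') < (1 / 4) ^ 0" using C[of 1] by simp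
      fix x n
      obtain N where N: "\<forall>m\<ge>N. \<forall>m'\<ge>N. ip2 l (f m - f m') (f m - f m') < (1/4)^Suc n"
        using C[of "(1/4)^Suc n"] by auto
      show "\<exists>y. (\<forall>m\<ge>y. \<forall>m'\<ge>y. ip2 l (f m - f m') (f m - f m') < (1 / 4) ^ Suc n) \<and> x < y"
        using N by (intro exI[of _ "max N (Suc x)"]) auto
    qed
    then obtain r :: "nat \<Rightarrow> nat" where
      r: "\<And>n m m'. m \<ge> r n \<Longrightarrow> m' \<ge> r n \<Longrightarrow> ip2 l (f m - f m') (f m - f m') < (1/4)^n"
      and rS: "\<And>n. r n < r (Suc n)" by blast
    define d where "d n x = \<bar>f (r (Suc n)) x - f (r n) x\<bar>" for n x
    have dm [measurable]: "d n \<in> borel_measurable (leb l)" for n unfolding d_def by measurable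
    have di: "integrable (leb l) (d n)" for n
      unfolding d_def using dL by (intro Bochner_Integration.integrable_abs L2_on_integrable)
    define L where "L = \<bar>l\<bar>"
    have dint: "(\<integral>x. d n x \<partial>leb l) \<le> sqrt L * (1/2)^n" for n
    proof -
      have "(\<integral>x. d n x \<partial>leb l)\<^sup>2 \<le> l * ip2 l (\<lambda>x. f (r (Suc n)) x - f (r n) x) (\<lambda>x. f (r (Suc n)) x - f (r n) x)"
        unfolding d_def by (rule integral_abs_le_ip2[OF dL])
      also have "\<dots> \<le> L * ip2 l (f (r (Suc n)) - f (r n)) (f (r (Suc n)) - f (r n))"
        unfolding L_def ipd by (auto simp: ip2_def power2_eq_square intro!: mult_right_mono)
      also have "\<dots> \<le> L * (1/4)^n"
        using r[of n "r (Suc n)" "r n"] rS[of n] unfolding L_def by (intro mult_left_mono) auto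
      also have "\<dots> = (sqrt L * (1/2)^n)\<^sup>2"
      proof -
        have "(1/4::real)^n = ((1/2)^n)\<^sup>2"
          by (simp add: power2_eq_square power_mult_distrib[symmetric])
        then show ?thesis unfolding L_def by (simp add: power_mult_distrib)
      qed
      finally show ?thesis by (rule power2_le_imp_le) (simp add: L_def)
    qed
    have "AE x in leb l. (\<Sum>n. ennreal (d n x)) \<noteq> \<infinity>"
    proof (rule nn_integral_PInf_AE)
      have "(\<integral>\<^sup>+x. (\<Sum>n. ennreal (d n x)) \<partial>leb l) = (\<Sum>n. \<integral>\<^sup>+x. ennreal (d n x) \<partial>leb l)"
        by (rule nn_integral_suminf) measurable
      also have "\<dots> = (\<Sum>n. ennreal (\<integral>x. d n x \<partial>leb l))"
        using di by (intro suminf_cong nn_integral_eq_integral) (simp_all add: d_def[abs_def])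
      also have "\<dots> \<le> (\<Sum>n. ennreal (sqrt L * (1/2)^n))"
        using dint by (intro suminf_le) (auto intro: ennreal_leI)
      also have "\<dots> = ennreal (\<Sum>n. sqrt L * (1/2)^n)"
        by (intro suminf_ennreal2 summable_mult summable_geometric) (auto simp: L_def)
      also have "\<dots> < \<infinity>" by simp
      finally show "(\<integral>\<^sup>+x. (\<Sum>n. ennreal (d n x)) \<partial>leb l) \<noteq> \<infinity>" by simp
    qed measurable
    then have conv: "AE x in leb l. convergent (\<lambda>n. f (r n) x)"
    proof eventually_elim
      case (elim x)
      have "summable (\<lambda>n. d n x)"
        using elim by (intro summable_suminf_not_top) (auto simp: d_def)
      then have "summable (\<lambda>n. f (r (Suc n)) x - f (r n) x)"
        unfolding d_def by (rule summable_rabs_cancel)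
      then have "convergent (\<lambda>n. \<Sum>i<n. f (r (Suc i)) x - f (r i) x)" by (simp add: summable_iff_convergent)
      then have "convergent (\<lambda>n. f (r n) x - f (r 0) x)" using sum_lessThan_telescope[of "\<lambda>i. f (r i) x"] by simp
      then have "convergent (\<lambda>n. (f (r n) x - f (r 0) x) + f (r 0) x)"
        by (intro convergent_add convergent_const)
      then show ?case by simp
    qed
    define g where "g x = lim (\<lambda>n. f (r n) x)" for x
    have gm [measurable]: "g \<in> borel_measurable (leb l)" unfolding g_def by measurable
    have lim: "AE x in leb l. (\<lambda>n. f (r n) x) \<longlonglongrightarrow> g x"
      using conv by eventually_elim (simp add: g_def convergent_LIMSEQ_iff)
    have fat: "(\<integral>\<^sup>+x. ennreal ((f m x - g x)\<^sup>2) \<partial>leb l) \<le> ennreal ((1/4)^N)" if m: "m \<ge> r N" for m N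
    proof -
      have "(\<integral>\<^sup>+x. ennreal ((f m x - g x)\<^sup>2) \<partial>leb l) = (\<integral>\<^sup>+x. liminf (\<lambda>n. ennreal ((f m x - f (r n) x)\<^sup>2)) \<partial>leb l)"
      proof (rule nn_integral_cong_AE)
        show "AE x in leb l. ennreal ((f m x - g x)\<^sup>2) = liminf (\<lambda>n. ennreal ((f m x - f (r n) x)\<^sup>2))"
          using lim
        proof eventually_elim
          case (elim x)
          then have "(\<lambda>n. ennreal ((f m x - f (r n) x)\<^sup>2)) \<longlonglongrightarrow> ennreal ((f m x - g x)\<^sup>2)"
            by (intro tendsto_ennrealI tendsto_intros)
          then show ?case by (rule lim_imp_Liminf[OF trivial_limit_sequentially, symmetric])
        qed
      qed
      also have "\<dots> \<le> liminf (\<lambda>n. \<integral>\<^sup>+x. ennreal ((f m x - f (r n) x)\<^sup>2) \<partial>leb l)"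
        by (rule nn_integral_liminf) measurable
      also have "\<dots> \<le> ennreal ((1/4)^N)"
      proof (rule Liminf_le)
        have "(\<integral>\<^sup>+x. ennreal ((f m x - f (r n) x)\<^sup>2) \<partial>leb l) \<le> ennreal ((1/4)^N)" if "n \<ge> N" for n
        proof -
          have "r N \<le> r n" using lift_Suc_mono_le[of r N n] rS that by (simp add: less_imp_le)
          then have "ip2 l (f m - f (r n)) (f m - f (r n)) < (1/4)^N" using r m by simp
          moreover have "(\<integral>\<^sup>+x. ennreal ((f m x - f (r n) x)\<^sup>2) \<partial>leb l) = ennreal (\<integral>x. (f m x - f (r n) x)\<^sup>2 \<partial>leb l)"
            using dL by (intro nn_integral_eq_integral) (auto simp: L2_on_def)
          ultimately show ?thesis by (simp add: ipd ennreal_leI)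
        qed
        then show "\<forall>\<^sub>F n in sequentially. (\<integral>\<^sup>+x. ennreal ((f m x - f (r n) x)\<^sup>2) \<partial>leb l) \<le> ennreal ((1/4)^N)"
          unfolding eventually_sequentially by blast
      qed simp
      finally show ?thesis .
    qed
    \<comment> \<open>Fatou bounds only differences; from \<open>f (r 0) - g\<close> the square
      integrability of \<open>g\<close> itself is recovered.\<close>
    have fgL: "L2_on l (\<lambda>x. f (r 0) x - g x)"
      unfolding L2_on_def
    proof
      show "integrable (leb l) (\<lambda>x. (f (r 0) x - g x)\<^sup>2)"
      proof (rule integrableI_nonneg)
        have "(\<integral>\<^sup>+x. ennreal ((f (r 0) x - g x)\<^sup>2) \<partial>leb l) \<le> 1" using fat[of 0 "r 0"] by simp
        also have "\<dots> < \<infinity>" by simp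
        finally show "(\<integral>\<^sup>+x. ennreal ((f (r 0) x - g x)\<^sup>2) \<partial>leb l) < \<infinity>" .
      qed auto
    qed measurable
    have gL: "L2_on l g" using L2_on_diff[OF fL[of "r 0"] fgL] by simp
    have small: "ip2 l (f m - g) (f m - g) \<le> (1/4)^N" if "m \<ge> r N" for m N
    proof -
      have "L2_on l (\<lambda>x. f m x - g x)" using fL gL by auto
      then have "(\<integral>\<^sup>+x. ennreal ((f m x - g x)\<^sup>2) \<partial>leb l) = ennreal (\<integral>x. (f m x - g x)\<^sup>2 \<partial>leb l)"
        by (intro nn_integral_eq_integral) (auto simp: L2_on_def)
      then have "(\<integral>x. (f m x - g x)\<^sup>2 \<partial>leb l) \<le> (1/4)^N" using fat[OF that] by simp
      then show ?thesis by (simp add: ip2_def power2_eq_square)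
    qed
    have "(\<lambda>n. ip2 l (f n - g) (f n - g)) \<longlonglongrightarrow> 0"
    proof (rule LIMSEQ_I)
      fix e :: real assume "0 < e"
      then obtain N where N: "(1/4)^N < e" using real_arch_pow_inv[of e "1/4"] by auto
      have "0 \<le> ip2 l (f n - g) (f n - g)" for n using fL gL by (intro nonneg mem) auto
      then show "\<exists>no. \<forall>n\<ge>no. norm (ip2 l (f n - g) (f n - g) - 0) < e"
        using le_less_trans[OF small N] by (intro exI[of _ "r N"]) simp
    qed
    then show "\<exists>x\<in>{u. L2_on l u}. (\<lambda>n. ip2 l (f n - x) (f n - x)) \<longlonglongrightarrow> 0" using gL by blast
  qed
qed

section \<open>Absolutely continuous functions with square integrable derivative\<close>

text \<open>An absolutely continuous function together with one square integrable derivative.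
  \<open>u\<close> is determined at every point of \<open>{0..l}\<close>, whereas \<open>g\<close>
  matters only up to a null set.\<close>

definition H1rep :: "real \<Rightarrow> (real \<Rightarrow> real) \<Rightarrow> (real \<Rightarrow> real) \<Rightarrow> bool" where
  "H1rep l u g \<longleftrightarrow> L2_on l g \<and> (\<forall>x\<in>{0..l}. u x = u 0 + integral {0..x} g)"

lemma H1rep_L2: "H1rep l u g \<Longrightarrow> L2_on l g"
  by (simp add: H1rep_def)

lemma H1repD: "H1rep l u g \<Longrightarrow> x \<in> {0..l} \<Longrightarrow> u x = u 0 + integral {0..x} g"
  unfolding H1rep_def by blast

lemma H1repI:
  "L2_on l g \<Longrightarrow> (\<And>x. x \<in> {0..l} \<Longrightarrow> u x = u 0 + integral {0..x} g) \<Longrightarrow> H1rep l u g"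
  unfolding H1rep_def by blast

lemma L2_on_imp_absolutely_integrable:
  assumes "L2_on l g"
  shows "g absolutely_integrable_on {0..l}" "(\<lambda>x. (g x)\<^sup>2) absolutely_integrable_on {0..l}"
  using L2_on_integrable[OF assms] L2_on_integrable_sq[OF assms]
  by (auto simp: set_integrable_def integrable_restrict_space)

lemma L2_on_imp_integrable_on:
  assumes "L2_on l g" "0 \<le> x" "y \<le> l"
  shows "g integrable_on {x..y}" "(\<lambda>t. (g t)\<^sup>2) integrable_on {x..y}"
  using L2_on_imp_absolutely_integrable[OF assms(1)] assms(2,3)
  by (meson absolutely_integrable_on_def atLeastatMost_subset_iff integrable_on_subinterval)+

lemma ip2_eq_integral:
  assumes "L2_on l u" "L2_on l w"
  shows "ip2 l u w = integral {0..l} (\<lambda>x. u x * w x)"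
  unfolding ip2_def by (rule lebesgue_integral_eq_integral[OF L2_on_mult_integrable[OF assms]]) simp

text \<open>With \<open>c\<close> the mean of \<open>g\<close>, the integral of
  \<open>(g - c)\<^sup>2\<close>, multiplied by the length of the interval, is the difference of the
  two sides. A separate proof of Cauchy-Schwarz is given because subintervals are involved, while
  \<open>ip2\<close> integrates over \<open>{0..l}\<close>.\<close>

lemma integral_sq_le:
  assumes g: "L2_on l g" and xy: "0 \<le> x" "x \<le> y" "y \<le> l"
  shows "(integral {x..y} g)\<^sup>2 \<le> (y - x) * integral {x..y} (\<lambda>t. (g t)\<^sup>2)"
proof (cases "x = y")
  case False
  then have pos: "0 < y - x" using xy by simp
  define I where "I = integral {x..y} g"
  define c where "c = I / (y - x)"
  note int = L2_on_imp_integrable_on[OF g xy(1,3)]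
  have eq: "(g t - c)\<^sup>2 = (g t)\<^sup>2 - 2 * c * g t + c\<^sup>2" for t by (simp add: power2_eq_square algebra_simps)
  have "((\<lambda>t. (g t)\<^sup>2 - 2 * c * g t + c\<^sup>2) has_integral
      integral {x..y} (\<lambda>t. (g t)\<^sup>2) - 2 * c * I + (y - x) *\<^sub>R c\<^sup>2) {x..y}"
    unfolding I_def
    by (intro has_integral_add has_integral_diff has_integral_mult_right integrable_integral int)
      (use xy has_integral_const_real[of "c\<^sup>2" x y] in simp)
  then have "0 \<le> integral {x..y} (\<lambda>t. (g t)\<^sup>2) - 2 * c * I + (y - x) *\<^sub>R c\<^sup>2"
    unfolding eq[symmetric] by (rule has_integral_nonneg) simp
  then have "0 \<le> (y - x) * (integral {x..y} (\<lambda>t. (g t)\<^sup>2) - 2 * c * I + (y - x) * c\<^sup>2)"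
    using pos by (intro mult_nonneg_nonneg) auto
  also have "\<dots> = (y - x) * integral {x..y} (\<lambda>t. (g t)\<^sup>2) - I\<^sup>2"
  proof -
    have cI: "c * (y - x) = I" using pos unfolding c_def by simp
    have "(y - x) * (integral {x..y} (\<lambda>t. (g t)\<^sup>2) - 2 * c * I + (y - x) * c\<^sup>2)
        = (y - x) * integral {x..y} (\<lambda>t. (g t)\<^sup>2) - 2 * (c * (y - x)) * I + (c * (y - x))\<^sup>2"
      by (simp add: power2_eq_square algebra_simps)
    then show ?thesis unfolding cI by (simp add: power2_eq_square)
  qed
  finally show ?thesis unfolding I_def by simp
qed simp

lemma integral_sq_mono:
  assumes g: "L2_on l g" and xy: "0 \<le> x" "x \<le> y" "y \<le> l"
  shows "integral {x..y} (\<lambda>t. (g t)\<^sup>2) \<le> ip2 l g g"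
proof -
  have "integral {x..y} (\<lambda>t. (g t)\<^sup>2) \<le> integral {0..l} (\<lambda>t. (g t)\<^sup>2)"
    using xy by (intro integral_subset_le L2_on_imp_integrable_on[OF g]) auto
  then show ?thesis using ip2_eq_integral[OF g g] by (simp add: power2_eq_square)
qed

lemma H1rep_diff_eq:
  assumes "H1rep l u g" "0 \<le> x" "x \<le> y" "y \<le> l"
  shows "u y - u x = integral {x..y} g"
  using assms Henstock_Kurzweil_Integration.integral_combine[of 0 x y g]
    L2_on_imp_integrable_on(1)[OF H1rep_L2[OF assms(1)], of 0 y]
    H1repD[OF assms(1), of x] H1repD[OF assms(1), of y]
  by simp

text \<open>Cauchy-Schwarz for the increment. This bound with exponent 1/2 drives the trace
  inequality, the equicontinuity and the pointwise convergence below.\<close>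

lemma H1rep_Hoelder:
  assumes "H1rep l u g" "x \<in> {0..l}" "y \<in> {0..l}"
  shows "(u y - u x)\<^sup>2 \<le> \<bar>y - x\<bar> * ip2 l g g"
proof -
  have *: "(u y - u x)\<^sup>2 \<le> \<bar>y - x\<bar> * ip2 l g g" if "x \<in> {0..l}" "y \<in> {0..l}" "x \<le> y" for x y
  proof -
    have "(u y - u x)\<^sup>2 \<le> (y - x) * integral {x..y} (\<lambda>t. (g t)\<^sup>2)"
      using H1rep_diff_eq[OF assms(1), of x y] integral_sq_le[OF H1rep_L2[OF assms(1)], of x y] that by simp
    also have "\<dots> \<le> (y - x) * ip2 l g g"
      using integral_sq_mono[OF H1rep_L2[OF assms(1)], of x y] that by (intro mult_left_mono) auto
    finally show ?thesis using that by simp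
  qed
  show ?thesis
    using *[of x y] *[of y x] assms(2,3)
    by (cases "x \<le> y") (simp_all add: power2_commute[of "u x" "u y"] abs_minus_commute[of x y])
qed

lemma H1rep_continuous:
  assumes "H1rep l u g"
  shows "continuous_on {0..l} u"
proof -
  have "continuous_on {0..l} (\<lambda>x. u 0 + integral {0..x} g)"
    using L2_on_imp_integrable_on[OF H1rep_L2[OF assms], of 0 l]
    by (intro continuous_intros indefinite_integral_continuous_1) auto
  then show ?thesis by (rule continuous_on_eq) (use H1repD[OF assms] in metis)
qed

lemma H1rep_L2_self: "H1rep l u g \<Longrightarrow> L2_on l u"
  by (intro continuous_imp_L2_on H1rep_continuous)

lemma H1rep_primitive:
  assumes "L2_on l g"
  shows "H1rep l (\<lambda>x. c + integral {0..x} g) g"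
  using assms by (simp add: H1rep_def)

lemma H1rep_add:
  assumes "H1rep l u g" "H1rep l w h"
  shows "H1rep l (\<lambda>x. u x + w x) (\<lambda>x. g x + h x)"
proof -
  have *: "integral {0..x} (\<lambda>t. g t + h t) = integral {0..x} g + integral {0..x} h" if "x \<le> l" for x
    using that L2_on_imp_integrable_on(1)[OF H1rep_L2[OF assms(1)], of 0 x]
      L2_on_imp_integrable_on(1)[OF H1rep_L2[OF assms(2)], of 0 x]
    by (simp add: Henstock_Kurzweil_Integration.integral_add)
  then show ?thesis
    using H1rep_L2[OF assms(1)] H1rep_L2[OF assms(2)]
  proof (intro H1repI L2_on_add)
    fix x assume x: "x \<in> {0..l}"
    then show "u x + w x = u 0 + w 0 + integral {0..x} (\<lambda>x. g x + h x)"
      using H1repD[OF assms(1) x] H1repD[OF assms(2) x] * by simp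
  qed
qed

lemma H1rep_scale:
  assumes "H1rep l u g"
  shows "H1rep l (\<lambda>x. c * u x) (\<lambda>x. c * g x)"
proof (rule H1repI)
  show "c * u x = c * u 0 + integral {0..x} (\<lambda>x. c * g x)" if "x \<in> {0..l}" for x
    using H1repD[OF assms that] by (subst H1repD[OF assms that]) (simp add: distrib_left)
qed (use H1rep_L2[OF assms] in auto)

lemma H1rep_diff:
  assumes "H1rep l u g" "H1rep l w h"
  shows "H1rep l (\<lambda>x. u x - w x) (\<lambda>x. g x - h x)"
  using H1rep_add[OF assms(1) H1rep_scale[OF assms(2), of "-1"]] by simp

lemma H1rep_C1:
  assumes d: "\<And>x. x \<in> {0..l} \<Longrightarrow> (u has_real_derivative g x) (at x within {0..l})"
    and c: "continuous_on {0..l} g"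
  shows "H1rep l u g"
proof (rule H1repI)
  show "L2_on l g" by (rule continuous_imp_L2_on[OF c])
  fix x assume x: "x \<in> {0..l}"
  have "(g has_integral (u x - u 0)) {0..x}"
  proof (rule fundamental_theorem_of_calculus)
    fix y assume "y \<in> {0..x}"
    then have "(u has_real_derivative g y) (at y within {0..x})"
      using x by (intro has_field_derivative_subset[OF d]) auto
    then show "(u has_vector_derivative g y) (at y within {0..x})"
      by (simp add: has_real_derivative_iff_has_vector_derivative)
  qed (use x in auto)
  then show "u x = u 0 + integral {0..x} g" by (simp add: integral_unique)
qed

lemma H1rep_const [simp]: "H1rep l (\<lambda>x. c) (\<lambda>x. 0)"
  by (simp add: H1rep_def)

text \<open>Exchanging the derivative for one equal to it almost everywhere is how second-order
  regularity is obtained: the new derivative is chosen to be a primitive itself.\<close>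

lemma H1rep_AE_cong:
  assumes "H1rep l u g" "h \<in> borel_measurable (leb l)" "AE x in leb l. g x = h x"
  shows "H1rep l u h"
proof -
  have h: "L2_on l h" by (rule L2_on_AE_cong[OF H1rep_L2[OF assms(1)] assms(2,3)])
  have *: "integral {0..x} g = integral {0..x} h" if "x \<in> {0..l}" for x
  proof -
    have "AE x in lebesgue. x \<in> {0..l} \<longrightarrow> g x = h x"
      using assms(3) by (simp add: AE_restrict_space_iff)
    then obtain N where N: "N \<in> null_sets lebesgue" "{x. \<not> (x \<in> {0..l} \<longrightarrow> g x = h x)} \<subseteq> N"
      unfolding eventually_ae_filter by auto
    show ?thesis
    proof (rule integral_spike)
      show "negligible N" using N by (simp add: negligible_iff_null_sets)
    qed (use N that in auto)
  qed
  show ?thesis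
  proof (rule H1repI[OF h])
    fix x assume x: "x \<in> {0..l}"
    show "u x = u 0 + integral {0..x} h" unfolding *[OF x, symmetric] by (rule H1repD[OF assms(1) x])
  qed
qed

text \<open>The product rule: the defect is additive over intervals and bounded by the length of the
  interval times the increment of a continuous function, so its derivative vanishes.\<close>

lemma constant_if_superlinear:
  fixes D G :: "real \<Rightarrow> real"
  assumes G: "continuous_on {0..l} G"
    and D: "\<And>x y. \<lbrakk>0 \<le> x; x \<le> y; y \<le> l\<rbrakk> \<Longrightarrow> \<bar>D y - D x\<bar> \<le> K * (y - x) * \<bar>G y - G x\<bar>"
    and x: "x \<in> {0..l}"
  shows "D x = D 0"
proof -
  have "(D has_real_derivative 0) (at x within {0..l})" if x: "x \<in> {0..l}" for x
  proof -
    have "((\<lambda>y. \<bar>K\<bar> * \<bar>G y - G x\<bar>) \<longlongrightarrow> \<bar>K\<bar> * \<bar>G x - G x\<bar>) (at x within {0..l})"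
      using G x by (intro tendsto_intros) (auto simp: continuous_on_def)
    then have lim: "((\<lambda>y. \<bar>K\<bar> * \<bar>G y - G x\<bar>) \<longlongrightarrow> 0) (at x within {0..l})" by simp
    have "norm ((D y - D x) / (y - x)) \<le> \<bar>K\<bar> * \<bar>G y - G x\<bar>" if y: "y \<in> {0..l}" "y \<noteq> x" for y
    proof -
      have "\<bar>D y - D x\<bar> \<le> \<bar>K\<bar> * \<bar>y - x\<bar> * \<bar>G y - G x\<bar>"
      proof (cases "x \<le> y")
        case True
        have "K * (y - x) * \<bar>G y - G x\<bar> \<le> \<bar>K\<bar> * \<bar>y - x\<bar> * \<bar>G y - G x\<bar>"
          using True by (intro mult_right_mono mult_mono) auto
        moreover have "\<bar>D y - D x\<bar> \<le> K * (y - x) * \<bar>G y - G x\<bar>"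
          using x y True by (intro D) auto
        ultimately show ?thesis by (rule order_trans[rotated])
      next
        case False
        have "K * (x - y) * \<bar>G x - G y\<bar> \<le> \<bar>K\<bar> * \<bar>y - x\<bar> * \<bar>G x - G y\<bar>"
          using False by (intro mult_right_mono mult_mono) auto
        moreover have "\<bar>D x - D y\<bar> \<le> K * (x - y) * \<bar>G x - G y\<bar>"
          using x y False by (intro D) auto
        ultimately have "\<bar>D x - D y\<bar> \<le> \<bar>K\<bar> * \<bar>y - x\<bar> * \<bar>G x - G y\<bar>" by (rule order_trans[rotated])
        then show ?thesis by (simp only: abs_minus_commute[of "D x"] abs_minus_commute[of "G x"])
      qed
      then show ?thesis using y by (simp add: divide_simps mult.commute mult.left_commute)
    qed
    then have "\<forall>\<^sub>F y in at x within {0..l}. norm ((D y - D x) / (y - x)) \<le> \<bar>K\<bar> * \<bar>G y - G x\<bar>"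
      by (auto simp: eventually_at_filter)
    then have "((\<lambda>y. (D y - D x) / (y - x)) \<longlongrightarrow> 0) (at x within {0..l})"
      by (rule Lim_null_comparison[OF _ lim])
    then show ?thesis by (simp add: has_field_derivative_iff)
  qed
  then obtain c where "\<And>x. x \<in> {0..l} \<Longrightarrow> D x = c"
    using has_field_derivative_zero_constant[of "{0..l}" D] by blast
  then show ?thesis using x by auto
qed

lemma H1rep_square:
  assumes u: "H1rep l u g" and x: "x \<in> {0..l}"
  shows "(u x)\<^sup>2 = (u 0)\<^sup>2 + integral {0..x} (\<lambda>t. 2 * (g t * u t))"
proof -
  note g = H1rep_L2[OF u]
  have uL: "L2_on l u" by (rule H1rep_L2_self[OF u])
  define G where "G x = integral {0..x} (\<lambda>t. (g t)\<^sup>2)" for x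
  define D where "D x = (u x)\<^sup>2 - integral {0..x} (\<lambda>t. 2 * (g t * u t))" for x
  have gu: "(\<lambda>t. g t * u t) integrable_on {x..y}" if "0 \<le> x" "y \<le> l" for x y
  proof -
    have "(\<lambda>t. g t * u t) integrable_on {0..l}"
      using L2_on_mult_integrable[OF g uL] by (intro integrable_on_lebesgue_on) auto
    then show ?thesis by (rule integrable_on_subinterval) (use that in auto)
  qed
  have "D x = D 0"
  proof (rule constant_if_superlinear[OF _ _ x, of G _ 2])
    show "continuous_on {0..l} G"
      unfolding G_def using L2_on_imp_integrable_on[OF g, of 0 l] by (intro indefinite_integral_continuous_1) auto
    fix x y :: real assume xy: "0 \<le> x" "x \<le> y" "y \<le> l"
    have int1: "(\<lambda>t. (u x + u y) * g t) integrable_on {x..y}"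
      and int2: "(\<lambda>t. 2 * (g t * u t)) integrable_on {x..y}"
      and int3: "(\<lambda>t. (y - x) * (g t)\<^sup>2) integrable_on {x..y}"
      using L2_on_imp_integrable_on[OF g xy(1,3)] gu[OF xy(1,3)] by (auto intro: integrable_on_mult_right)
    define J where "J = integral {x..y} (\<lambda>t. (g t)\<^sup>2)"
    have GJ: "G y - G x = J"
      unfolding G_def J_def
      using Henstock_Kurzweil_Integration.integral_combine[of 0 x y "\<lambda>t. (g t)\<^sup>2"]
        L2_on_imp_integrable_on[OF g, of 0 y] xy by simp
    have J0: "0 \<le> J" unfolding J_def by (rule integral_nonneg[OF L2_on_imp_integrable_on(2)[OF g xy(1,3)]]) simp
    have ginc: "\<bar>u t - u s\<bar> \<le> sqrt ((y - x) * J)" if "x \<le> s" "s \<le> t" "t \<le> y" for s t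
    proof -
      have "(u t - u s)\<^sup>2 \<le> (t - s) * integral {s..t} (\<lambda>t. (g t)\<^sup>2)"
        using H1rep_diff_eq[OF u, of s t] integral_sq_le[OF g, of s t] that xy by simp
      also have "\<dots> \<le> (y - x) * J"
        unfolding J_def using that xy
        by (intro mult_mono integral_subset_le L2_on_imp_integrable_on[OF g] integral_nonneg) auto
      finally show ?thesis by (simp add: real_le_rsqrt)
    qed
    have "D y - D x = (u y)\<^sup>2 - (u x)\<^sup>2 - integral {x..y} (\<lambda>t. 2 * (g t * u t))"
      unfolding D_def
      using Henstock_Kurzweil_Integration.integral_combine[of 0 x y "\<lambda>t. 2 * (g t * u t)"] gu[of 0 y] xy by simp
    \<comment> \<open>Factoring the difference of squares brings both terms under one integral of
      \<open>(u x + u y - 2 * u t) * g t\<close>, whose first factor is small by continuity of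
      \<open>u\<close>.\<close>
    also have "(u y)\<^sup>2 - (u x)\<^sup>2 = (u x + u y) * integral {x..y} g"
      unfolding H1rep_diff_eq[OF u xy, symmetric] by (simp add: power2_eq_square algebra_simps)
    also have "\<dots> = integral {x..y} (\<lambda>t. (u x + u y) * g t)" by simp
    also have "\<dots> - integral {x..y} (\<lambda>t. 2 * (g t * u t)) = integral {x..y} (\<lambda>t. (u x + u y) * g t - 2 * (g t * u t))"
      by (rule Henstock_Kurzweil_Integration.integral_diff[OF int1 int2, symmetric])
    finally have eq: "D y - D x = integral {x..y} (\<lambda>t. (u x + u y) * g t - 2 * (g t * u t))" .
    have le: "\<bar>integral {x..y} (\<lambda>t. (u x + u y) * g t - 2 * (g t * u t))\<bar>
        \<le> integral {x..y} (\<lambda>t. ((y - x) * J) / (y - x) + (y - x) * (g t)\<^sup>2)" if "x < y"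
    proof (subst real_norm_def[symmetric], rule integral_norm_bound_integral)
      show "(\<lambda>t. (u x + u y) * g t - 2 * (g t * u t)) integrable_on {x..y}"
        by (rule Henstock_Kurzweil_Integration.integrable_diff[OF int1 int2])
      show "(\<lambda>t. ((y - x) * J) / (y - x) + (y - x) * (g t)\<^sup>2) integrable_on {x..y}"
        by (rule Henstock_Kurzweil_Integration.integrable_add[OF integrable_continuous_real[OF continuous_on_const] int3])
      fix t assume t: "t \<in> {x..y}"
      define e where "e = \<bar>u x + u y - 2 * u t\<bar>"
      have e2: "e \<le> 2 * sqrt ((y - x) * J)"
        using ginc[of x t] ginc[of t y] t unfolding e_def by auto
      have "(e / 2)\<^sup>2 \<le> (sqrt ((y - x) * J))\<^sup>2" using e2 by (intro power_mono) (auto simp: e_def)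
      also have "\<dots> = (y - x) * J" using J0 xy by simp
      finally have e4: "(e / 2)\<^sup>2 \<le> (y - x) * J" .
      have "\<bar>(u x + u y) * g t - 2 * (g t * u t)\<bar> = e * \<bar>g t\<bar>"
        unfolding e_def abs_mult[symmetric] by (simp add: algebra_simps)
      \<comment> \<open>Young's inequality weighted by \<open>y - x\<close>. Since
        \<open>(e / 2)\<^sup>2 \<le> (y - x) * J\<close>, each of the two terms integrates to at
        most \<open>(y - x) * J\<close>, whence the constant 2.\<close>
      also have "\<dots> \<le> (e / 2)\<^sup>2 / (y - x) + (y - x) * (g t)\<^sup>2"
      proof -
        have "0 \<le> (e / 2 - (y - x) * \<bar>g t\<bar>)\<^sup>2 / (y - x)" using that by simp
        also have "\<dots> = (e / 2)\<^sup>2 / (y - x) - e * \<bar>g t\<bar> + (y - x) * (g t)\<^sup>2"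
          using that by (simp add: field_simps power2_eq_square)
        finally show ?thesis by simp
      qed
      also have "\<dots> \<le> ((y - x) * J) / (y - x) + (y - x) * (g t)\<^sup>2"
        using e4 that by (intro add_right_mono divide_right_mono) auto
      finally show "norm ((u x + u y) * g t - 2 * (g t * u t)) \<le> ((y - x) * J) / (y - x) + (y - x) * (g t)\<^sup>2"
        by (simp only: real_norm_def)
    qed
    have val: "integral {x..y} (\<lambda>t. ((y - x) * J) / (y - x) + (y - x) * (g t)\<^sup>2) = 2 * (y - x) * J" if "x < y"
    proof -
      have "integral {x..y} (\<lambda>t. ((y - x) * J) / (y - x) + (y - x) * (g t)\<^sup>2)
          = integral {x..y} (\<lambda>t. ((y - x) * J) / (y - x)) + integral {x..y} (\<lambda>t. (y - x) * (g t)\<^sup>2)"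
        by (rule Henstock_Kurzweil_Integration.integral_add[OF integrable_continuous_real[OF continuous_on_const] int3])
      then show ?thesis using that by (simp add: J_def)
    qed
    have "\<bar>D y - D x\<bar> \<le> 2 * (y - x) * J" if "x < y"
      using le[OF that] unfolding eq val[OF that] .
    then show "\<bar>D y - D x\<bar> \<le> 2 * (y - x) * \<bar>G y - G x\<bar>"
      using xy J0 GJ by (cases "x = y") auto
  qed
  then show ?thesis unfolding D_def by simp
qed

text \<open>Polarisation of \<open>H1rep_square\<close>, applied to \<open>u + w\<close>,
  \<open>u\<close> and \<open>w\<close>.\<close>

lemma H1rep_mult:
  assumes u: "H1rep l u g" and w: "H1rep l w h"
  shows "H1rep l (\<lambda>x. u x * w x) (\<lambda>x. g x * w x + u x * h x)"
proof -
  have L: "L2_on l u" "L2_on l w" "L2_on l g" "L2_on l h"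
    using H1rep_L2_self H1rep_L2 u w by auto
  have bd: "L2_on l (\<lambda>x. k x * f x)" if k: "H1rep l k k'" and f: "L2_on l f" for k k' f
  proof -
    obtain C where "\<And>x. x \<in> {0..l} \<Longrightarrow> \<bar>k x\<bar> \<le> C"
      using continuous_on_bounded_interval[OF H1rep_continuous[OF k]] by blast
    then have "AE x in leb l. \<bar>k x\<bar> \<le> C" by (intro AE_I2) simp
    then show ?thesis
      by (rule L2_on_bounded_mult[OF f continuous_imp_measurable_leb[OF H1rep_continuous[OF k]]])
  qed
  have L2: "L2_on l (\<lambda>x. g x * w x)" "L2_on l (\<lambda>x. u x * h x)" "L2_on l (\<lambda>x. g x * u x)" "L2_on l (\<lambda>x. h x * w x)"
    using bd[OF w L(3)] bd[OF u L(4)] bd[OF u L(3)] bd[OF w L(4)] by (auto simp: mult.commute)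
  have "u x * w x = u 0 * w 0 + integral {0..x} (\<lambda>x. g x * w x + u x * h x)" if x: "x \<in> {0..l}" for x
  proof -
    note s = H1rep_square[OF H1rep_add[OF u w] x] H1rep_square[OF u x] H1rep_square[OF w x]
    have I: "f integrable_on {0..x}" if "L2_on l f" for f
      using L2_on_imp_integrable_on[OF that, of 0 x] x by auto
    have "integral {0..x} (\<lambda>t. 2 * ((g t + h t) * (u t + w t))) =
        integral {0..x} (\<lambda>t. 2 * (g t * u t) + 2 * (h t * w t) + 2 * (g t * w t + u t * h t))"
      by (intro arg_cong2[where f=integral] refl) (auto simp: algebra_simps)
    also have "\<dots> = integral {0..x} (\<lambda>t. 2 * (g t * u t)) + integral {0..x} (\<lambda>t. 2 * (h t * w t))
        + integral {0..x} (\<lambda>t. 2 * (g t * w t + u t * h t))"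
    proof -
      have i: "(\<lambda>t. 2 * (g t * u t)) integrable_on {0..x}" "(\<lambda>t. 2 * (h t * w t)) integrable_on {0..x}"
        "(\<lambda>t. 2 * (g t * w t + u t * h t)) integrable_on {0..x}"
        using L2 by (intro I L2_on_scale L2_on_add; simp)+
      show ?thesis
        using Henstock_Kurzweil_Integration.integral_add[OF integrable_add[OF i(1,2)] i(3)]
          Henstock_Kurzweil_Integration.integral_add[OF i(1,2)] by simp
    qed
    also have "integral {0..x} (\<lambda>t. 2 * (g t * w t + u t * h t)) = 2 * integral {0..x} (\<lambda>t. g t * w t + u t * h t)"
      by (rule Henstock_Kurzweil_Integration.integral_mult_right)
    finally show ?thesis
      using s power2_sum[of "u x" "w x"] power2_sum[of "u 0" "w 0"] by linarith
  qed
  then show ?thesis by (intro H1repI L2_on_add L2(1,2))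
qed

lemma H1rep_by_parts:
  assumes u: "H1rep l u g" and w: "H1rep l w h" and l: "0 \<le> l"
  shows "ip2 l g w + ip2 l u h = u l * w l - u 0 * w 0"
proof -
  have L: "L2_on l u" "L2_on l w" "L2_on l g" "L2_on l h"
    using H1rep_L2_self H1rep_L2 u w by auto
  have "ip2 l g w + ip2 l u h = integral\<^sup>L (leb l) (\<lambda>x. g x * w x + u x * h x)"
    unfolding ip2_def using L L2_on_mult_integrable by (intro Bochner_Integration.integral_add[symmetric]) auto
  also have "\<dots> = integral {0..l} (\<lambda>x. g x * w x + u x * h x)"
    using L L2_on_mult_integrable
    by (intro lebesgue_integral_eq_integral Bochner_Integration.integrable_add) auto
  also have "\<dots> = u l * w l - u 0 * w 0"
    using H1repD[OF H1rep_mult[OF u w], of l] l by simp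
  finally show ?thesis .
qed

section \<open>Test functions, the lemma of du Bois-Reymond and weak derivatives\<close>

lemma test_fun_H1rep:
  assumes "test_fun l \<phi>"
  shows "H1rep l \<phi> (deriv \<phi>)" "continuous_on UNIV (deriv \<phi>)" "\<phi> 0 = 0" "\<phi> l = 0"
    "\<exists>s t. 0 < s \<and> t < l \<and> (\<forall>x. x \<notin> {s..t} \<longrightarrow> \<phi> x = 0)"
proof -
  obtain D where D: "\<And>x. (\<phi> has_vector_derivative D x) (at x)" "continuous_on UNIV D"
    using assms unfolding test_fun_def C1_differentiable_on_def by auto
  then have d: "(\<phi> has_real_derivative D x) (at x)" for x
    by (simp add: has_real_derivative_iff_has_vector_derivative)
  have dD: "deriv \<phi> = D" using DERIV_imp_deriv[OF d] by (simp add: fun_eq_iff)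
  show "continuous_on UNIV (deriv \<phi>)" unfolding dD by (rule D(2))
  show "H1rep l \<phi> (deriv \<phi>)" unfolding dD
  proof (rule H1rep_C1)
    show "(\<phi> has_real_derivative D x) (at x within {0..l})" for x
      by (rule has_field_derivative_at_within[OF d])
    show "continuous_on {0..l} D" by (rule continuous_on_subset[OF D(2)]) simp
  qed
  show st: "\<exists>s t. 0 < s \<and> t < l \<and> (\<forall>x. x \<notin> {s..t} \<longrightarrow> \<phi> x = 0)"
    using assms unfolding test_fun_def by blast
  then show "\<phi> 0 = 0" "\<phi> l = 0" by force+
qed

lemma H1rep_weak_deriv:
  assumes u: "H1rep l u g" and l: "0 \<le> l"
  shows "weak_deriv_on l u g"
  unfolding weak_deriv_on_def
proof (intro allI impI)
  fix \<phi> assume "test_fun l \<phi>"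
  note t = test_fun_H1rep[OF this]
  show "integral\<^sup>L (leb l) (\<lambda>x. u x * deriv \<phi> x) = - integral\<^sup>L (leb l) (\<lambda>x. g x * \<phi> x)"
    using H1rep_by_parts[OF u t(1) l] t(3,4) by (simp add: ip2_def)
qed

text \<open>Tested against continuous approximations of its own sign, cut off near the ends,
  \<open>g\<close> yields the integral of its absolute value in the limit. Clipping the
  approximations to values between -1 and 1 permits dominated convergence.\<close>

lemma AE_zero_if_orthogonal_to_continuous:
  assumes g: "L2_on l g" and l: "0 < l"
    and orth: "\<And>\<psi> s t. \<lbrakk>continuous_on UNIV \<psi>; 0 < s; t < l; \<And>x. x \<notin> {s..t} \<Longrightarrow> \<psi> x = 0\<rbrakk> \<Longrightarrow> ip2 l g \<psi> = 0"
  shows "AE x in leb l. g x = 0"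
proof -
  have gm [measurable]: "g \<in> borel_measurable (leb l)" using g by (rule L2_on_measurable)
  have "(\<lambda>x. sgn (g x)) \<in> borel_measurable (leb l)"
    unfolding sgn_real_def by measurable
  then have "(\<lambda>x. sgn (g x)) measurable_on {0..l}" by (subst measurable_on_iff_borel_measurable) auto
  then obtain N s where N: "negligible N" and sc: "\<And>n. continuous_on UNIV (s n)"
    and lim: "\<And>x. x \<notin> N \<Longrightarrow> (\<lambda>n. s n x) \<longlonglongrightarrow> (if x \<in> {0..l} then sgn (g x) else 0)"
    unfolding measurable_on_def by blast
  \<comment> \<open>A cutoff that vanishes within \<open>1 / Suc n\<close> of both ends, which makes
    the support compact inside the open interval, and whose slope \<open>n\<close> lets it tend to 1
    at every interior point.\<close>
  define \<eta> where "\<eta> n x = min 1 (real n * max 0 (min (x - 1 / real (Suc n)) (l - 1 / real (Suc n) - x)))" for n x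
  define \<psi> where "\<psi> n x = max (-1) (min 1 (s n x)) * \<eta> n x" for n x
  have \<psi>c: "continuous_on UNIV (\<psi> n)" for n
    unfolding \<psi>_def \<eta>_def using sc by (intro continuous_intros) auto
  have \<psi>0: "\<psi> n x = 0" if "x \<notin> {1 / real (Suc n)..l - 1 / real (Suc n)}" for n x
    using that unfolding \<psi>_def \<eta>_def by (auto simp: not_le max_def min_def)
  have \<eta>b: "0 \<le> \<eta> n x" "\<eta> n x \<le> 1" for n x unfolding \<eta>_def by (auto intro!: mult_nonneg_nonneg)
  have \<psi>b: "\<bar>\<psi> n x\<bar> \<le> 1" for n x
    unfolding \<psi>_def abs_mult using \<eta>b[of n x] by (intro mult_le_one) (auto simp: abs_le_iff)
  have \<eta>lim: "(\<lambda>n. \<eta> n x) \<longlonglongrightarrow> 1" if x: "0 < x" "x < l" for x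
  proof -
    define d where "d = min x (l - x)"
    have d: "d > 0" and d_le: "d \<le> x" "d \<le> l - x" using x unfolding d_def by auto
    obtain n0 where n0: "2 / d < real n0" using reals_Archimedean2 by blast
    have "\<eta> n x = 1" if "n \<ge> n0" for n
    proof -
      have n: "2 / d < real n" using n0 that by linarith
      then have "2 / d < real (Suc n)" by simp
      then have "1 / real (Suc n) < d / 2" using d by (simp add: field_simps)
      then have m: "d / 2 \<le> min (x - 1 / real (Suc n)) (l - 1 / real (Suc n) - x)" using d_le by (intro min.boundedI) linarith+
      have "1 \<le> real n * (d / 2)" using n d by (simp add: field_simps)
      also have "\<dots> \<le> real n * max 0 (min (x - 1 / real (Suc n)) (l - 1 / real (Suc n) - x))"
        by (intro mult_left_mono order.trans[OF m max.cobounded2]) simp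
      finally show ?thesis unfolding \<eta>_def by simp
    qed
    then show ?thesis by (intro tendsto_eventually) (auto simp: eventually_sequentially)
  qed
  have zero: "ip2 l g (\<psi> n) = 0" for n
  proof (rule orth[OF \<psi>c])
    show "0 < 1 / real (Suc n)" "l - 1 / real (Suc n) < l" by auto
  qed (rule \<psi>0)
  have conv: "AE x in leb l. (\<lambda>n. g x * \<psi> n x) \<longlonglongrightarrow> \<bar>g x\<bar>"
  proof -
    have "negligible (N \<union> {0, l})" using N by (intro negligible_Un) auto
    then have "N \<union> {0, l} \<in> null_sets lebesgue" by (simp add: negligible_iff_null_sets)
    then have "AE x in lebesgue. x \<notin> N \<union> {0, l}" by (rule AE_not_in)
    then have "AE x in leb l. x \<notin> N \<union> {0, l}" by (subst AE_restrict_space_iff) auto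
    then show ?thesis
      using AE_space
    proof eventually_elim
      case (elim x)
      then have x: "0 < x" "x < l" "x \<notin> N" by auto
      have "(\<lambda>n. g x * (max (-1) (min 1 (s n x)) * \<eta> n x)) \<longlonglongrightarrow> g x * (max (-1) (min 1 (sgn (g x))) * 1)"
        using lim[OF x(3)] x \<eta>lim[OF x(1,2)] by (intro tendsto_intros) auto
      moreover have "g x * (max (-1) (min 1 (sgn (g x))) * 1) = \<bar>g x\<bar>"
        by (auto simp: sgn_real_def)
      ultimately show ?case by (simp add: \<psi>_def)
    qed
  qed
  have "(\<lambda>n. integral\<^sup>L (leb l) (\<lambda>x. g x * \<psi> n x)) \<longlonglongrightarrow> integral\<^sup>L (leb l) (\<lambda>x. \<bar>g x\<bar>)"
  proof (rule integral_dominated_convergence[where w="\<lambda>x. \<bar>g x\<bar>"])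
    show "(\<lambda>x. g x * \<psi> n x) \<in> borel_measurable (leb l)" for n
      using continuous_imp_measurable_leb[OF continuous_on_subset[OF \<psi>c]] by auto
    show "integrable (leb l) (\<lambda>x. \<bar>g x\<bar>)" using L2_on_integrable[OF g] by auto
    show "AE x in leb l. norm (g x * \<psi> n x) \<le> \<bar>g x\<bar>" for n
      using \<psi>b[of n] by (auto simp: abs_mult intro!: AE_I2 mult_left_le)
  qed (use conv in auto)
  then have "integral\<^sup>L (leb l) (\<lambda>x. \<bar>g x\<bar>) = 0" using zero by (simp add: ip2_def LIMSEQ_const_iff)
  then have "AE x in leb l. \<bar>g x\<bar> = 0"
    using L2_on_integrable[OF g] by (subst (asm) integral_nonneg_eq_0_iff_AE) auto
  then show ?thesis by simp
qed

text \<open>The lemma of du Bois-Reymond. A compactly supported continuous function is the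
  derivative of a test function once its integral vanishes, so a multiple of the fixed bump
  \<open>\<psi>0\<close> is subtracted. The constant is the average of \<open>U\<close> weighted by
  that bump.\<close>

lemma AE_constant_if_orthogonal_to_derivatives:
  assumes U: "L2_on l U" and l: "0 < l"
    and orth: "\<And>\<phi>. test_fun l \<phi> \<Longrightarrow> ip2 l U (deriv \<phi>) = 0"
  shows "\<exists>c. AE x in leb l. U x = c"
proof -
  interpret semi_inner "{u. L2_on l u}" "ip2 l" by (rule ip2_semi_inner)
  define \<psi>0 :: "real \<Rightarrow> real" where "\<psi>0 x = max 0 (min (x - l/4) (3*l/4 - x))" for x
  have \<psi>0c: "continuous_on UNIV \<psi>0" unfolding \<psi>0_def by (intro continuous_intros)
  have \<psi>00: "\<psi>0 x = 0" if "x \<notin> {l/4..3*l/4}" for x using that unfolding \<psi>0_def by (auto simp: max_def min_def)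
  have \<psi>0_ge: "0 \<le> \<psi>0 x" for x by (simp add: \<psi>0_def)
  define A where "A = integral {0..l} \<psi>0"
  have "A \<noteq> 0"
  proof
    assume "A = 0"
    then have "\<forall>x\<in>{0..l}. \<psi>0 x = 0"
      unfolding A_def using l
      by (subst (asm) integral_eq_0_iff) (auto intro: continuous_on_subset[OF \<psi>0c] simp: \<psi>0_ge)
    then have "\<psi>0 (l/2) = 0" using l by auto
    then show False using l by (auto simp: \<psi>0_def max_def min_def split: if_splits)
  qed
  define c where "c = ip2 l U \<psi>0 / A"
  have "AE x in leb l. U x - c = 0"
  proof (rule AE_zero_if_orthogonal_to_continuous[OF _ l])
    show "L2_on l (\<lambda>x. U x - c)" using U by auto
    fix \<psi> :: "real \<Rightarrow> real" and s t
    assume \<psi>c: "continuous_on UNIV \<psi>" and st: "0 < s" "t < l" and \<psi>s: "\<And>x. x \<notin> {s..t} \<Longrightarrow> \<psi> x = 0"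
    define \<alpha> where "\<alpha> = integral {0..l} \<psi> / A"
    define \<rho> where "\<rho> x = \<psi> x - \<alpha> * \<psi>0 x" for x
    have \<rho>c: "continuous_on UNIV \<rho>" unfolding \<rho>_def by (intro continuous_intros \<psi>c \<psi>0c)
    then have "\<And>x. isCont \<rho> x" by (simp add: continuous_on_eq_continuous_at)
    then have "\<exists>F. \<forall>x. -\<infinity> < ereal x \<longrightarrow> ereal x < \<infinity> \<longrightarrow> (F has_vector_derivative \<rho> x) (at x)"
      by (intro einterval_antiderivative) auto
    then obtain F where F: "\<And>x. (F has_real_derivative \<rho> x) (at x)"
      by (auto simp: has_real_derivative_iff_has_vector_derivative)
    define s' where "s' = min s (l/4)"
    define t' where "t' = max t (3*l/4)"
    have st': "0 < s'" "s' < l" "0 < t'" "t' < l" using st l unfolding s'_def t'_def by auto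
    \<comment> \<open>Outside the closed supports \<open>\<rho>\<close> vanishes; continuity adds
      the points \<open>s'\<close> and \<open>t'\<close>, so the antiderivative is constant on
      closed half-lines.\<close>
    have \<rho>s: "\<rho> x = 0" if "x \<le> s' \<or> t' \<le> x" for x
    proof -
      have out: "\<rho> x = 0" if "x < s' \<or> t' < x" for x
        using that \<psi>s[of x] \<psi>00[of x] unfolding \<rho>_def s'_def t'_def by auto
      have "\<rho> s' = 0"
      proof (rule continuous_constant_on_closure[of "{..<s'}" \<rho>])
        show "continuous_on (closure {..<s'}) \<rho>" by (rule continuous_on_subset[OF \<rho>c]) simp
      qed (use out in auto)
      moreover have "\<rho> t' = 0"
      proof (rule continuous_constant_on_closure[of "{t'<..}" \<rho>])
        show "continuous_on (closure {t'<..}) \<rho>" by (rule continuous_on_subset[OF \<rho>c]) simp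
      qed (use out in auto)
      ultimately show ?thesis using out[of x] that by (cases "x = s' \<or> x = t'") auto
    qed
    define \<phi> where "\<phi> x = F x - F 0" for x
    have d\<phi>: "(\<phi> has_real_derivative \<rho> x) (at x)" for x
      unfolding \<phi>_def using F[of x] by (auto intro!: derivative_eq_intros)
    have Fw: "(F has_real_derivative 0) (at x within S)" if "x \<le> s' \<or> t' \<le> x" for x S
      using has_field_derivative_at_within[OF F[of x], of S] \<rho>s[OF that] by simp
    have "\<exists>c. \<forall>x\<in>{..s'}. F x = c"
      by (rule has_field_derivative_zero_constant) (auto intro!: Fw simp: convex_real_interval)
    then have left: "F x = F 0" if "x \<le> s'" for x using that st' by auto
    have "\<exists>c. \<forall>x\<in>{t'..}. F x = c"
      by (rule has_field_derivative_zero_constant) (auto intro!: Fw simp: convex_real_interval)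
    then have right: "F x = F l" if "t' \<le> x" for x using that st' by auto
    have I0: "integral {0..l} \<rho> = 0"
    proof -
      have "integral {0..l} \<rho> = integral {0..l} \<psi> - integral {0..l} (\<lambda>x. \<alpha> * \<psi>0 x)"
        unfolding \<rho>_def
        by (intro Henstock_Kurzweil_Integration.integral_diff integrable_continuous_real
            continuous_on_mult_left continuous_on_subset[OF \<psi>c] continuous_on_subset[OF \<psi>0c]) auto
      then show ?thesis using \<open>A \<noteq> 0\<close> by (simp add: \<alpha>_def A_def)
    qed
    \<comment> \<open>Here the zero mean enters: the constant values of \<open>F\<close> on the two
      sides of the support agree, so \<open>\<phi>\<close> vanishes on both.\<close>
    have "(\<rho> has_integral (F l - F 0)) {0..l}"
      using l has_field_derivative_at_within[OF F]
      by (intro fundamental_theorem_of_calculus) (auto simp: has_real_derivative_iff_has_vector_derivative)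
    then have Fl: "F l = F 0" using I0 by (simp add: integral_unique)
    have "\<phi> C1_differentiable_on UNIV"
      unfolding C1_differentiable_on_def using d\<phi> \<rho>c
      by (intro exI[of _ \<rho>]) (simp add: has_real_derivative_iff_has_vector_derivative)
    moreover have "\<phi> x = 0" if "x \<notin> {s'..t'}" for x
      using that left[of x] right[of x] Fl unfolding \<phi>_def by (auto simp: not_le)
    ultimately have "test_fun l \<phi>"
      unfolding test_fun_def using st' by blast
    moreover have "deriv \<phi> = \<rho>" using DERIV_imp_deriv[OF d\<phi>] by (simp add: fun_eq_iff)
    ultimately have U\<rho>: "ip2 l U \<rho> = 0" using orth by auto
    have L: "L2_on l \<psi>" "L2_on l \<psi>0"
      using continuous_imp_L2_on continuous_on_subset[OF \<psi>c] continuous_on_subset[OF \<psi>0c] by auto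
    have "\<rho> = \<psi> - \<alpha> *\<^sub>R \<psi>0" by (auto simp: \<rho>_def)
    moreover have "\<alpha> *\<^sub>R \<psi>0 \<in> {u. L2_on l u}" using L mem(3)[of \<psi>0 \<alpha>] by simp
    ultimately have "ip2 l U \<psi> = \<alpha> * ip2 l U \<psi>0"
      using U\<rho> U L diff_right[of \<psi> "\<alpha> *\<^sub>R \<psi>0" U] scale_right[of \<psi>0 U \<alpha>] by simp
    also have "\<dots> = c * integral {0..l} \<psi>" unfolding \<alpha>_def c_def by simp
    also have "integral {0..l} \<psi> = ip2 l (\<lambda>x. 1) \<psi>" using L by (simp add: ip2_eq_integral)
    finally have "ip2 l U \<psi> = ip2 l (c *\<^sub>R (\<lambda>x. 1)) \<psi>" using L by (simp add: scale_left)
    then have "ip2 l (U - c *\<^sub>R (\<lambda>x. 1)) \<psi> = 0" using U L mem(3)[of "\<lambda>x. 1" c] by (subst diff_left) auto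
    moreover have "U - c *\<^sub>R (\<lambda>x. 1) = (\<lambda>x. U x - c)" by auto
    ultimately show "ip2 l (\<lambda>x. U x - c) \<psi> = 0" by simp
  qed
  then show ?thesis by auto
qed

text \<open>The difference of \<open>u\<close> and a primitive of \<open>g\<close> is orthogonal to
  all derivatives of test functions, hence constant almost everywhere, and the constant is absorbed
  into the primitive.\<close>

lemma weak_deriv_imp_H1rep:
  assumes u: "L2_on l u" and g: "L2_on l g" and l: "0 < l" and weak: "weak_deriv_on l u g"
  obtains w where "H1rep l w g" "AE x in leb l. u x = w x"
proof -
  interpret semi_inner "{u. L2_on l u}" "ip2 l" by (rule ip2_semi_inner)
  define p where "p x = 0 + integral {0..x} g" for x
  have p: "H1rep l p g" unfolding p_def by (rule H1rep_primitive[OF g])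
  have pL: "L2_on l p" by (rule H1rep_L2_self[OF p])
  have "\<exists>c. AE x in leb l. u x - p x = c"
  proof (rule AE_constant_if_orthogonal_to_derivatives[OF _ l])
    show "L2_on l (\<lambda>x. u x - p x)" using u pL by auto
    fix \<phi> assume t: "test_fun l \<phi>"
    have "L2_on l (deriv \<phi>)" using test_fun_H1rep(1)[OF t] H1rep_L2 by auto
    moreover have "ip2 l u (deriv \<phi>) = ip2 l p (deriv \<phi>)"
      using weak H1rep_weak_deriv[OF p] l t unfolding weak_deriv_on_def ip2_def by simp
    ultimately have "ip2 l (u - p) (deriv \<phi>) = 0" using u pL by (simp add: diff_left)
    then show "ip2 l (\<lambda>x. u x - p x) (deriv \<phi>) = 0" by (simp add: fun_diff_def)
  qed
  then obtain c where c: "AE x in leb l. u x - p x = c" by blast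
  show thesis
  proof
    show "H1rep l (\<lambda>x. c + integral {0..x} g) g" by (rule H1rep_primitive[OF g])
    show "AE x in leb l. u x = c + integral {0..x} g"
      using c by eventually_elim (auto simp: p_def)
  qed
qed

text \<open>Integration by parts shows that \<open>r\<close> is orthogonal to every polynomial, and
  polynomials approximate continuous functions uniformly.\<close>

lemma H1rep_zero:
  assumes r: "H1rep l (\<lambda>x. 0) r" and l: "0 < l"
  shows "AE x in leb l. r x = 0"
proof (rule AE_zero_if_orthogonal_to_continuous[OF H1rep_L2[OF r] l])
  interpret semi_inner "{u. L2_on l u}" "ip2 l" by (rule ip2_semi_inner)
  note rL = H1rep_L2[OF r]
  fix \<psi> :: "real \<Rightarrow> real" assume \<psi>c: "continuous_on UNIV \<psi>"
  have \<psi>L: "L2_on l \<psi>" using continuous_imp_L2_on continuous_on_subset[OF \<psi>c] by auto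
  have bd: "\<bar>ip2 l r \<psi>\<bar> \<le> e * (integral\<^sup>L (leb l) (\<lambda>x. \<bar>r x\<bar>))" if "e > 0" for e
  proof -
    obtain p where p: "real_polynomial_function p" "\<And>x. x \<in> {0..l} \<Longrightarrow> \<bar>\<psi> x - p x\<bar> < e"
      using Stone_Weierstrass_real_polynomial_function[of "{0..l}" \<psi> e] \<psi>c \<open>e > 0\<close>
      by (auto intro: continuous_on_subset)
    obtain p' where p': "real_polynomial_function p'" "\<And>x. (p has_real_derivative p' x) (at x)"
      using has_real_derivative_polynomial_function[OF p(1)] by blast
    have "continuous_on {0..l} p'"
      using p'(1) by (simp add: continuous_on_polymonial_function real_polynomial_function_eq)
    then have P: "H1rep l p p'"
      by (rule H1rep_C1[OF has_field_derivative_at_within[OF p'(2)]])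
    have pL: "L2_on l p" by (rule H1rep_L2_self[OF P])
    have "ip2 l r p = 0" using H1rep_by_parts[OF r P] l by (simp add: ip2_def)
    then have "ip2 l r \<psi> = ip2 l r (\<psi> - p)" using rL \<psi>L pL by (simp add: diff_right)
    also have "\<bar>\<dots>\<bar> \<le> integral\<^sup>L (leb l) (\<lambda>x. e * \<bar>r x\<bar>)"
      unfolding ip2_def
    proof (rule order_trans[OF integral_abs_bound] , rule integral_mono)
      have "L2_on l (\<lambda>x. \<psi> x - p x)" using \<psi>L pL by auto
      from L2_on_mult_integrable[OF rL this]
      show "integrable (leb l) (\<lambda>x. \<bar>r x * (\<psi> - p) x\<bar>)" by simp
      show "integrable (leb l) (\<lambda>x. e * \<bar>r x\<bar>)" using L2_on_integrable[OF rL] by auto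
      show "\<bar>r x * (\<psi> - p) x\<bar> \<le> e * \<bar>r x\<bar>" if "x \<in> space (leb l)" for x
        using p(2)[of x] that by (auto simp: abs_mult mult.commute[of e] intro!: mult_left_mono)
    qed
    finally show ?thesis by simp
  qed
  have "\<bar>ip2 l r \<psi>\<bar> \<le> 0"
  proof (rule field_le_epsilon)
    fix e :: real assume e: "0 < e"
    define R where "R = integral\<^sup>L (leb l) (\<lambda>x. \<bar>r x\<bar>)"
    have R: "0 \<le> R" unfolding R_def by simp
    have "\<bar>ip2 l r \<psi>\<bar> \<le> e / (R + 1) * R"
      unfolding R_def[symmetric] using e R by (intro bd[folded R_def]) simp
    also have "\<dots> \<le> e" using e R by (simp add: field_simps)
    finally show "\<bar>ip2 l r \<psi>\<bar> \<le> 0 + e" by simp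
  qed
  then show "ip2 l r \<psi> = 0" by simp
qed

lemma continuous_AE_eq_imp_eq:
  fixes u w :: "real \<Rightarrow> real"
  assumes c: "continuous_on {0..l} u" "continuous_on {0..l} w" and ae: "AE x in leb l. u x = w x"
    and l: "0 < l" and x: "x \<in> {0..l}"
  shows "u x = w x"
proof -
  have "integral\<^sup>L (leb l) (\<lambda>x. (u x - w x)\<^sup>2) = integral\<^sup>L (leb l) (\<lambda>x. 0)"
  proof (rule integral_cong_AE)
    show "(\<lambda>x. (u x - w x)\<^sup>2) \<in> borel_measurable (leb l)"
      using c by (intro continuous_imp_measurable_leb continuous_intros)
    show "AE x in leb l. (u x - w x)\<^sup>2 = 0" using ae by eventually_elim simp
  qed simp
  then have "\<forall>x\<in>{0..l}. (u x - w x)\<^sup>2 = 0"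
    using l c by (subst integralL_eq_0_iff[symmetric]) (auto intro!: continuous_intros)
  then show ?thesis using x by simp
qed

lemma H1rep_unique:
  assumes u: "H1rep l u g" and w: "H1rep l w h" and ae: "AE x in leb l. u x = w x" and l: "0 < l"
  shows "\<And>x. x \<in> {0..l} \<Longrightarrow> u x = w x" "AE x in leb l. g x = h x"
proof -
  show eq: "u x = w x" if "x \<in> {0..l}" for x
    by (rule continuous_AE_eq_imp_eq[OF H1rep_continuous[OF u] H1rep_continuous[OF w] ae l that])
  have d: "H1rep l (\<lambda>x. u x - w x) (\<lambda>x. g x - h x)" by (rule H1rep_diff[OF u w])
  have "H1rep l (\<lambda>x. 0) (\<lambda>x. g x - h x)"
  proof (rule H1repI[OF H1rep_L2[OF d]])
    fix x assume x: "x \<in> {0..l}"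
    show "0 = 0 + integral {0..x} (\<lambda>x. g x - h x)"
      using H1repD[OF d x] eq[OF x] eq[of 0] l by simp
  qed
  from H1rep_zero[OF this l] show "AE x in leb l. g x = h x" by eventually_elim simp
qed

section \<open>Chosen weak derivatives and point values in terms of representatives\<close>

lemma weak_deriv_AE_cong:
  assumes "weak_deriv_on l u g" "u \<in> borel_measurable (leb l)" "u' \<in> borel_measurable (leb l)"
    "AE x in leb l. u x = u' x"
  shows "weak_deriv_on l u' g"
  unfolding weak_deriv_on_def
proof (intro allI impI)
  fix \<phi> assume t: "test_fun l \<phi>"
  have m: "deriv \<phi> \<in> borel_measurable (leb l)"
    using continuous_imp_measurable_leb continuous_on_subset[OF test_fun_H1rep(2)[OF t]] by blast
  have "integral\<^sup>L (leb l) (\<lambda>x. u' x * deriv \<phi> x) = integral\<^sup>L (leb l) (\<lambda>x. u x * deriv \<phi> x)"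
    by (rule integral_cong_AE) (use assms m in auto)
  then show "integral\<^sup>L (leb l) (\<lambda>x. u' x * deriv \<phi> x) = - integral\<^sup>L (leb l) (\<lambda>x. g x * \<phi> x)"
    using assms(1) t unfolding weak_deriv_on_def by simp
qed

text \<open>\<open>wderiv\<close> is an arbitrary choice among weak derivatives. Whatever is chosen
  has a representative of its own, which agrees with \<open>w\<close> almost everywhere, and
  uniqueness of representatives identifies the derivatives.\<close>

lemma wderiv_AE_eq:
  assumes w: "H1rep l w g" and u: "u \<in> borel_measurable (leb l)" "AE x in leb l. u x = w x" and l: "0 < l"
  shows "L2_on l (wderiv l u)" "AE x in leb l. wderiv l u x = g x"
proof -
  have uL: "L2_on l u"
    using u by (intro L2_on_AE_cong[OF H1rep_L2_self[OF w]]) auto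
  have "weak_deriv_on l u g"
  proof (rule weak_deriv_AE_cong)
    show "weak_deriv_on l w g" using H1rep_weak_deriv[OF w] l by simp
    show "w \<in> borel_measurable (leb l)" by (rule L2_on_measurable[OF H1rep_L2_self[OF w]])
    show "AE x in leb l. w x = u x" using u(2) by auto
  qed (rule u(1))
  then have "L2_on l g \<and> weak_deriv_on l u g" using H1rep_L2[OF w] by simp
  then have *: "L2_on l (wderiv l u) \<and> weak_deriv_on l u (wderiv l u)"
    unfolding wderiv_def by (rule someI[where P="\<lambda>g. L2_on l g \<and> weak_deriv_on l u g"])
  then show "L2_on l (wderiv l u)" by simp
  obtain v where v: "H1rep l v (wderiv l u)" "AE x in leb l. u x = v x"
    using weak_deriv_imp_H1rep[OF uL _ l] * by metis
  have "AE x in leb l. v x = w x" using v(2) u(2) by eventually_elim simp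
  from H1rep_unique(2)[OF v(1) w this l] show "AE x in leb l. wderiv l u x = g x" .
qed

lemma pt_value_eq:
  assumes c: "continuous_on {0..l} w" and ae: "AE x in leb l. u x = w x" and l: "0 < l" and t: "t \<in> {0..l}"
  shows "pt_value l u t = w t"
  unfolding pt_value_def
proof (rule the_equality)
  show "\<exists>v. continuous_on {0..l} v \<and> (AE x in leb l. u x = v x) \<and> v t = w t" using c ae by blast
  fix d assume "\<exists>v. continuous_on {0..l} v \<and> (AE x in leb l. u x = v x) \<and> v t = d"
  then obtain v where v: "continuous_on {0..l} v" "AE x in leb l. u x = v x" "v t = d" by blast
  have "AE x in leb l. v x = w x" using v(2) ae by eventually_elim simp
  from continuous_AE_eq_imp_eq[OF v(1) c this l t] show "d = w t" using v(3) by simp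
qed

text \<open>The weak derivative of \<open>u\<close> agrees almost everywhere with a primitive
  \<open>G\<close>; exchanging the two gives a representative \<open>w\<close> whose derivative has
  values at the ends of the edge.\<close>

lemma H2_onD:
  assumes u: "H2_on l u" and l: "0 < l"
  obtains w G k where "L2_on l u" "H1rep l w G" "H1rep l G k" "AE x in leb l. u x = w x"
proof -
  obtain g h where g: "L2_on l u" "L2_on l g" "L2_on l h" "weak_deriv_on l g h" "weak_deriv_on l u g"
    using u unfolding H2_on_def H1_on_def by blast
  obtain G where G: "H1rep l G h" "AE x in leb l. g x = G x"
    using weak_deriv_imp_H1rep[OF g(2,3) l g(4)] .
  obtain w where w: "H1rep l w g" "AE x in leb l. u x = w x"
    using weak_deriv_imp_H1rep[OF g(1,2) l g(5)] .
  have "H1rep l w G"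
    by (rule H1rep_AE_cong[OF w(1) L2_on_measurable[OF H1rep_L2_self[OF G(1)]] G(2)])
  then show thesis using that g(1) G(1) w(2) by blast
qed

lemma H2_onI:
  assumes w: "H1rep l w G" "H1rep l G k" and l: "0 < l"
  shows "H2_on l w"
  unfolding H2_on_def H1_on_def
  using H1rep_L2_self[OF w(1)] H1rep_L2_self[OF w(2)] H1rep_L2[OF w(2)]
    H1rep_weak_deriv[OF w(1)] H1rep_weak_deriv[OF w(2)] l by auto

text \<open>A Lipschitz function is the primitive of the strong limit of \<open>L\<^sup>2\<close>-minimal elements of
  shrinking convex sets; difference quotients show that these sets contain bounded elements.\<close>

lemma Lipschitz_imp_H1rep:
  assumes l: "0 < l" and lip: "\<And>x y. x \<in> {0..l} \<Longrightarrow> y \<in> {0..l} \<Longrightarrow> \<bar>\<alpha> x - \<alpha> y\<bar> \<le> C * \<bar>x - y\<bar>"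
  obtains \<alpha>' where "H1rep l \<alpha> \<alpha>'"
proof -
  interpret complete_semi_inner "{u. L2_on l u}" "ip2 l" by (rule ip2_complete)
  define K where "K n = {g. L2_on l g \<and> (\<forall>x\<in>{0..l}. \<bar>integral {0..x} g - (\<alpha> x - \<alpha> 0)\<bar> \<le> 1 / real (Suc n))}" for n :: nat
  have C0: "0 \<le> C"
  proof -
    have "0 \<le> C * \<bar>0 - l\<bar>" using lip[of 0 l] l by (intro order_trans[OF abs_ge_zero]) auto
    then show ?thesis using l by (simp add: zero_le_mult_iff)
  qed
  \<comment> \<open>Constant extension beyond the ends preserves the Lipschitz constant and gives a
    meaning to the difference quotient where \<open>x + h\<close> exceeds \<open>l\<close>.\<close>
  define b where "b x = \<alpha> (max 0 (min l x))" for x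
  have blip: "\<bar>b x - b y\<bar> \<le> C * \<bar>x - y\<bar>" for x y
  proof -
    have "\<bar>b x - b y\<bar> \<le> C * \<bar>max 0 (min l x) - max 0 (min l y)\<bar>"
      unfolding b_def using l by (intro lip) auto
    also have "\<dots> \<le> C * \<bar>x - y\<bar>" using C0 by (intro mult_left_mono) auto
    finally show ?thesis .
  qed
  have bc: "continuous_on S b" for S
  proof (rule continuous_on_subset[of UNIV])
    have "C-lipschitz_on UNIV b" using blip C0 by (auto simp: lipschitz_on_def dist_real_def)
    then show "continuous_on UNIV b" by (rule lipschitz_on_continuous_on)
  qed simp
  have b\<alpha>: "b x = \<alpha> x" if "x \<in> {0..l}" for x using that unfolding b_def by auto
  have bi: "b integrable_on {x..y}" for x y by (intro integrable_continuous_real bc)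
  have Kex: "\<exists>g\<in>K n. ip2 l g g \<le> C\<^sup>2 * l" for n
  proof -
    \<comment> \<open>The primitive of the difference quotient misses
      \<open>\<alpha> x - \<alpha> 0\<close> by at most \<open>2 * C * h\<close>. This
      \<open>h\<close> keeps the error below \<open>1 / Suc n\<close>; the added 1 covers
      \<open>C = 0\<close>.\<close>
    define h where "h = 1 / (real (Suc n) * (2 * C + 1))"
    have h: "h > 0" using C0 unfolding h_def by simp
    define d where "d x = (1 / h) * (b (x + h) - b x)" for x
    have dc: "continuous_on S d" for S
    proof -
      have "continuous_on S (b \<circ> (\<lambda>x. x + h))" by (intro continuous_on_compose bc continuous_intros)
      then show ?thesis unfolding d_def o_def by (intro continuous_intros bc)
    qed
    have dL: "L2_on l d" by (intro continuous_imp_L2_on dc)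
    have "\<bar>d x\<bar> \<le> C" for x
      using blip[of "x + h" x] h unfolding d_def abs_mult by (simp add: field_simps)
    then have "(d x)\<^sup>2 \<le> C\<^sup>2" for x by (metis abs_ge_zero power2_abs power_mono)
    then have "integral {0..l} (\<lambda>x. (d x)\<^sup>2) \<le> integral {0..l} (\<lambda>x. C\<^sup>2)"
      by (intro integral_le integrable_continuous_real continuous_intros dc) auto
    then have nd: "ip2 l d d \<le> C\<^sup>2 * l" using l by (simp add: ip2_eq_integral[OF dL dL] power2_eq_square mult_ac)
    have avg: "\<bar>(1 / h) * integral {x..x+h} b - b x\<bar> \<le> C * h" for x
    proof -
      have "\<bar>integral {x..x+h} (\<lambda>t. b t - b x)\<bar> \<le> integral {x..x+h} (\<lambda>t. C * h)"
      proof (subst real_norm_def[symmetric], rule integral_norm_bound_integral)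
        show "norm (b t - b x) \<le> C * h" if "t \<in> {x..x+h}" for t
        proof -
          have "C * \<bar>t - x\<bar> \<le> C * h" using that C0 by (intro mult_left_mono) auto
          then show ?thesis using blip[of t x] by simp
        qed
      qed (auto intro!: integrable_diff bi)
      also have "\<dots> = h * (C * h)" using h by simp
      also have "integral {x..x+h} (\<lambda>t. b t - b x) = integral {x..x+h} b - h * b x"
        using h by (subst Henstock_Kurzweil_Integration.integral_diff) (auto intro: bi)
      finally have "\<bar>integral {x..x+h} b - h * b x\<bar> \<le> h * (C * h)" .
      then have "\<bar>h * ((1 / h) * integral {x..x+h} b - b x)\<bar> \<le> h * (C * h)"
        using h by (simp add: right_diff_distrib)
      then show ?thesis using h by (simp add: abs_mult)
    qed
    have "\<bar>integral {0..x} d - (\<alpha> x - \<alpha> 0)\<bar> \<le> 1 / real (Suc n)" if x: "x \<in> {0..l}" for x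
    proof -
      have "integral {0..x} d = (1 / h) * (integral {0..x} (\<lambda>t. b (t + h)) - integral {0..x} b)"
      proof -
        have "(\<lambda>t. b (t + h)) integrable_on {0..x}"
        proof (rule integrable_continuous_real)
          have "continuous_on {0..x} (b \<circ> (\<lambda>x. x + h))" by (intro continuous_on_compose bc continuous_intros)
          then show "continuous_on {0..x} (\<lambda>t. b (t + h))" by (simp add: o_def)
        qed
        then show ?thesis
          unfolding d_def Henstock_Kurzweil_Integration.integral_mult_right
          by (subst Henstock_Kurzweil_Integration.integral_diff) (auto intro: bi)
      qed
      also have "integral {0..x} (\<lambda>t. b (t + h)) = integral {h..x+h} b"
        using integral_shift_Icc_real[of 0 x b h] by (simp add: o_def add.commute)
      also have "integral {h..x+h} b - integral {0..x} b = integral {x..x+h} b - integral {0..0+h} b"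
        using Henstock_Kurzweil_Integration.integral_combine[of 0 h "x+h" b]
          Henstock_Kurzweil_Integration.integral_combine[of 0 x "x+h" b] h x bi by simp
      finally have "integral {0..x} d - (\<alpha> x - \<alpha> 0) =
          ((1 / h) * integral {x..x+h} b - b x) - ((1 / h) * integral {0..0+h} b - b 0)"
        using b\<alpha>[OF x] b\<alpha>[of 0] l by (simp add: algebra_simps)
      also have "\<bar>\<dots>\<bar> \<le> 2 * C * h" using avg[of x] avg[of 0] by simp
      also have "\<dots> \<le> 1 / real (Suc n)"
        using C0 unfolding h_def by (simp add: divide_simps) 
      finally show ?thesis .
    qed
    then show ?thesis using dL nd unfolding K_def by blast
  qed
  define c where "c n = Inf ((\<lambda>g. ip2 l g g) ` K n)" for n
  have KL: "L2_on l g" if "g \<in> K n" for g n using that unfolding K_def by auto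
  have bdd: "bdd_below ((\<lambda>g. ip2 l g g) ` K n)" for n
    using KL by (intro bdd_belowI[of _ 0]) (auto intro: nonneg)
  have ne: "(\<lambda>g. ip2 l g g) ` K n \<noteq> {}" for n using Kex[of n] by auto
  have c_le: "c n \<le> ip2 l g g" if "g \<in> K n" for n g
    unfolding c_def using that bdd by (intro cInf_lower) auto
  have Kmono: "K m \<subseteq> K n" if "n \<le> m" for m n
  proof -
    have "1 / real (Suc m) \<le> 1 / real (Suc n)" using that by (intro divide_left_mono) auto
    then show ?thesis unfolding K_def by force
  qed
  have "incseq c"
    unfolding incseq_def c_def using Kmono ne bdd by (auto intro!: cInf_superset_mono)
  moreover have "c n \<le> C\<^sup>2 * l" for n using Kex[of n] c_le[of _ n] by (meson order_trans)
  ultimately have "convergent c" using incseq_convergent by (metis convergent_def)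
  then have cC: "Cauchy c" by (simp add: Cauchy_convergent_iff)
  have "\<exists>g. g \<in> K n \<and> ip2 l g g < c n + 1 / real (Suc n)" for n
    using cInf_lessD[OF ne, of n "c n + 1 / real (Suc n)"] unfolding c_def by auto
  then obtain g where g: "\<And>n. g n \<in> K n" "\<And>n. ip2 l (g n) (g n) < c n + 1 / real (Suc n)" by metis
  have gL: "L2_on l (g n)" for n using g(1) KL by blast
  have half: "\<bar>1 / 2 * (P + Q) - a\<bar> \<le> e" if "\<bar>P - a\<bar> \<le> e" "\<bar>Q - a\<bar> \<le> e" for P Q a e :: real
    using that by (auto simp: abs_le_iff field_simps)
  \<comment> \<open>The midpoint of \<open>g n\<close> and \<open>g m\<close> stays in the convex
    set \<open>K n\<close>, so the parallelogram law bounds their distance by the growth of the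
    minima \<open>c\<close>, which increase and are bounded.\<close>
  have est: "ip2 l (g n - g m) (g n - g m) \<le> 2 * (c m - c n) + 2 / real (Suc n) + 2 / real (Suc m)" if nm: "n \<le> m" for n m
  proof -
    have gm: "g m \<in> K n" using Kmono[OF nm] g(1) by auto
    have "(1/2) *\<^sub>R (g n + g m) \<in> K n"
      unfolding K_def
    proof (intro CollectI conjI ballI)
      show "L2_on l ((1/2) *\<^sub>R (g n + g m))" using gL mem by auto
      fix x assume x: "x \<in> {0..l}"
      have i: "g k integrable_on {0..x}" for k using L2_on_imp_integrable_on[OF gL] x by auto
      have "integral {0..x} ((1/2) *\<^sub>R (g n + g m)) = (1/2) * (integral {0..x} (g n) + integral {0..x} (g m))"
        using Henstock_Kurzweil_Integration.integral_add[OF i[of n] i[of m]]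
        by (simp add: scaleR_fun_def plus_fun_def)
      moreover have "\<bar>integral {0..x} (g n) - (\<alpha> x - \<alpha> 0)\<bar> \<le> 1 / real (Suc n)"
        "\<bar>integral {0..x} (g m) - (\<alpha> x - \<alpha> 0)\<bar> \<le> 1 / real (Suc n)"
        using g(1)[of n] gm x unfolding K_def by auto
      ultimately show "\<bar>integral {0..x} ((1/2) *\<^sub>R (g n + g m)) - (\<alpha> x - \<alpha> 0)\<bar> \<le> 1 / real (Suc n)"
        by (simp only: half)
    qed
    from c_le[OF this] have "4 * c n \<le> ip2 l (g n + g m) (g n + g m)"
      using sq_scale[OF mem(2), of "g n" "g m" "1/2"] gL by (simp add: power2_eq_square)
    then show ?thesis
      using g(2)[of n] g(2)[of m] gL by (simp add: sq_add sq_diff)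
  qed
  have "\<exists>x\<in>{u. L2_on l u}. (\<lambda>n. ip2 l (g n - x) (g n - x)) \<longlonglongrightarrow> 0"
  proof (rule complete)
    show "g n \<in> {u. L2_on l u}" for n using gL by simp
    fix e :: real assume e: "0 < e"
    obtain N1 where N1: "\<And>m n. m \<ge> N1 \<Longrightarrow> n \<ge> N1 \<Longrightarrow> \<bar>c m - c n\<bar> < e / 4"
      using metric_CauchyD[OF cC, of "e/4"] e by (auto simp: dist_real_def)
    obtain N2 where N2: "8 / e < real N2" using reals_Archimedean2 by blast
    have small: "2 / real (Suc i) < e / 4" if "N2 \<le> i" for i
    proof -
      have "8 / e < real (Suc i)" using N2 that by linarith
      then show ?thesis using e by (simp add: field_simps)
    qed
    have one: "ip2 l (g n - g m) (g n - g m) < e" if "n \<le> m" "N1 \<le> n" "N2 \<le> n" for n m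
    proof -
      have "\<bar>c m - c n\<bar> < e / 4" by (rule N1) (use that in simp_all)
      with abs_ge_self have "c m - c n < e / 4" by (rule order.strict_trans1)
      then show ?thesis using est[OF that(1)] small[of n] small[of m] that by simp
    qed
    have "ip2 l (g n - g m) (g n - g m) < e" if "max N1 N2 \<le> n" "max N1 N2 \<le> m" for n m
      using one[of n m] one[of m n] that sq_diff_commute[of "g n" "g m"] gL by (cases "n \<le> m") auto
    then show "\<exists>N. \<forall>m\<ge>N. \<forall>n\<ge>N. ip2 l (g m - g n) (g m - g n) < e" by blast
  qed
  then obtain f where f: "L2_on l f" "(\<lambda>n. ip2 l (g n - f) (g n - f)) \<longlonglongrightarrow> 0" by blast
  have "\<alpha> x = \<alpha> 0 + integral {0..x} f" if x: "x \<in> {0..l}" for x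
  proof -
    have "(\<lambda>n. integral {0..x} (g n - f)) \<longlonglongrightarrow> 0"
    proof -
      have "(\<lambda>n. (integral {0..x} (g n - f))\<^sup>2) \<longlonglongrightarrow> 0"
      proof (rule tendsto_sandwich[OF _ _ tendsto_const])
        show "\<forall>\<^sub>F n in sequentially. (integral {0..x} (g n - f))\<^sup>2 \<le> l * ip2 l (g n - f) (g n - f)"
        proof (intro always_eventually allI)
          fix n
          have L: "L2_on l (g n - f)" using gL f mem(4)[of "g n" f] by simp
          have "(integral {0..x} (g n - f))\<^sup>2 \<le> (x - 0) * integral {0..x} (\<lambda>t. ((g n - f) t)\<^sup>2)"
            using integral_sq_le[OF L, of 0 x] x by simp
          also have "\<dots> \<le> l * ip2 l (g n - f) (g n - f)"
            using x integral_sq_mono[OF L, of 0 x] L nonneg[of "g n - f"]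
            by (intro mult_mono integral_nonneg L2_on_imp_integrable_on(2)[OF L]) auto
          finally show "(integral {0..x} (g n - f))\<^sup>2 \<le> l * ip2 l (g n - f) (g n - f)" .
        qed
        show "(\<lambda>n. l * ip2 l (g n - f) (g n - f)) \<longlonglongrightarrow> 0" using tendsto_mult_right_zero[OF f(2)] by simp
      qed simp
      then show ?thesis by simp
    qed
    moreover have "integral {0..x} (g n - f) = integral {0..x} (g n) - integral {0..x} f" for n
      using Henstock_Kurzweil_Integration.integral_diff[of "g n" "{0..x}" f]
        L2_on_imp_integrable_on[OF gL, of 0 x] L2_on_imp_integrable_on[OF f(1), of 0 x] x
      by (simp add: fun_diff_def)
    ultimately have lim: "(\<lambda>n. integral {0..x} (g n)) \<longlonglongrightarrow> integral {0..x} f"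
      by (simp add: LIM_zero_iff)
    have "(\<lambda>n. integral {0..x} (g n) - (\<alpha> x - \<alpha> 0)) \<longlonglongrightarrow> 0"
    proof (rule Lim_null_comparison)
      show "\<forall>\<^sub>F n in sequentially. norm (integral {0..x} (g n) - (\<alpha> x - \<alpha> 0)) \<le> 1 / real (Suc n)"
        using g(1) x unfolding K_def by auto
      show "(\<lambda>n. 1 / real (Suc n)) \<longlonglongrightarrow> 0" using LIMSEQ_Suc[OF lim_1_over_n] by simp
    qed
    then have "(\<lambda>n. integral {0..x} (g n)) \<longlonglongrightarrow> \<alpha> x - \<alpha> 0" by (simp add: LIM_zero_iff)
    from LIMSEQ_unique[OF lim this] show ?thesis by simp
  qed
  then have "H1rep l \<alpha> f" by (rule H1repI[OF f(1)])
  then show thesis by (rule that)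
qed

lemma H1rep_compact:
  fixes u g :: "nat \<Rightarrow> real \<Rightarrow> real"
  assumes u: "\<And>n. H1rep l (u n) (g n)" and b0: "\<And>n. \<bar>u n 0\<bar> \<le> K" and bg: "\<And>n. ip2 l (g n) (g n) \<le> K"
    and l: "0 < l"
  obtains w r where "strict_mono (r :: nat \<Rightarrow> nat)" "uniform_limit {0..l} (\<lambda>n. u (r n)) w sequentially"
proof -
  have K: "0 \<le> K" using b0[of 0] by simp
  have Ho: "(u n y - u n x)\<^sup>2 \<le> \<bar>y - x\<bar> * K" if "x \<in> {0..l}" "y \<in> {0..l}" for n x y
    using H1rep_Hoelder[OF u that] bg[of n] by (meson abs_ge_zero mult_left_mono order_trans)
  show thesis
  proof (rule Arzela_Ascoli[of "{0..l}" u "K + sqrt (l * K)"])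
    show "compact {0..l}" by simp
    show "norm (u n x) \<le> K + sqrt (l * K)" if x: "x \<in> {0..l}" for n x
    proof -
      have "(u n x - u n 0)\<^sup>2 \<le> \<bar>x - 0\<bar> * K" using Ho[of 0 x n] x l by auto
      also have "\<dots> \<le> l * K" using x K by (intro mult_right_mono) auto
      finally have "\<bar>u n x - u n 0\<bar> \<le> sqrt (l * K)" by (simp add: real_le_rsqrt)
      then show ?thesis using b0[of n] by simp
    qed
    show "\<exists>d. 0 < d \<and> (\<forall>n y. y \<in> {0..l} \<and> norm (x - y) < d \<longrightarrow> norm (u n x - u n y) < e)"
      if x: "x \<in> {0..l}" and e: "0 < e" for x e
    proof (intro exI conjI allI impI)
      \<comment> \<open>From \<open>(u n x - u n y)\<^sup>2 \<le> \<bar>x - y\<bar> * K\<close>,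
        uniformly in \<open>n\<close>; the added 1 covers \<open>K = 0\<close>.\<close>
      show d: "0 < e\<^sup>2 / (K + 1)" using e K by simp
      fix n y assume y: "y \<in> {0..l} \<and> norm (x - y) < e\<^sup>2 / (K + 1)"
      have "(u n x - u n y)\<^sup>2 \<le> \<bar>x - y\<bar> * K" using Ho[of y x n] x y by auto
      also have "\<dots> \<le> \<bar>x - y\<bar> * (K + 1)" by (intro mult_left_mono) auto
      also have "\<dots> < e\<^sup>2" using y K by (simp add: field_simps)
      finally show "norm (u n x - u n y) < e"
        using e by (metis power2_abs power2_less_imp_less less_imp_le real_norm_def)
    qed
    fix w r assume r: "strict_mono (r :: nat \<Rightarrow> nat)"
      "\<And>e. 0 < e \<Longrightarrow> \<exists>N. \<forall>n x. n \<ge> N \<and> x \<in> {0..l} \<longrightarrow> norm (u (r n) x - w x) < e"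
    have "uniform_limit {0..l} (\<lambda>n. u (r n)) w sequentially"
      using r(2) unfolding uniform_limit_iff eventually_sequentially dist_norm by meson
    then show thesis using that r(1) by blast
  qed
qed

section \<open>Linear algebra of the vertex conditions\<close>

lemma scalar_prod_real_self_nonneg: "0 \<le> scalar_prod (v :: real Matrix.vec) v"
  by (simp add: scalar_prod_def sum_nonneg)

lemma scalar_prod_real_self_zero:
  assumes "v \<in> carrier_vec d" "scalar_prod (v :: real Matrix.vec) v = 0"
  shows "v = 0\<^sub>v d"
proof (rule eq_vecI)
  have "(\<Sum>i<d. (v $ i)\<^sup>2) = 0"
    using assms by (simp add: scalar_prod_def atLeast0LessThan power2_eq_square)
  then have "\<forall>i\<in>{..<d}. (v $ i)\<^sup>2 = 0" by (subst sum_nonneg_eq_0_iff[symmetric]) auto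
  then show "v $ i = 0\<^sub>v d $ i" if "i < dim_vec (0\<^sub>v d)" for i using that by auto
qed (use assms in auto)

lemma Cauchy_Schwarz_vec:
  assumes "u \<in> carrier_vec d" "v \<in> carrier_vec d"
  shows "\<bar>scalar_prod u v\<bar> \<le> vnorm u * vnorm v"
proof -
  have "\<bar>\<Sum>i<d. u $ i * v $ i\<bar> \<le> L2_set (\<lambda>i. u $ i) {..<d} * L2_set (\<lambda>i. v $ i) {..<d}"
    using L2_set_mult_ineq[of "\<lambda>i. u $ i" "\<lambda>i. v $ i" "{..<d}"]
      sum_abs[of "\<lambda>i. u $ i * v $ i" "{..<d}"] by (simp add: abs_mult)
  then show ?thesis
    using assms by (simp add: scalar_prod_def vnorm_def L2_set_def atLeast0LessThan power2_eq_square)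
qed

text \<open>Maximal rank of the block of columns of \<open>A\<close> and \<open>B\<close> provides
  \<open>d\<close> independent columns, which form an invertible matrix \<open>C\<close>. A vector
  orthogonal to all columns is annihilated by the transpose of \<open>C\<close>.\<close>

lemma max_rank_kernel:
  assumes A: "A \<in> carrier_mat d d" and B: "B \<in> carrier_mat d d" and r: "max_rank d A B"
    and p: "p \<in> carrier_vec d" "transpose_mat A *\<^sub>v p = 0\<^sub>v d" "transpose_mat B *\<^sub>v p = 0\<^sub>v d"
  shows "p = 0\<^sub>v d"
proof -
  interpret vec_space "TYPE(real)" d .
  define M where "M = mat_of_cols d (cols A @ cols B)"
  have M: "M \<in> carrier_mat d (d + d)" using A B unfolding M_def by auto
  have cM: "cols M = cols A @ cols B"
    unfolding M_def using A B cols_dim[of A] cols_dim[of B] by (intro cols_mat_of_cols) auto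
  obtain S where S: "finite S" "maximal S (\<lambda>T. T \<subseteq> set (cols M) \<and> lin_indpt T)"
    using maximal_exists_superset[of "set (cols M)" "\<lambda>T. T \<subseteq> set (cols M) \<and> lin_indpt T" "{}"]
    by (auto simp: lin_dep_def)
  have card: "card S = d"
    using rank_card_indpt[OF M S(2)] r unfolding max_rank_def M_def by simp
  have Ssub: "S \<subseteq> set (cols M)" and Sli: "lin_indpt S" using S(2) unfolding maximal_def by auto
  obtain xs where xs: "set xs = S" "distinct xs" using finite_distinct_list[OF S(1)] by blast
  have lxs: "length xs = d" using xs card distinct_card by metis
  have car: "set xs \<subseteq> carrier_vec d" using Ssub xs cols_dim[of M] M by auto
  define C where "C = mat_of_cols d xs"
  have C: "C \<in> carrier_mat d d" unfolding C_def using lxs by auto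
  have cC: "cols C = xs" unfolding C_def using car by (rule cols_mat_of_cols)
  have "rank C = d" using lin_indpt_full_rank[OF C] xs Sli cC by simp
  then have "det C \<noteq> 0" using det_rank_iff[OF C] by simp
  then have "det (transpose_mat C) \<noteq> 0" using det_transpose[OF C] by simp
  moreover have "transpose_mat C *\<^sub>v p = 0\<^sub>v d"
  proof (rule eq_vecI)
    fix i assume "i < dim_vec (0\<^sub>v d)"
    then have i: "i < d" by simp
    have "xs ! i \<in> set (cols A) \<union> set (cols B)" using Ssub xs lxs i cM by (metis nth_mem set_append subsetD)
    then have "scalar_prod (xs ! i) p = 0"
    proof
      assume "xs ! i \<in> set (cols A)"
      then obtain j where j: "j < d" "xs ! i = col A j" using A by (auto simp: cols_def)
      have "(transpose_mat A *\<^sub>v p) $ j = scalar_prod (col A j) p" using A j by simp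
      then show ?thesis using p(2) j by simp
    next
      assume "xs ! i \<in> set (cols B)"
      then obtain j where j: "j < d" "xs ! i = col B j" using B by (auto simp: cols_def)
      have "(transpose_mat B *\<^sub>v p) $ j = scalar_prod (col B j) p" using B j by simp
      then show ?thesis using p(3) j by simp
    qed
    moreover have "col C i = xs ! i" using cC C i by (metis carrier_matD(2) cols_nth)
    ultimately show "(transpose_mat C *\<^sub>v p) $ i = 0\<^sub>v d $ i" using C i by simp
  qed (use C in auto)
  ultimately show ?thesis
    using det_0_iff_vec_prod_zero[of "transpose_mat C" d] C p(1) by auto
qed

section \<open>Algebra of a single pair of vertex matrices\<close>

locale vertex_conditions =
  fixes d :: nat and A B :: "real Matrix.mat"
  assumes A [simp, intro]: "A \<in> carrier_mat d d" and B [simp, intro]: "B \<in> carrier_mat d d"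
    and rank: "max_rank d A B"
    and symm: "transpose_mat (A * transpose_mat B) = A * transpose_mat B"
begin

abbreviation "R \<equiv> range_mat (transpose_mat B)"

lemma dims [simp]: "dim_row A = d" "dim_col A = d" "dim_row B = d" "dim_col B = d"
  using carrier_matD[OF A] carrier_matD[OF B] by auto

lemma mv_carrier [simp]:
  assumes "z \<in> carrier_vec d"
  shows "A *\<^sub>v z \<in> carrier_vec d" "B *\<^sub>v z \<in> carrier_vec d"
    "transpose_mat A *\<^sub>v z \<in> carrier_vec d" "transpose_mat B *\<^sub>v z \<in> carrier_vec d"
  using assms by (auto intro!: mult_mat_vec_carrier[of _ d d])

lemma mv_zero [simp]:
  "A *\<^sub>v 0\<^sub>v d = 0\<^sub>v d" "B *\<^sub>v 0\<^sub>v d = 0\<^sub>v d"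
  "transpose_mat A *\<^sub>v 0\<^sub>v d = 0\<^sub>v d" "transpose_mat B *\<^sub>v 0\<^sub>v d = 0\<^sub>v d"
  by (auto intro!: eq_vecI)

lemma R_iff: "y \<in> R \<longleftrightarrow> (\<exists>z\<in>carrier_vec d. y = transpose_mat B *\<^sub>v z)"
  unfolding range_mat_def by auto

lemma R_carrier: "y \<in> R \<Longrightarrow> y \<in> carrier_vec d"
  unfolding R_iff by auto

lemma symm': "A * transpose_mat B = B * transpose_mat A"
  using symm transpose_mult[OF A, of "transpose_mat B" d] by simp

lemma symm_vec:
  assumes z: "z \<in> carrier_vec d"
  shows "A *\<^sub>v (transpose_mat B *\<^sub>v z) = B *\<^sub>v (transpose_mat A *\<^sub>v z)"
proof -
  have "A *\<^sub>v (transpose_mat B *\<^sub>v z) = (A * transpose_mat B) *\<^sub>v z"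
    using z by (subst assoc_mult_mat_vec[of _ d d _ d]) auto
  also have "\<dots> = B *\<^sub>v (transpose_mat A *\<^sub>v z)"
    unfolding symm' using z by (subst assoc_mult_mat_vec[of _ d d _ d]) auto
  finally show ?thesis .
qed

lemma adj: "\<lbrakk>M \<in> carrier_mat d d; x \<in> carrier_vec d; y \<in> carrier_vec d\<rbrakk> \<Longrightarrow>
    scalar_prod (transpose_mat M *\<^sub>v y) x = scalar_prod y (M *\<^sub>v x)" for M :: "real Matrix.mat"
  by (rule transpose_vec_mult_scalar)

lemma symm_form:
  assumes z: "z \<in> carrier_vec d" and w: "w \<in> carrier_vec d"
  shows "scalar_prod (A *\<^sub>v (transpose_mat B *\<^sub>v z)) w = scalar_prod (A *\<^sub>v (transpose_mat B *\<^sub>v w)) z"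
proof -
  have "scalar_prod (A *\<^sub>v (transpose_mat B *\<^sub>v z)) w = scalar_prod w (A *\<^sub>v (transpose_mat B *\<^sub>v z))"
    using z w by (intro comm_scalar_prod[of _ d]) auto
  also have "\<dots> = scalar_prod (transpose_mat A *\<^sub>v w) (transpose_mat B *\<^sub>v z)"
    using z w by (intro adj[symmetric]) auto
  also have "\<dots> = scalar_prod (transpose_mat B *\<^sub>v z) (transpose_mat A *\<^sub>v w)"
    using z w by (intro comm_scalar_prod[of _ d]) auto
  also have "\<dots> = scalar_prod z (B *\<^sub>v (transpose_mat A *\<^sub>v w))" using z w by (intro adj) auto
  also have "\<dots> = scalar_prod (A *\<^sub>v (transpose_mat B *\<^sub>v w)) z"
    unfolding symm_vec[OF w, symmetric] using z w by (intro comm_scalar_prod[of _ d]) auto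
  finally show ?thesis .
qed

text \<open>The kernel of \<open>B\<close> is the image of the kernel of \<open>B\<^sup>T\<close> under \<open>A\<^sup>T\<close>. Surjectivity
  comes from the block matrix below, whose kernel is trivial because
  \<open>\<bar>A\<^sup>T p + B\<^sup>T q\<bar>\<^sup>2 + \<bar>B\<^sup>T p - A\<^sup>T q\<bar>\<^sup>2 = \<bar>A\<^sup>T p\<bar>\<^sup>2 + \<bar>B\<^sup>T p\<bar>\<^sup>2 + \<bar>A\<^sup>T q\<bar>\<^sup>2 + \<bar>B\<^sup>T q\<bar>\<^sup>2\<close>.\<close>

lemma block_combination:
  assumes p: "p \<in> carrier_vec d" and q: "q \<in> carrier_vec d"
  shows "A *\<^sub>v (transpose_mat A *\<^sub>v p + transpose_mat B *\<^sub>v q)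
      + B *\<^sub>v (transpose_mat B *\<^sub>v p + (- transpose_mat A) *\<^sub>v q)
    = A *\<^sub>v (transpose_mat A *\<^sub>v p) + B *\<^sub>v (transpose_mat B *\<^sub>v p)"
proof (rule eq_vecI)
  fix i assume "i < dim_vec (A *\<^sub>v (transpose_mat A *\<^sub>v p) + B *\<^sub>v (transpose_mat B *\<^sub>v p))"
  then have i: "i < d" by simp
  have rows: "Matrix.row A i \<in> carrier_vec d" "Matrix.row B i \<in> carrier_vec d"
    using i row_carrier[of A i] row_carrier[of B i] by auto
  have um: "(- transpose_mat A) *\<^sub>v q = - (transpose_mat A *\<^sub>v q)" using q by simp
  have "scalar_prod (Matrix.row A i) (transpose_mat B *\<^sub>v q) = scalar_prod (Matrix.row B i) (transpose_mat A *\<^sub>v q)"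
    using arg_cong[OF symm_vec[OF q], of "\<lambda>v. v $ i"] i by simp
  then show "(A *\<^sub>v (transpose_mat A *\<^sub>v p + transpose_mat B *\<^sub>v q)
      + B *\<^sub>v (transpose_mat B *\<^sub>v p + (- transpose_mat A) *\<^sub>v q)) $ i
    = (A *\<^sub>v (transpose_mat A *\<^sub>v p) + B *\<^sub>v (transpose_mat B *\<^sub>v p)) $ i"
    unfolding um using i p q rows
    by (simp add: scalar_prod_add_distrib[OF rows(1)] scalar_prod_add_distrib[OF rows(2)])
qed (use p q in auto)

text \<open>Paired with \<open>p\<close>, the equation says that the squared norms of
  \<open>transpose_mat A *\<^sub>v p\<close> and \<open>transpose_mat B *\<^sub>v p\<close> add up
  to 0.\<close>

lemma gram_kernel:
  assumes p: "p \<in> carrier_vec d"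
    and eq: "A *\<^sub>v (transpose_mat A *\<^sub>v p) + B *\<^sub>v (transpose_mat B *\<^sub>v p) = 0\<^sub>v d"
  shows "p = 0\<^sub>v d"
proof -
  let ?a = "transpose_mat A *\<^sub>v p" and ?b = "transpose_mat B *\<^sub>v p"
  have "scalar_prod p (A *\<^sub>v ?a) + scalar_prod p (B *\<^sub>v ?b) = 0"
    using eq p by (subst scalar_prod_add_distrib[symmetric, of _ d]) auto
  then have "scalar_prod ?a ?a + scalar_prod ?b ?b = 0"
    using p adj[OF A, of ?a p] adj[OF B, of ?b p] by simp
  then have "scalar_prod ?a ?a = 0" "scalar_prod ?b ?b = 0"
    using scalar_prod_real_self_nonneg[of ?a] scalar_prod_real_self_nonneg[of ?b] by linarith+
  then have "?a = 0\<^sub>v d" "?b = 0\<^sub>v d"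
    using p by (auto intro!: scalar_prod_real_self_zero)
  then show ?thesis using max_rank_kernel[OF A B rank p] by auto
qed

text \<open>In the homogeneous system \<open>block_combination\<close> eliminates \<open>q\<close>,
  \<open>gram_kernel\<close> then gives \<open>p = 0\<close>, and maximal rank gives
  \<open>q = 0\<close>. The block matrix is square, so a trivial kernel makes it invertible.\<close>

lemma block_solve:
  assumes f: "f \<in> carrier_vec d" and g: "g \<in> carrier_vec d"
  obtains p q where "p \<in> carrier_vec d" "q \<in> carrier_vec d"
    "transpose_mat A *\<^sub>v p + transpose_mat B *\<^sub>v q = f" "transpose_mat B *\<^sub>v p + (- transpose_mat A) *\<^sub>v q = g"
proof -
  let ?AT = "transpose_mat A" and ?BT = "transpose_mat B"
  define N where "N = four_block_mat ?AT ?BT ?BT (- ?AT)"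
  have N: "N \<in> carrier_mat (d + d) (d + d)" unfolding N_def by (rule four_block_carrier_mat) auto
  have Nv: "N *\<^sub>v (p @\<^sub>v q) = (?AT *\<^sub>v p + ?BT *\<^sub>v q) @\<^sub>v (?BT *\<^sub>v p + (- ?AT) *\<^sub>v q)"
    if "p \<in> carrier_vec d" "q \<in> carrier_vec d" for p q
    unfolding N_def by (rule four_block_mat_mult_vec[of _ d d _ d _ d]) (use that in auto)
  have append_zero: "0\<^sub>v d @\<^sub>v 0\<^sub>v d = (0\<^sub>v (d + d) :: real Matrix.vec)" by (rule eq_vecI) auto
  have "det N \<noteq> 0"
  proof
    assume "det N = 0"
    then obtain v where v: "v \<in> carrier_vec (d + d)" "v \<noteq> 0\<^sub>v (d + d)" "N *\<^sub>v v = 0\<^sub>v (d + d)"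
      using det_0_iff_vec_prod_zero[OF N] by blast
    define p where "p = vec_first v d"
    define q where "q = vec_last v d"
    have pq: "p \<in> carrier_vec d" "q \<in> carrier_vec d" unfolding p_def q_def by auto
    have v_eq: "v = p @\<^sub>v q" unfolding p_def q_def using v(1) by simp
    have "(?AT *\<^sub>v p + ?BT *\<^sub>v q) @\<^sub>v (?BT *\<^sub>v p + (- ?AT) *\<^sub>v q) = 0\<^sub>v d @\<^sub>v 0\<^sub>v d"
      using v(3) Nv[OF pq] v_eq append_zero by simp
    then have e: "?AT *\<^sub>v p + ?BT *\<^sub>v q = 0\<^sub>v d" "?BT *\<^sub>v p + (- ?AT) *\<^sub>v q = 0\<^sub>v d"
      using append_vec_eq[of "?AT *\<^sub>v p + ?BT *\<^sub>v q" d "0\<^sub>v d"] pq by auto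
    have kk: "p = 0\<^sub>v d \<and> q = 0\<^sub>v d"
    proof -
      have "A *\<^sub>v (?AT *\<^sub>v p) + B *\<^sub>v (?BT *\<^sub>v p) = 0\<^sub>v d"
        unfolding block_combination[OF pq, symmetric] e by auto
      then have p0: "p = 0\<^sub>v d" by (rule gram_kernel[OF pq(1)])
      have "?BT *\<^sub>v q = 0\<^sub>v d" using e(1) pq unfolding p0 by simp
      moreover have "- (?AT *\<^sub>v q) = 0\<^sub>v d" using e(2) pq unfolding p0 by simp
      then have "- (- (?AT *\<^sub>v q)) = - 0\<^sub>v d" by simp
      then have "?AT *\<^sub>v q = 0\<^sub>v d" by simp
      ultimately have "q = 0\<^sub>v d" using max_rank_kernel[OF A B rank pq(2)] by auto
      then show ?thesis using p0 by simp
    qed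
    then show False using v(2) v_eq append_zero by simp
  qed
  then have "N \<in> Units (ring_mat TYPE(real) (d + d) ())" by (rule det_non_zero_imp_unit[OF N])
  then obtain N' where N': "N' \<in> carrier_mat (d + d) (d + d)" "N * N' = 1\<^sub>m (d + d)"
    unfolding Units_def by (auto simp: ring_mat_simps)
  define v where "v = N' *\<^sub>v (f @\<^sub>v g)"
  have v: "v \<in> carrier_vec (d + d)" unfolding v_def using N' f g by auto
  have "N *\<^sub>v v = (N * N') *\<^sub>v (f @\<^sub>v g)"
    unfolding v_def using N N' f g by (subst assoc_mult_mat_vec) auto
  then have Nfg: "N *\<^sub>v v = f @\<^sub>v g" using N' f g by simp
  define p where "p = vec_first v d"
  define q where "q = vec_last v d"
  have pq: "p \<in> carrier_vec d" "q \<in> carrier_vec d" unfolding p_def q_def by auto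
  have v_eq: "v = p @\<^sub>v q" unfolding p_def q_def using v by simp
  have "(?AT *\<^sub>v p + ?BT *\<^sub>v q) @\<^sub>v (?BT *\<^sub>v p + (- ?AT) *\<^sub>v q) = f @\<^sub>v g"
    using Nfg unfolding v_eq Nv[OF pq] .
  then have "?AT *\<^sub>v p + ?BT *\<^sub>v q = f" "?BT *\<^sub>v p + (- ?AT) *\<^sub>v q = g"
    using append_vec_eq[of "?AT *\<^sub>v p + ?BT *\<^sub>v q" d f] pq f by auto
  then show thesis using that pq by blast
qed

text \<open>Solving the block system for the right-hand side \<open>(0, n)\<close> writes
  \<open>n\<close> as \<open>- (transpose_mat A *\<^sub>v q)\<close> with
  \<open>transpose_mat B *\<^sub>v q = 0\<close>. Pairing the boundary condition with this
  \<open>q\<close> eliminates \<open>y\<close>.\<close>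

lemma boundary_orthogonal_kernel:
  assumes x: "x \<in> carrier_vec d" and y: "y \<in> carrier_vec d" and eq: "A *\<^sub>v x + B *\<^sub>v y = 0\<^sub>v d"
    and n: "n \<in> carrier_vec d" "B *\<^sub>v n = 0\<^sub>v d"
  shows "scalar_prod x n = 0"
proof -
  let ?AT = "transpose_mat A" and ?BT = "transpose_mat B"
  obtain p q where pq: "p \<in> carrier_vec d" "q \<in> carrier_vec d"
    and e: "?AT *\<^sub>v p + ?BT *\<^sub>v q = 0\<^sub>v d" "?BT *\<^sub>v p + (- ?AT) *\<^sub>v q = n"
    using block_solve[of "0\<^sub>v d" n] n by auto
  have "A *\<^sub>v (?AT *\<^sub>v p) + B *\<^sub>v (?BT *\<^sub>v p) = 0\<^sub>v d"
    unfolding block_combination[OF pq, symmetric] e using n by auto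
  then have p0: "p = 0\<^sub>v d" by (rule gram_kernel[OF pq(1)])
  have Bq: "?BT *\<^sub>v q = 0\<^sub>v d" using e(1) pq unfolding p0 by simp
  have n_eq: "n = - (?AT *\<^sub>v q)" using e(2) pq unfolding p0 by simp
  have "scalar_prod q (A *\<^sub>v x) + scalar_prod q (B *\<^sub>v y) = 0"
    using eq pq x y by (subst scalar_prod_add_distrib[symmetric, of _ d]) auto
  then have "scalar_prod (?AT *\<^sub>v q) x + scalar_prod (?BT *\<^sub>v q) y = 0"
    using adj[OF A x pq(2)] adj[OF B y pq(2)] by simp
  then have "scalar_prod (?AT *\<^sub>v q) x = 0" using Bq y by simp
  moreover have "scalar_prod x n = - scalar_prod x (?AT *\<^sub>v q)"
    unfolding n_eq using x pq by (intro scalar_prod_uminus_right) auto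
  moreover have "scalar_prod x (?AT *\<^sub>v q) = scalar_prod (?AT *\<^sub>v q) x"
    using x pq by (intro comm_scalar_prod[of _ d]) auto
  ultimately show ?thesis by simp
qed

end

text \<open>Vectors are read as functions of the index, of which only the first \<open>d\<close>
  values matter. Functions form a \<open>real_vector\<close>, so the orthonormal machinery applies,
  whereas the dimension of a \<open>Matrix.vec\<close> is not part of its type.\<close>

definition dotn :: "nat \<Rightarrow> (nat \<Rightarrow> real) \<Rightarrow> (nat \<Rightarrow> real) \<Rightarrow> real" where
  "dotn d x y = (\<Sum>i<d. x i * y i)"

lemma dotn_semi_inner: "semi_inner UNIV (dotn d)"
  by unfold_locales
    (auto simp: dotn_def algebra_simps sum.distrib sum_distrib_left intro!: sum_nonneg)

lemma scalar_prod_vec_vec: "scalar_prod (Matrix.vec d x) (Matrix.vec d y) = dotn d x y"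
  by (simp add: scalar_prod_def dotn_def atLeast0LessThan)

section \<open>The range of the transpose of B, the operator \<Lambda> and its form\<close>

context vertex_conditions
begin

lemma R_subspace: "Real_Vector_Spaces.subspace {x. Matrix.vec d x \<in> R}"
  unfolding Real_Vector_Spaces.subspace_def
proof (intro conjI ballI allI)
  have "Matrix.vec d (0 :: nat \<Rightarrow> real) = transpose_mat B *\<^sub>v 0\<^sub>v d" by (auto intro!: eq_vecI)
  then show "0 \<in> {x. Matrix.vec d x \<in> R}"
    unfolding R_iff by (intro CollectI bexI[of _ "0\<^sub>v d"]) auto
next
  fix x y assume "x \<in> {x. Matrix.vec d x \<in> R}" "y \<in> {x. Matrix.vec d x \<in> R}"
  then obtain z w where zw: "z \<in> carrier_vec d" "w \<in> carrier_vec d"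
    "Matrix.vec d x = transpose_mat B *\<^sub>v z" "Matrix.vec d y = transpose_mat B *\<^sub>v w" unfolding R_iff by auto
  have "Matrix.vec d (x + y) = Matrix.vec d x + Matrix.vec d y" by (auto intro!: eq_vecI)
  also have "\<dots> = transpose_mat B *\<^sub>v (z + w)"
    unfolding zw(3,4) using zw by (intro mult_add_distrib_mat_vec[symmetric]) auto
  finally show "x + y \<in> {x. Matrix.vec d x \<in> R}" unfolding R_iff using zw by auto
next
  fix c x assume "x \<in> {x. Matrix.vec d x \<in> R}"
  then obtain z where z: "z \<in> carrier_vec d" "Matrix.vec d x = transpose_mat B *\<^sub>v z" unfolding R_iff by auto
  have "Matrix.vec d (c *\<^sub>R x) = c \<cdot>\<^sub>v Matrix.vec d x" by (auto intro!: eq_vecI)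
  also have "\<dots> = transpose_mat B *\<^sub>v (c \<cdot>\<^sub>v z)"
    unfolding z(2) using z by (intro mult_mat_vec[symmetric]) auto
  finally show "c *\<^sub>R x \<in> {x. Matrix.vec d x \<in> R}" unfolding R_iff using z by auto
qed

text \<open>Gram-Schmidt on the rows of \<open>B\<close>, which span \<open>R\<close>. A null
  residual for \<open>dotn d\<close> says nothing about indices beyond \<open>d\<close>, so the
  expansion is claimed for \<open>i < d\<close> only.\<close>

lemma R_basis:
  "\<exists>(n::nat) b. (\<forall>k<n. Matrix.vec d (b k) \<in> R) \<and>
    (\<forall>x. Matrix.vec d x \<in> R \<longrightarrow> (\<forall>i<d. x i = (\<Sum>k<n. dotn d x (b k) * b k i))) \<and>
    (\<forall>j<n. \<forall>k<n. dotn d (b j) (b k) = (if j = k then 1 else 0))"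
proof -
  interpret semi_inner UNIV "dotn d" by (rule dotn_semi_inner)
  \<comment> \<open>With the rows cut off at \<open>d\<close>, the vector \<open>x'\<close> below is
    an exact combination of rows as a function on all of \<open>nat\<close>, hence in the
    span.\<close>
  define rw where "rw i = (\<lambda>j. if j < d then B $$ (i, j) else 0)" for i
  define X where "X = rw ` {..<d}"
  obtain n b where on: "orthonormal_upto n b" and bX: "\<And>k. k < n \<Longrightarrow> b k \<in> Real_Vector_Spaces.span X"
    and res: "\<And>x. x \<in> Real_Vector_Spaces.span X \<Longrightarrow> dotn d (residual n b x) (residual n b x) = 0"
    using Gram_Schmidt[of X] unfolding X_def by auto
  have comb: "(\<lambda>j. if j < d then (transpose_mat B *\<^sub>v z) $ j else 0) = (\<Sum>i<d. z $ i *\<^sub>R rw i)"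
    if z: "z \<in> carrier_vec d" for z
  proof
    fix j show "(if j < d then (transpose_mat B *\<^sub>v z) $ j else 0) = (\<Sum>i<d. z $ i *\<^sub>R rw i) j"
      using z by (auto simp: rw_def scalar_prod_def atLeast0LessThan mult.commute)
  qed
  have "X \<subseteq> {x. Matrix.vec d x \<in> R}"
  proof
    fix x assume "x \<in> X"
    then obtain i where i: "i < d" "x = rw i" unfolding X_def by auto
    have "Matrix.vec d x = transpose_mat B *\<^sub>v unit_vec d i"
      unfolding i(2) rw_def using i by (intro eq_vecI) auto
    then show "x \<in> {x. Matrix.vec d x \<in> R}" unfolding R_iff by auto
  qed
  then have "Real_Vector_Spaces.span X \<subseteq> {x. Matrix.vec d x \<in> R}"
    by (intro real_vector.span_minimal R_subspace)
  then have 1: "Matrix.vec d (b k) \<in> R" if "k < n" for k using bX[OF that] by auto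
  have 2: "x i = (\<Sum>k<n. dotn d x (b k) * b k i)" if x: "Matrix.vec d x \<in> R" and i: "i < d" for x i
  proof -
    obtain z where z: "z \<in> carrier_vec d" "Matrix.vec d x = transpose_mat B *\<^sub>v z" using x unfolding R_iff by auto
    define x' where "x' j = (if j < d then (transpose_mat B *\<^sub>v z) $ j else 0)" for j
    have xx: "x' j = x j" if "j < d" for j using z(2) that unfolding x'_def by (metis index_vec)
    have "x' = (\<Sum>i<d. z $ i *\<^sub>R rw i)" unfolding x'_def comb[OF z(1), symmetric] ..
    moreover have "(\<Sum>i<d. z $ i *\<^sub>R rw i) \<in> Real_Vector_Spaces.span X"
      by (intro real_vector.span_sum real_vector.span_scale real_vector.span_base) (simp add: X_def)
    ultimately have "x' \<in> Real_Vector_Spaces.span X" by simp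
    from res[OF this] have "\<forall>i\<in>{..<d}. residual n b x' i * residual n b x' i = 0"
      unfolding dotn_def by (subst sum_nonneg_eq_0_iff[symmetric]) auto
    then have "residual n b x' i = 0" using i by auto
    moreover have "dotn d x' (b k) = dotn d x (b k)" for k using xx by (simp add: dotn_def)
    ultimately show ?thesis using xx[OF i] unfolding residual_def by simp
  qed
  have 3: "dotn d (b j) (b k) = (if j = k then 1 else 0)" if "j < n" "k < n" for j k
    using on that unfolding orthonormal_upto_def by blast
  show ?thesis by (intro exI[of _ n] exI[of _ b] conjI allI impI 1 2 3)
qed

text \<open>Coefficients in a finite orthonormal basis pass to the limit. Through this fact the
  boundary constraint of the form domain survives limits.\<close>

lemma R_closed:
  assumes x: "\<And>k. Matrix.vec d (x k) \<in> R" and lim: "\<And>i. i < d \<Longrightarrow> (\<lambda>k. x k i) \<longlonglongrightarrow> y i"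
  shows "Matrix.vec d y \<in> R"
proof -
  obtain n :: nat and b where b': "(\<forall>k<n. Matrix.vec d (b k) \<in> R) \<and>
    (\<forall>x. Matrix.vec d x \<in> R \<longrightarrow> (\<forall>i<d. x i = (\<Sum>k<n. dotn d x (b k) * b k i))) \<and>
    (\<forall>j<n. \<forall>k<n. dotn d (b j) (b k) = (if j = k then 1 else 0))"
    using R_basis by (elim exE)
  note b = b'[THEN conjunct1, rule_format] b'[THEN conjunct2, THEN conjunct1, rule_format]
    b'[THEN conjunct2, THEN conjunct2, rule_format]
  define y' where "y' = (\<Sum>k<n. dotn d y (b k) *\<^sub>R b k)"
  have "y i = y' i" if i: "i < d" for i
  proof (rule LIMSEQ_unique[OF lim[OF i]])
    have "(\<lambda>j. \<Sum>k<n. dotn d (x j) (b k) * b k i) \<longlonglongrightarrow> (\<Sum>k<n. dotn d y (b k) * b k i)"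
      unfolding dotn_def by (intro tendsto_intros lim) auto
    then show "(\<lambda>k. x k i) \<longlonglongrightarrow> y' i" using b(2)[OF x i] by (simp add: y'_def)
  qed
  then have "Matrix.vec d y = Matrix.vec d y'" by (intro eq_vecI) auto
  moreover have "y' \<in> {x. Matrix.vec d x \<in> R}"
    unfolding y'_def using b(1) by (intro real_vector.subspace_sum R_subspace real_vector.subspace_scale) auto
  ultimately show ?thesis by simp
qed

lemma orth_proj_eq:
  assumes "W \<subseteq> carrier_vec d" "\<And>u v. u \<in> W \<Longrightarrow> v \<in> W \<Longrightarrow> u - v \<in> W" "y \<in> W"
  shows "orth_proj W y = y"
  unfolding orth_proj_def
proof (rule the_equality)
  have y: "y \<in> carrier_vec d" using assms by auto
  show "y \<in> W \<and> (\<forall>w\<in>W. scalar_prod (y - y) w = 0)" using assms y by (auto simp: minus_cancel_vec)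
  fix u assume u: "u \<in> W \<and> (\<forall>w\<in>W. scalar_prod (y - u) w = 0)"
  then have uc: "u \<in> carrier_vec d" using assms by auto
  have "scalar_prod (y - u) (y - u) = 0" using u assms(2)[OF assms(3)] by auto
  then have "y - u = 0\<^sub>v d" using y uc by (intro scalar_prod_real_self_zero) auto
  then show "u = y" using y uc
    by (metis carrier_vecD eq_vecI index_minus_vec(1) index_zero_vec(1) right_minus_eq)
qed

lemma range_diff:
  assumes "M \<in> carrier_mat d d" "u \<in> range_mat M" "v \<in> range_mat M"
  shows "u - v \<in> range_mat M"
proof -
  obtain x y where xy: "x \<in> carrier_vec d" "y \<in> carrier_vec d" "u = M *\<^sub>v x" "v = M *\<^sub>v y"
    using assms unfolding range_mat_def by auto
  then have "u - v = M *\<^sub>v (x - y)" using assms by (simp add: mult_minus_distrib_mat_vec)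
  then show ?thesis unfolding range_mat_def using assms xy by auto
qed

text \<open>On these arguments both projections act trivially. \<open>B\<close> is injective on
  \<open>R\<close>: a difference of the form \<open>transpose_mat B *\<^sub>v z\<close> that
  \<open>B\<close> annihilates is orthogonal to itself.\<close>

lemma part_inv_eq:
  assumes y: "y \<in> R"
  shows "part_inv B (B *\<^sub>v y) = y"
proof -
  let ?f = "\<lambda>y. orth_proj (range_mat B) (B *\<^sub>v orth_proj R y)"
  have f: "?f y = B *\<^sub>v y" if "y \<in> R" for y
  proof -
    have "orth_proj R y = y" using that range_diff[of "transpose_mat B"] R_carrier by (intro orth_proj_eq) auto
    moreover have "B *\<^sub>v y \<in> range_mat B" using R_carrier[OF that] unfolding range_mat_def by auto
    then have "orth_proj (range_mat B) (B *\<^sub>v y) = B *\<^sub>v y"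
      using range_diff[OF B] by (intro orth_proj_eq) (auto simp: range_mat_def)
    ultimately show ?thesis by simp
  qed
  have "inj_on ?f R"
  proof (rule inj_onI)
    fix u v assume uv: "u \<in> R" "v \<in> R" "?f u = ?f v"
    have c: "u \<in> carrier_vec d" "v \<in> carrier_vec d" using uv R_carrier by auto
    have "B *\<^sub>v u = B *\<^sub>v v" using uv f by simp
    then have B0: "B *\<^sub>v (u - v) = 0\<^sub>v d" using c by (simp add: mult_minus_distrib_mat_vec[OF B] minus_cancel_vec)
    obtain z where z: "z \<in> carrier_vec d" "u - v = transpose_mat B *\<^sub>v z"
      using range_diff[of "transpose_mat B" u v] uv unfolding R_iff by auto
    have "scalar_prod (u - v) (u - v) = scalar_prod z (B *\<^sub>v (u - v))"
      using adj[OF B _ z(1), of "u - v"] c unfolding z(2)[symmetric] by simp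
    then have "u - v = 0\<^sub>v d" using B0 z c by (intro scalar_prod_real_self_zero) auto
    then show "u = v" using c
      by (metis carrier_vecD eq_vecI index_minus_vec(1) index_zero_vec(1) right_minus_eq)
  qed
  from inv_into_f_f[OF this y] show ?thesis unfolding part_inv_def f[OF y] .
qed

text \<open>The projection is the Fourier sum in an orthonormal basis of \<open>R\<close>. Its
  remainder is orthogonal to the rows of \<open>B\<close>, which lie in \<open>R\<close>, so
  \<open>B\<close> does not see it.\<close>

lemma R_projection:
  assumes v: "v \<in> carrier_vec d"
  shows "\<exists>p\<in>R. B *\<^sub>v v = B *\<^sub>v p \<and> (\<forall>w\<in>R. scalar_prod (v - p) w = 0)"
proof -
  obtain n :: nat and b where b': "(\<forall>k<n. Matrix.vec d (b k) \<in> R) \<and>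
    (\<forall>x. Matrix.vec d x \<in> R \<longrightarrow> (\<forall>i<d. x i = (\<Sum>k<n. dotn d x (b k) * b k i))) \<and>
    (\<forall>j<n. \<forall>k<n. dotn d (b j) (b k) = (if j = k then 1 else 0))"
    using R_basis by (elim exE)
  note b = b'[THEN conjunct1, rule_format] b'[THEN conjunct2, THEN conjunct1, rule_format]
    b'[THEN conjunct2, THEN conjunct2, rule_format]
  define p where "p = (\<Sum>k<n. dotn d (($) v) (b k) *\<^sub>R b k)"
  have "p \<in> {x. Matrix.vec d x \<in> R}"
    unfolding p_def using b(1) by (intro real_vector.subspace_sum R_subspace real_vector.subspace_scale) auto
  then have pR: "Matrix.vec d p \<in> R" by simp
  have pb: "dotn d p (b k) = dotn d (($) v) (b k)" if "k < n" for k
  proof -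
    interpret semi_inner UNIV "dotn d" by (rule dotn_semi_inner)
    have "orthonormal_upto n b" unfolding orthonormal_upto_def using b(3) by auto
    from orthonormal_sum[OF this that] show ?thesis unfolding p_def .
  qed
  have orth: "scalar_prod (v - Matrix.vec d p) w = 0" if w: "w \<in> R" for w
  proof -
    have wc: "w \<in> carrier_vec d" by (rule R_carrier[OF w])
    have wv: "Matrix.vec d (($) w) = w" using wc by (intro eq_vecI) auto
    have W: "w $ i = (\<Sum>k<n. dotn d (($) w) (b k) * b k i)" if "i < d" for i
      using b(2)[of "($) w" i] w wv that by simp
    have "dotn d f (($) w) = (\<Sum>k<n. dotn d (($) w) (b k) * dotn d f (b k))" for f
    proof -
      have "dotn d f (($) w) = (\<Sum>i<d. \<Sum>k<n. dotn d (($) w) (b k) * (f i * b k i))"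
        unfolding dotn_def[of d f] by (intro sum.cong refl) (auto simp: W sum_distrib_left mult_ac)
      also have "\<dots> = (\<Sum>k<n. dotn d (($) w) (b k) * dotn d f (b k))"
        by (subst sum.swap) (simp add: dotn_def[of d f] sum_distrib_left)
      finally show ?thesis .
    qed
    then have "dotn d p (($) w) = dotn d (($) v) (($) w)" using pb by simp
    moreover have "scalar_prod (v - Matrix.vec d p) w = dotn d (($) v) (($) w) - dotn d p (($) w)"
      using v wc by (simp add: scalar_prod_def dotn_def atLeast0LessThan left_diff_distrib sum_subtractf)
    ultimately show ?thesis by simp
  qed
  have "B *\<^sub>v (v - Matrix.vec d p) = 0\<^sub>v d"
  proof (rule eq_vecI)
    fix i assume "i < dim_vec (0\<^sub>v d)"
    then have i: "i < d" by simp
    have "scalar_prod (v - Matrix.vec d p) (Matrix.row B i) = 0"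
    proof (rule orth)
      have "Matrix.row B i = transpose_mat B *\<^sub>v unit_vec d i"
        using i by (intro eq_vecI) auto
      then show "Matrix.row B i \<in> R" unfolding R_iff by auto
    qed
    moreover have "scalar_prod (Matrix.row B i) (v - Matrix.vec d p) = scalar_prod (v - Matrix.vec d p) (Matrix.row B i)"
      using v i row_carrier[of B i] by (intro comm_scalar_prod[of _ d]) auto
    ultimately show "(B *\<^sub>v (v - Matrix.vec d p)) $ i = 0\<^sub>v d $ i" using i by simp
  qed simp
  then have "B *\<^sub>v v - B *\<^sub>v Matrix.vec d p = 0\<^sub>v d"
    using v by (simp add: mult_minus_distrib_mat_vec[OF B])
  then have eq: "B *\<^sub>v Matrix.vec d p = B *\<^sub>v v"
    using v mv_carrier(2)[OF v] by (metis B carrier_matD(1) dim_mult_mat_vec eq_vecI index_minus_vec(1) index_zero_vec(1) right_minus_eq)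
  then show ?thesis using pR orth by (intro bexI[of _ "Matrix.vec d p"] conjI ballI) auto
qed

text \<open>For \<open>y = transpose_mat B *\<^sub>v z\<close> the symmetry of the pair gives
  \<open>A *\<^sub>v y = B *\<^sub>v (transpose_mat A *\<^sub>v z)\<close>. Projecting
  \<open>transpose_mat A *\<^sub>v z\<close> onto \<open>R\<close> yields a preimage in
  \<open>R\<close>, so the inverse inside \<open>Lam\<close> is applied where it makes
  sense.\<close>

lemma Lam_exists:
  assumes y: "y \<in> R"
  shows "Lam A B y \<in> R" "B *\<^sub>v Lam A B y = A *\<^sub>v y"
proof -
  obtain z where z: "z \<in> carrier_vec d" "y = transpose_mat B *\<^sub>v z" using y unfolding R_iff by auto
  obtain p where p: "p \<in> R" "B *\<^sub>v (transpose_mat A *\<^sub>v z) = B *\<^sub>v p"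
    using R_projection[of "transpose_mat A *\<^sub>v z"] z by auto
  have "A *\<^sub>v y = B *\<^sub>v p" unfolding p(2)[symmetric] z(2) by (rule symm_vec[OF z(1)])
  then show "Lam A B y \<in> R" "B *\<^sub>v Lam A B y = A *\<^sub>v y"
    unfolding Lam_def using part_inv_eq[OF p(1)] p(1) by auto
qed

definition vform :: "(nat \<Rightarrow> real) \<Rightarrow> (nat \<Rightarrow> real) \<Rightarrow> real" where
  "vform x y = scalar_prod (Lam A B (Matrix.vec d x)) (Matrix.vec d y)"

text \<open>Moving \<open>transpose_mat B\<close> across the scalar product cancels it against the
  inverse inside \<open>Lam\<close>. Symmetry of the form and its link with the vertex condition can
  then be read off from the matrices.\<close>

lemma vform_eq:
  assumes x: "Matrix.vec d x \<in> R" and z: "z \<in> carrier_vec d" "Matrix.vec d y = transpose_mat B *\<^sub>v z"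
  shows "vform x y = scalar_prod z (A *\<^sub>v Matrix.vec d x)"
proof -
  note L = Lam_exists[OF x] R_carrier[OF Lam_exists(1)[OF x]]
  have "vform x y = scalar_prod (transpose_mat B *\<^sub>v z) (Lam A B (Matrix.vec d x))"
    unfolding vform_def z(2) using L z by (intro comm_scalar_prod[of _ d]) auto
  also have "\<dots> = scalar_prod z (A *\<^sub>v Matrix.vec d x)"
    using adj[OF B L(3) z(1)] L(2) by simp
  finally show ?thesis .
qed

lemma vform_sym:
  assumes "Matrix.vec d x \<in> R" "Matrix.vec d y \<in> R"
  shows "vform x y = vform y x"
proof -
  obtain z w where zw: "z \<in> carrier_vec d" "Matrix.vec d x = transpose_mat B *\<^sub>v z"
    "w \<in> carrier_vec d" "Matrix.vec d y = transpose_mat B *\<^sub>v w" using assms unfolding R_iff by auto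
  have "vform x y = scalar_prod w (A *\<^sub>v (transpose_mat B *\<^sub>v z))"
    using vform_eq[OF assms(1) zw(3,4)] unfolding zw(2) .
  also have "\<dots> = scalar_prod (A *\<^sub>v (transpose_mat B *\<^sub>v z)) w"
    using zw by (intro comm_scalar_prod[of _ d]) auto
  also have "\<dots> = scalar_prod (A *\<^sub>v (transpose_mat B *\<^sub>v w)) z" by (rule symm_form[OF zw(1,3)])
  also have "\<dots> = scalar_prod z (A *\<^sub>v (transpose_mat B *\<^sub>v w))"
    using zw by (intro comm_scalar_prod[of _ d]) auto
  also have "\<dots> = vform y x" using vform_eq[OF assms(2) zw(1,2)] unfolding zw(4) by simp
  finally show ?thesis .
qed

lemma vform_right:
  "vform x (y + w) = vform x y + vform x w" "vform x (c *\<^sub>R y) = c * vform x y" if "Matrix.vec d x \<in> R"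
proof -
  have L: "Lam A B (Matrix.vec d x) \<in> carrier_vec d" using R_carrier[OF Lam_exists(1)[OF that]] .
  have s: "Matrix.vec d (y + w) = Matrix.vec d y + Matrix.vec d w" "Matrix.vec d (c *\<^sub>R y) = c \<cdot>\<^sub>v Matrix.vec d y"
    by (auto intro!: eq_vecI)
  show "vform x (y + w) = vform x y + vform x w"
    unfolding vform_def s using L by (intro scalar_prod_add_distrib[of _ d]) auto
  show "vform x (c *\<^sub>R y) = c * vform x y"
    unfolding vform_def s using L by (intro scalar_prod_smult_distrib[of _ d]) auto
qed

lemma vform_sum_right:
  assumes "Matrix.vec d x \<in> R" "finite I"
  shows "vform x (\<Sum>i\<in>I. f i *\<^sub>R g i) = (\<Sum>i\<in>I. f i * vform x (g i))"
  using assms(2)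
proof (induction I)
  case empty
  have "vform x (0 *\<^sub>R 0) = 0 * vform x 0" by (rule vform_right(2)[OF assms(1)])
  then show ?case by (simp only: sum.empty scaleR_zero_left mult_zero_left)
next
  case (insert i I)
  show ?case
    unfolding sum.insert[OF insert(1,2)] vform_right[OF assms(1)] insert.IH ..
qed

lemma vform_cong:
  assumes "\<And>i. i < d \<Longrightarrow> x i = x' i" "\<And>i. i < d \<Longrightarrow> y i = y' i"
  shows "vform x y = vform x' y'"
proof -
  have "Matrix.vec d x = Matrix.vec d x'" "Matrix.vec d y = Matrix.vec d y'" using assms by (auto intro!: eq_vecI)
  then show ?thesis unfolding vform_def by simp
qed

text \<open>Both arguments are expanded in a finite orthonormal basis of \<open>R\<close>. The crude
  constant shows that the supremum in \<open>Lam_norm\<close> is taken over a bounded set, and later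
  that the vertex terms are continuous in the H1 norm.\<close>

lemma vform_bounded:
  "\<exists>C\<ge>0. \<forall>x y. Matrix.vec d x \<in> R \<longrightarrow> Matrix.vec d y \<in> R \<longrightarrow>
    \<bar>vform x y\<bar> \<le> C * (sqrt (dotn d x x) * sqrt (dotn d y y))"
proof -
  interpret semi_inner UNIV "dotn d" by (rule dotn_semi_inner)
  obtain n :: nat and b where b': "(\<forall>k<n. Matrix.vec d (b k) \<in> R) \<and>
    (\<forall>x. Matrix.vec d x \<in> R \<longrightarrow> (\<forall>i<d. x i = (\<Sum>k<n. dotn d x (b k) * b k i))) \<and>
    (\<forall>j<n. \<forall>k<n. dotn d (b j) (b k) = (if j = k then 1 else 0))"
    using R_basis by (elim exE)
  note b = b'[THEN conjunct1, rule_format] b'[THEN conjunct2, THEN conjunct1, rule_format]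
    b'[THEN conjunct2, THEN conjunct2, rule_format]
  define C where "C = (\<Sum>k<n. \<Sum>j<n. \<bar>vform (b j) (b k)\<bar>)"
  have "\<bar>vform x y\<bar> \<le> C * (sqrt (dotn d x x) * sqrt (dotn d y y))"
    if x: "Matrix.vec d x \<in> R" and y: "Matrix.vec d y \<in> R" for x y
  proof -
    have ex: "vform v w = (\<Sum>k<n. dotn d w (b k) * vform v (b k))"
      if v: "Matrix.vec d v \<in> R" and w: "Matrix.vec d w \<in> R" for v w
    proof -
      have "vform v w = vform v (\<Sum>k<n. dotn d w (b k) *\<^sub>R b k)"
        by (rule vform_cong) (simp_all add: b(2)[OF w])
      also have "\<dots> = (\<Sum>k<n. dotn d w (b k) * vform v (b k))"
        by (rule vform_sum_right[OF v]) simp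
      finally show ?thesis .
    qed
    have le: "\<bar>dotn d w (b k)\<bar> \<le> sqrt (dotn d w w)" if "k < n" for w k
      using Cauchy_Schwarz[of w "b k"] b(3)[OF that that] by (simp add: real_le_rsqrt)
    have "vform x y = (\<Sum>k<n. dotn d y (b k) * (\<Sum>j<n. dotn d x (b j) * vform (b k) (b j)))"
      unfolding ex[OF x y]
      by (intro sum.cong refl) (auto simp: vform_sym[OF x b(1)] ex[OF b(1) x])
    also have "\<dots> = (\<Sum>k<n. \<Sum>j<n. (dotn d y (b k) * dotn d x (b j)) * vform (b k) (b j))"
      by (simp add: sum_distrib_left mult.assoc)
    finally have eq: "vform x y = (\<Sum>k<n. \<Sum>j<n. (dotn d y (b k) * dotn d x (b j)) * vform (b k) (b j))" .
    have "\<bar>vform x y\<bar> \<le> (\<Sum>k<n. \<Sum>j<n. (sqrt (dotn d y y) * sqrt (dotn d x x)) * \<bar>vform (b k) (b j)\<bar>)"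
      unfolding eq
    proof (intro order_trans[OF sum_abs] sum_mono)
      fix k j assume kj: "k \<in> {..<n}" "j \<in> {..<n}"
      show "\<bar>dotn d y (b k) * dotn d x (b j) * vform (b k) (b j)\<bar>
          \<le> sqrt (dotn d y y) * sqrt (dotn d x x) * \<bar>vform (b k) (b j)\<bar>"
        unfolding abs_mult using kj nonneg
        by (intro mult_right_mono mult_mono le) auto
    qed
    also have "\<dots> = (sqrt (dotn d y y) * sqrt (dotn d x x)) * (\<Sum>k<n. \<Sum>j<n. \<bar>vform (b k) (b j)\<bar>)"
      by (simp add: sum_distrib_left)
    also have "(\<Sum>k<n. \<Sum>j<n. \<bar>vform (b k) (b j)\<bar>) = C" unfolding C_def by (rule sum.swap)
    finally show ?thesis by (simp add: mult_ac)
  qed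
  moreover have "0 \<le> C" unfolding C_def by (intro sum_nonneg) auto
  ultimately show ?thesis by blast
qed

lemma vnorm_vec: "vnorm (Matrix.vec d v) = sqrt (dotn d v v)"
  by (simp add: vnorm_def scalar_prod_vec_vec)

text \<open>A \<open>Sup\<close> dominates its members only if the set is bounded. Testing the form
  with \<open>w = Lam A B y\<close> itself gives \<open>|w|^2 \<le> C |y| |w|\<close>, hence the
  bound \<open>C\<close>.\<close>

lemma Lam_norm_upper:
  assumes y: "y \<in> R" "vnorm y \<le> 1"
  shows "vnorm (Lam A B y) \<le> Lam_norm A B"
proof -
  obtain C where C: "0 \<le> C" "\<And>x y. Matrix.vec d x \<in> R \<Longrightarrow> Matrix.vec d y \<in> R \<Longrightarrow>
    \<bar>vform x y\<bar> \<le> C * (sqrt (dotn d x x) * sqrt (dotn d y y))" using vform_bounded by blast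
  define S where "S = {vnorm (Lam A B y) | y. y \<in> R \<and> vnorm y \<le> 1}"
  have bdd: "bdd_above S"
  proof (rule bdd_aboveI)
    fix s assume "s \<in> S"
    then obtain y where y: "s = vnorm (Lam A B y)" "y \<in> R" "vnorm y \<le> 1" unfolding S_def by auto
    define w where "w = Lam A B y"
    have w: "w \<in> R" "w \<in> carrier_vec d" unfolding w_def using Lam_exists(1)[OF y(2)] R_carrier by auto
    have vy: "Matrix.vec d (($) y) = y" using R_carrier[OF y(2)] by (intro eq_vecI) auto
    have vw: "Matrix.vec d (($) w) = w" using w(2) by (intro eq_vecI) auto
    have "vform (($) y) (($) w) = scalar_prod w w" unfolding vform_def vy vw by (simp add: w_def)
    then have "(vnorm w)\<^sup>2 \<le> C * (vnorm y * vnorm w)"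
      using C(2)[of "($) y" "($) w"] y(2) w(1) vy vw vnorm_vec[of "($) y"] vnorm_vec[of "($) w"]
        scalar_prod_real_self_nonneg[of w] by (simp add: vnorm_def)
    also have "\<dots> \<le> C * (1 * vnorm w)"
      using C(1) y(3) by (intro mult_left_mono mult_right_mono) (auto simp: vnorm_def scalar_prod_real_self_nonneg)
    finally have "vnorm w * vnorm w \<le> C * vnorm w" by (simp add: power2_eq_square)
    moreover have "0 \<le> vnorm w" by (simp add: vnorm_def scalar_prod_real_self_nonneg)
    ultimately show "s \<le> C"
      unfolding y(1) w_def[symmetric] using C(1)
      by (cases "vnorm w = 0") (auto dest: mult_right_le_imp_le)
  qed
  show ?thesis
    unfolding Lam_norm_def S_def[symmetric] by (rule cSup_upper[OF _ bdd]) (use y in \<open>auto simp: S_def\<close>)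
qed

lemma Lam_norm_nonneg: "0 \<le> Lam_norm A B"
proof -
  have "0\<^sub>v d = transpose_mat B *\<^sub>v 0\<^sub>v d" by simp
  then have "0\<^sub>v d \<in> R" unfolding R_iff by (intro bexI[of _ "0\<^sub>v d"]) auto
  then have "vnorm (Lam A B (0\<^sub>v d)) \<le> Lam_norm A B"
    by (rule Lam_norm_upper) (simp add: vnorm_def)
  then show ?thesis by (rule order_trans[rotated]) (simp add: vnorm_def scalar_prod_real_self_nonneg)
qed

lemma vform_le_Lam_norm:
  assumes x: "Matrix.vec d x \<in> R"
  shows "vform x x \<le> Lam_norm A B * dotn d x x"
proof -
  interpret semi_inner UNIV "dotn d" by (rule dotn_semi_inner)
  show ?thesis
  proof (cases "dotn d x x = 0")
    case True
    obtain C where C: "0 \<le> C" "\<And>x y. Matrix.vec d x \<in> R \<Longrightarrow> Matrix.vec d y \<in> R \<Longrightarrow>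
      \<bar>vform x y\<bar> \<le> C * (sqrt (dotn d x x) * sqrt (dotn d y y))" using vform_bounded by blast
    show ?thesis using C(2)[OF x x] True by simp
  next
    case False
    then have pos: "0 < dotn d x x" using nonneg[of x] by simp
    define y where "y = (1 / sqrt (dotn d x x)) *\<^sub>R x"
    have yR: "Matrix.vec d y \<in> R"
      using real_vector.subspace_scale[OF R_subspace, of x] x unfolding y_def by auto
    have y1: "dotn d y y = 1" unfolding y_def using pos by (simp add: sq_scale power_divide)
    have "vform y y = (1 / dotn d x x) * vform x x"
    proof -
      have "vform y y = (1 / sqrt (dotn d x x)) * vform y x"
        by (subst (2) y_def) (rule vform_right(2)[OF yR])
      also have "vform y x = vform x y" by (rule vform_sym[OF yR x])
      also have "vform x y = (1 / sqrt (dotn d x x)) * vform x x" unfolding y_def by (rule vform_right(2)[OF x])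
      finally show ?thesis using pos by simp
    qed
    moreover have "vform y y \<le> vnorm (Lam A B (Matrix.vec d y))"
      using Cauchy_Schwarz_vec[of "Lam A B (Matrix.vec d y)" d "Matrix.vec d y"]
        R_carrier[OF Lam_exists(1)[OF yR]] y1 vnorm_vec[of y] unfolding vform_def by simp
    moreover have "vnorm (Lam A B (Matrix.vec d y)) \<le> Lam_norm A B"
      by (rule Lam_norm_upper[OF yR]) (simp add: vnorm_vec y1)
    ultimately have "(1 / dotn d x x) * vform x x \<le> Lam_norm A B" by simp
    then show ?thesis using pos by (simp add: field_simps)
  qed
qed

lemma vform_nonpos:
  assumes "Lam_nonpos A B" "Matrix.vec d x \<in> R"
  shows "vform x x \<le> 0"
  using assms unfolding Lam_nonpos_def vform_def by auto



text \<open>Forwards, the component of \<open>x\<close> orthogonal to \<open>R\<close> lies in the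
  kernel of \<open>B\<close>, to which \<open>x\<close> is orthogonal, so it vanishes; pairing the
  condition with \<open>z\<close> gives the identity for
  \<open>w = transpose_mat B *\<^sub>v z\<close>. Backwards, the defect \<open>z\<close> of the
  condition is paired with itself by inserting the same \<open>w\<close>.\<close>

lemma boundary_condition_iff:
  "A *\<^sub>v Matrix.vec d x + c \<cdot>\<^sub>v (B *\<^sub>v Matrix.vec d y) = 0\<^sub>v d \<longleftrightarrow>
    Matrix.vec d x \<in> R \<and> (\<forall>w. Matrix.vec d w \<in> R \<longrightarrow> c * dotn d y w = - vform x w)" (is "?l \<longleftrightarrow> ?r")
proof
  assume l: ?l
  let ?x = "Matrix.vec d x" and ?y = "Matrix.vec d y"
  have cy: "c \<cdot>\<^sub>v (B *\<^sub>v ?y) = B *\<^sub>v (c \<cdot>\<^sub>v ?y)" by (rule mult_mat_vec[symmetric, of _ d d]) auto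
  obtain p where p: "p \<in> R" "B *\<^sub>v ?x = B *\<^sub>v p" "\<And>w. w \<in> R \<Longrightarrow> scalar_prod (?x - p) w = 0"
    using R_projection[of ?x] by auto
  have pc: "p \<in> carrier_vec d" by (rule R_carrier[OF p(1)])
  have "B *\<^sub>v (?x - p) = 0\<^sub>v d" using p(2) pc by (simp add: mult_minus_distrib_mat_vec[OF B] minus_cancel_vec)
  then have "scalar_prod ?x (?x - p) = 0"
    using boundary_orthogonal_kernel[of ?x "c \<cdot>\<^sub>v ?y" "?x - p"] l pc unfolding cy by auto
  moreover have "scalar_prod (?x - p) p = 0" using p by auto
  moreover have "scalar_prod (?x - p) (?x - p) = scalar_prod ?x (?x - p) - scalar_prod (?x - p) p"
    using pc minus_scalar_prod_distrib[of ?x d p "?x - p"] comm_scalar_prod[of p d "?x - p"] by simp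
  ultimately have "scalar_prod (?x - p) (?x - p) = 0" by simp
  then have "?x - p = 0\<^sub>v d" using pc by (intro scalar_prod_real_self_zero) auto
  then have "?x = p" using pc
    by (metis carrier_vecD dim_vec eq_vecI index_minus_vec(1) index_zero_vec(1) right_minus_eq)
  then have xR: "?x \<in> R" using p by simp
  have "c * dotn d y w = - vform x w" if w: "Matrix.vec d w \<in> R" for w
  proof -
    obtain z where z: "z \<in> carrier_vec d" "Matrix.vec d w = transpose_mat B *\<^sub>v z" using w unfolding R_iff by auto
    have "dotn d y w = scalar_prod (transpose_mat B *\<^sub>v z) ?y"
      unfolding scalar_prod_vec_vec[symmetric] z(2) using z by (intro comm_scalar_prod[of _ d]) auto
    also have "\<dots> = scalar_prod z (B *\<^sub>v ?y)" by (rule adj[OF B _ z(1)]) simp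
    finally have "c * dotn d y w + vform x w = scalar_prod z (c \<cdot>\<^sub>v (B *\<^sub>v ?y)) + scalar_prod z (A *\<^sub>v ?x)"
      using z vform_eq[OF xR z] by simp
    also have "\<dots> = scalar_prod z (A *\<^sub>v ?x + c \<cdot>\<^sub>v (B *\<^sub>v ?y))"
      using z by (subst scalar_prod_add_distrib[of _ d]) auto
    also have "\<dots> = 0" using l z by simp
    finally show ?thesis by simp
  qed
  then show ?r using xR by simp
next
  assume r: ?r
  let ?x = "Matrix.vec d x" and ?y = "Matrix.vec d y"
  define z where "z = A *\<^sub>v ?x + c \<cdot>\<^sub>v (B *\<^sub>v ?y)"
  have z: "z \<in> carrier_vec d" unfolding z_def by simp
  define w where "w = ($) (transpose_mat B *\<^sub>v z)"
  have w: "Matrix.vec d w = transpose_mat B *\<^sub>v z" unfolding w_def using z by (intro eq_vecI) auto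
  then have wR: "Matrix.vec d w \<in> R" unfolding R_iff using z by auto
  have "dotn d y w = scalar_prod (transpose_mat B *\<^sub>v z) ?y"
    unfolding scalar_prod_vec_vec[symmetric] w using z by (intro comm_scalar_prod[of _ d]) auto
  also have "\<dots> = scalar_prod z (B *\<^sub>v ?y)" by (rule adj[OF B _ z]) simp
  finally have "c * dotn d y w + vform x w = scalar_prod z (c \<cdot>\<^sub>v (B *\<^sub>v ?y)) + scalar_prod z (A *\<^sub>v ?x)"
    using z vform_eq[OF _ z w] r by simp
  also have "\<dots> = scalar_prod z z"
  proof -
    have "scalar_prod z z = scalar_prod z (A *\<^sub>v ?x + c \<cdot>\<^sub>v (B *\<^sub>v ?y))" by (simp only: z_def[symmetric])
    also have "\<dots> = scalar_prod z (A *\<^sub>v ?x) + scalar_prod z (c \<cdot>\<^sub>v (B *\<^sub>v ?y))"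
      using z by (intro scalar_prod_add_distrib[of _ d]) auto
    finally show ?thesis by simp
  qed
  finally have "scalar_prod z z = 0" using r wR by simp
  then have "z = 0\<^sub>v d" using z by (intro scalar_prod_real_self_zero) auto
  then show ?l unfolding z_def .
qed

end

section \<open>Square integrable functions on the graph\<close>

text \<open>The inequality \<open>(u p)\<^sup>2 \<le> 2 * (u x)\<^sup>2 + 2 * N * \<bar>x -
  p\<bar>\<close> is averaged over the interval of length \<open>s\<close> adjacent to the end
  \<open>p\<close>, where the distance to \<open>p\<close> integrates to
  \<open>s\<^sup>2 / 2\<close>. The parameter \<open>s\<close> trades one term against the
  other.\<close>

lemma H1rep_trace:
  assumes u: "H1rep l u g" and s: "0 < s" "s \<le> l"
  shows "(u 0)\<^sup>2 \<le> 2 / s * ip2 l u u + s * ip2 l g g" "(u l)\<^sup>2 \<le> 2 / s * ip2 l u u + s * ip2 l g g"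
proof -
  have uL: "L2_on l u" by (rule H1rep_L2_self[OF u])
  have gL: "L2_on l g" by (rule H1rep_L2[OF u])
  define N where "N = ip2 l g g"
  have est: "(u p)\<^sup>2 \<le> 2 / s * ip2 l u u + s * N"
    if p: "p \<in> {0..l}" "0 \<le> y" "y + s \<le> l" and d: "integral {y..y+s} (\<lambda>x. \<bar>x - p\<bar>) = s\<^sup>2 / 2" for p y
  proof -
    have i1: "(\<lambda>x. 2 * (u x)\<^sup>2) integrable_on {y..y+s}"
      using L2_on_imp_integrable_on(2)[OF uL p(2,3)] by (intro integrable_on_mult_right)
    have i2: "(\<lambda>x. 2 * N * \<bar>x - p\<bar>) integrable_on {y..y+s}"
      by (intro integrable_continuous_real continuous_intros)
    have "integral {y..y+s} (\<lambda>x. (u p)\<^sup>2) \<le> integral {y..y+s} (\<lambda>x. 2 * (u x)\<^sup>2 + 2 * N * \<bar>x - p\<bar>)"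
    proof (rule integral_le)
      show "(\<lambda>x. (u p)\<^sup>2) integrable_on {y..y+s}" by (intro integrable_continuous_real continuous_intros)
      show "(\<lambda>x. 2 * (u x)\<^sup>2 + 2 * N * \<bar>x - p\<bar>) integrable_on {y..y+s}" by (rule integrable_add[OF i1 i2])
      fix x assume x: "x \<in> {y..y+s}"
      then have xl: "x \<in> {0..l}" using p by auto
      have "(u p)\<^sup>2 = (u x - (u x - u p))\<^sup>2" by simp
      also have "\<dots> \<le> 2 * (u x)\<^sup>2 + 2 * (u x - u p)\<^sup>2"
        using zero_le_power2[of "u x + (u x - u p)"] by (simp add: power2_eq_square algebra_simps)
      also have "(u x - u p)\<^sup>2 \<le> \<bar>x - p\<bar> * N" unfolding N_def by (rule H1rep_Hoelder[OF u p(1) xl])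
      finally show "(u p)\<^sup>2 \<le> 2 * (u x)\<^sup>2 + 2 * N * \<bar>x - p\<bar>" by (simp add: mult_ac)
    qed
    also have "\<dots> = 2 * integral {y..y+s} (\<lambda>x. (u x)\<^sup>2) + 2 * N * (s\<^sup>2 / 2)"
      using Henstock_Kurzweil_Integration.integral_add[OF i1 i2] d by simp
    also have "\<dots> \<le> 2 * ip2 l u u + N * s\<^sup>2"
      using integral_sq_mono[OF uL, of y "y + s"] p s by simp
    finally have "s * (u p)\<^sup>2 \<le> 2 * ip2 l u u + N * s\<^sup>2" using s by simp
    then show ?thesis using s by (simp add: field_simps power2_eq_square)
  qed
  have "integral {0..0+s} (\<lambda>x. \<bar>x - 0\<bar>) = integral {0..0+s} (\<lambda>x. x)"
    by (rule Henstock_Kurzweil_Integration.integral_cong) auto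
  then have "integral {0..0+s} (\<lambda>x. \<bar>x - 0\<bar>) = s\<^sup>2 / 2" using s integral_unique[OF ident_has_integral[of 0 s]] by simp
  from est[OF _ _ _ this] show "(u 0)\<^sup>2 \<le> 2 / s * ip2 l u u + s * ip2 l g g" using s by (simp add: N_def)
  have "integral {l-s..l-s+s} (\<lambda>x. \<bar>x - l\<bar>) = integral {l-s..l} (\<lambda>x. l - x)"
    by (simp, rule Henstock_Kurzweil_Integration.integral_cong) auto
  also have "\<dots> = s * l - (l\<^sup>2 - (l - s)\<^sup>2) / 2"
  proof -
    have "integral {l-s..l} (\<lambda>x. l - x) = integral {l-s..l} (\<lambda>x. l) - integral {l-s..l} (\<lambda>x. x)"
      by (intro Henstock_Kurzweil_Integration.integral_diff integrable_continuous_real continuous_intros)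
    then show ?thesis using s integral_unique[OF ident_has_integral[of "l - s" l]] by simp
  qed
  also have "\<dots> = s\<^sup>2 / 2" by (simp add: power2_eq_square field_simps)
  finally show "(u l)\<^sup>2 \<le> 2 / s * ip2 l u u + s * ip2 l g g" using est[of l "l - s"] s by (simp add: N_def)
qed

text \<open>A counterpart of the trace bound: the value at one end and the derivative control the
  function. In the completeness proof these are the quantities whose convergence is known.\<close>

lemma H1rep_ip2_le:
  assumes u: "H1rep l u g" and l: "0 < l"
  shows "ip2 l u u \<le> 2 * l * (u 0)\<^sup>2 + 2 * l\<^sup>2 * ip2 l g g"
proof -
  have uL: "L2_on l u" by (rule H1rep_L2_self[OF u])
  have "ip2 l u u = integral {0..l} (\<lambda>x. (u x)\<^sup>2)"
    using ip2_eq_integral[OF uL uL] by (simp add: power2_eq_square)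
  also have "\<dots> \<le> integral {0..l} (\<lambda>x. 2 * (u 0)\<^sup>2 + 2 * l * ip2 l g g)"
  proof (rule integral_le)
    show "(\<lambda>x. (u x)\<^sup>2) integrable_on {0..l}" using L2_on_imp_integrable_on(2)[OF uL, of 0 l] by simp
    show "(\<lambda>x. 2 * (u 0)\<^sup>2 + 2 * l * ip2 l g g) integrable_on {0..l}"
      by (intro integrable_continuous_real continuous_intros)
    fix x assume x: "x \<in> {0..l}"
    have "(u x)\<^sup>2 = (u 0 + (u x - u 0))\<^sup>2" by simp
    also have "\<dots> \<le> 2 * (u 0)\<^sup>2 + 2 * (u x - u 0)\<^sup>2"
      using zero_le_power2[of "u 0 - (u x - u 0)"] by (simp add: power2_eq_square algebra_simps)
    also have "(u x - u 0)\<^sup>2 \<le> \<bar>x - 0\<bar> * ip2 l g g" using l x by (intro H1rep_Hoelder[OF u]) auto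
    also have "\<bar>x - 0\<bar> * ip2 l g g \<le> l * ip2 l g g"
      using x by (intro mult_right_mono) (auto simp: ip2_def)
    finally show "(u x)\<^sup>2 \<le> 2 * (u 0)\<^sup>2 + 2 * l * ip2 l g g" by simp
  qed
  also have "\<dots> = 2 * l * (u 0)\<^sup>2 + 2 * l\<^sup>2 * ip2 l g g"
    using l by (simp add: algebra_simps power2_eq_square)
  finally show ?thesis .
qed

section \<open>The L2 space of the graph as a finite sum over edges\<close>

locale graph_L2 =
  fixes G :: "('v,'e) pre_digraph" and len :: "'e \<Rightarrow> real"
  assumes cmg: "compact_metric_graph G len"
begin

abbreviation "ipG \<equiv> L2_inner G len"
abbreviation "HG \<equiv> L2_graph G len"

lemma fin: "finite (arcs G)" "finite (verts G)" "arcs G \<noteq> {}" "\<And>e. e \<in> arcs G \<Longrightarrow> 0 < len e"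
  "\<And>e. e \<in> arcs G \<Longrightarrow> tail G e \<in> verts G" "\<And>e. e \<in> arcs G \<Longrightarrow> head G e \<in> verts G"
proof -
  have fd: "fin_digraph G" using cmg unfolding compact_metric_graph_def by simp
  then interpret fin_digraph G .
  show "finite (arcs G)" "finite (verts G)" "\<And>e. e \<in> arcs G \<Longrightarrow> tail G e \<in> verts G"
    "\<And>e. e \<in> arcs G \<Longrightarrow> head G e \<in> verts G" by auto
qed (use cmg in \<open>auto simp: compact_metric_graph_def\<close>)

lemma ipG_eq: "ipG u w = (\<Sum>e\<in>arcs G. ip2 (len e) (u e) (w e))"
  by (simp add: L2_inner_def ip2_def)

lemma HG_iff: "u \<in> HG \<longleftrightarrow> (\<forall>e\<in>arcs G. L2_on (len e) (u e))"
  by (simp add: L2_graph_def)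

lemma ipG_semi_inner: "semi_inner HG ipG"
proof -
  note s = ip2_semi_inner
  show ?thesis
  proof
    show "Real_Vector_Spaces.subspace HG"
      unfolding Real_Vector_Spaces.subspace_def
    proof (intro conjI ballI allI)
      show "0 \<in> HG" unfolding HG_iff using semi_inner.mem(1)[OF s] by simp
      show "x + y \<in> HG" if "x \<in> HG" "y \<in> HG" for x y
        unfolding HG_iff
      proof
        fix e assume "e \<in> arcs G"
        then show "L2_on (len e) ((x + y) e)"
          using semi_inner.mem(2)[OF s, of "x e" "len e" "y e"] that by (simp add: HG_iff)
      qed
      show "c *\<^sub>R x \<in> HG" if "x \<in> HG" for c x
        unfolding HG_iff
      proof
        fix e assume "e \<in> arcs G"
        then show "L2_on (len e) ((c *\<^sub>R x) e)"
          using semi_inner.mem(3)[OF s, of "x e" "len e" c] that by (simp add: HG_iff)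
      qed
    qed
    show "ipG x y = ipG y x" for x y by (simp add: ipG_eq ip2_commute)
    show "ipG (x + y) z = ipG x z + ipG y z" if "x \<in> HG" "y \<in> HG" "z \<in> HG" for x y z
      using that semi_inner.add_left[OF s] by (simp add: ipG_eq HG_iff sum.distrib)
    show "ipG (c *\<^sub>R x) y = c * ipG x y" if "x \<in> HG" "y \<in> HG" for c x y
      using that semi_inner.scale_left[OF s] by (simp add: ipG_eq HG_iff sum_distrib_left)
    show "0 \<le> ipG x x" if "x \<in> HG" for x
      using that semi_inner.nonneg[OF s] by (auto simp: ipG_eq HG_iff intro!: sum_nonneg)
  qed
qed

lemma ip2_le_ipG:
  assumes "u \<in> HG" "e \<in> arcs G"
  shows "ip2 (len e) (u e) (u e) \<le> ipG u u"
  unfolding ipG_eq using assms fin(1)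
  by (intro member_le_sum) (auto simp: ip2_def)

lemma ipG_complete: "complete_semi_inner HG ipG"
proof -
  interpret semi_inner HG ipG by (rule ipG_semi_inner)
  show ?thesis
  proof
    fix f :: "nat \<Rightarrow> 'e \<Rightarrow> real \<Rightarrow> real"
    assume f: "\<And>n. f n \<in> HG" and C: "\<And>e. 0 < e \<Longrightarrow> \<exists>N. \<forall>m\<ge>N. \<forall>n\<ge>N. ipG (f m - f n) (f m - f n) < e"
    have "\<exists>g. L2_on (len e) g \<and> (\<lambda>n. ip2 (len e) (f n e - g) (f n e - g)) \<longlonglongrightarrow> 0" if e: "e \<in> arcs G" for e
    proof -
      interpret e: complete_semi_inner "{u. L2_on (len e) u}" "ip2 (len e)" by (rule ip2_complete)
      have "\<exists>x\<in>{u. L2_on (len e) u}. (\<lambda>n. ip2 (len e) (f n e - x) (f n e - x)) \<longlonglongrightarrow> 0"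
      proof (rule e.complete)
        show "f n e \<in> {u. L2_on (len e) u}" for n using f e by (auto simp: HG_iff)
        fix \<epsilon> :: real assume "0 < \<epsilon>"
        then obtain N where N: "\<forall>m\<ge>N. \<forall>n\<ge>N. ipG (f m - f n) (f m - f n) < \<epsilon>" using C by blast
        have "ip2 (len e) (f m e - f n e) (f m e - f n e) \<le> ipG (f m - f n) (f m - f n)" for m n
          using ip2_le_ipG[OF mem(4)[OF f f] e] by simp
        then show "\<exists>N. \<forall>m\<ge>N. \<forall>n\<ge>N. ip2 (len e) (f m e - f n e) (f m e - f n e) < \<epsilon>"
          using N le_less_trans by blast
      qed
      then show ?thesis by blast
    qed
    then have "\<forall>e. \<exists>g. e \<in> arcs G \<longrightarrow> L2_on (len e) g \<and> (\<lambda>n. ip2 (len e) (f n e - g) (f n e - g)) \<longlonglongrightarrow> 0" by blast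
    from choice[OF this] obtain g where g: "\<forall>e. e \<in> arcs G \<longrightarrow> L2_on (len e) (g e) \<and>
        (\<lambda>n. ip2 (len e) (f n e - g e) (f n e - g e)) \<longlonglongrightarrow> 0" by blast
    have "(\<lambda>n. ipG (f n - g) (f n - g)) \<longlonglongrightarrow> (\<Sum>e\<in>arcs G. 0)"
      unfolding ipG_eq using g by (intro tendsto_sum) auto
    then show "\<exists>x\<in>HG. (\<lambda>n. ipG (f n - x) (f n - x)) \<longlonglongrightarrow> 0"
      using g by (intro bexI[of _ g]) (auto simp: HG_iff)
  qed
qed

lemma L2_norm_tendsto_iff:
  assumes "\<And>n. f n \<in> HG"
  shows "(\<lambda>n. L2_norm G len (f n)) \<longlonglongrightarrow> 0 \<longleftrightarrow> (\<lambda>n. ipG (f n) (f n)) \<longlonglongrightarrow> 0"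
proof
  interpret semi_inner HG ipG by (rule ipG_semi_inner)
  show "(\<lambda>n. L2_norm G len (f n)) \<longlonglongrightarrow> 0" if "(\<lambda>n. ipG (f n) (f n)) \<longlonglongrightarrow> 0"
    unfolding L2_norm_def using tendsto_real_sqrt[OF that] by simp
  show "(\<lambda>n. ipG (f n) (f n)) \<longlonglongrightarrow> 0" if "(\<lambda>n. L2_norm G len (f n)) \<longlonglongrightarrow> 0"
  proof -
    have "(\<lambda>n. (L2_norm G len (f n))\<^sup>2) \<longlonglongrightarrow> 0" using tendsto_power[OF that, of 2] by simp
    then show ?thesis unfolding L2_norm_def using nonneg[OF assms] by simp
  qed
qed

lemma L2_sums_iff:
  assumes w: "\<And>k. w k \<in> HG" and u: "u \<in> HG"
  shows "L2_sums G len w u \<longleftrightarrow> (\<lambda>n. ipG (u - (\<Sum>k<n. w k)) (u - (\<Sum>k<n. w k))) \<longlonglongrightarrow> 0"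
proof -
  interpret semi_inner HG ipG by (rule ipG_semi_inner)
  have "(\<lambda>e x. u e x - (\<Sum>k<n. w k e x)) = u - (\<Sum>k<n. w k)" for n by (auto simp: fun_eq_iff)
  then show ?thesis
    unfolding L2_sums_def using w u by (simp, subst L2_norm_tendsto_iff) auto
qed

lemma ipG_zero_iff:
  assumes "u \<in> HG"
  shows "ipG u u = 0 \<longleftrightarrow> (\<forall>e\<in>arcs G. AE x in leb (len e). u e x = 0)"
proof -
  have "ipG u u = 0 \<longleftrightarrow> (\<forall>e\<in>arcs G. ip2 (len e) (u e) (u e) = 0)"
    unfolding ipG_eq using fin(1) by (intro sum_nonneg_eq_0_iff) (auto simp: ip2_def)
  then show ?thesis using assms ip2_eq_0_iff by (auto simp: HG_iff)
qed

end

section \<open>The quadratic form\<close>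

locale quantum_graph = graph_L2 G len
  for G :: "('v,'e) pre_digraph" and len :: "'e \<Rightarrow> real" +
  fixes enum :: "'v \<Rightarrow> nat \<Rightarrow> 'e \<times> bool" and a :: "('v,'e) gpoint \<Rightarrow> real" and a0 :: real
    and \<kappa> :: "'e \<Rightarrow> real \<Rightarrow> real" and \<kappa>0 :: real and A B :: "'v \<Rightarrow> real Matrix.mat"
  assumes enum: "\<forall>v\<in>verts G. bij_betw (enum v) {..<deg G v} (edge_ends G v)"
    and kappa_Linf: "\<forall>e\<in>arcs G. \<kappa> e \<in> borel_measurable (lebesgue_on {0..len e}) \<and>
           (\<exists>C. AE x in lebesgue_on {0..len e}. \<bar>\<kappa> e x\<bar> \<le> C)"
    and kappa_ge: "\<forall>e\<in>arcs G. AE x in lebesgue_on {0..len e}. \<kappa>0 \<le> \<kappa> e x"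
    and kappa_pos: "0 < \<kappa>0"
    and lip: "lipschitz_graph G len a"
    and a_ge: "\<forall>p\<in>gpoints G len. a0 \<le> a p"
    and a0_pos: "0 < a0"
    and adm: "admissible_vertex_conditions G A B"
begin

lemma vc: "v \<in> verts G \<Longrightarrow> vertex_conditions (deg G v) (A v) (B v)"
  using adm unfolding admissible_vertex_conditions_def by unfold_locales auto

abbreviation \<alpha> :: "'e \<Rightarrow> real \<Rightarrow> real" where "\<alpha> e t \<equiv> a (edge_pt G len e t)"

lemma edge_pt_in: "\<lbrakk>e \<in> arcs G; t \<in> {0..len e}\<rbrakk> \<Longrightarrow> edge_pt G len e t \<in> gpoints G len"
  using fin(5,6) unfolding edge_pt_def gpoints_def by auto

lemma \<alpha>_ge: "\<lbrakk>e \<in> arcs G; t \<in> {0..len e}\<rbrakk> \<Longrightarrow> a0 \<le> \<alpha> e t"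
  using a_ge edge_pt_in by auto

lemma path_length_nonneg: "path_length G len p q r \<Longrightarrow> 0 \<le> r"
  by (induction rule: path_length.induct) auto

text \<open>The segment of the edge between the two points is itself a path, so their graph distance
  is at most \<open>\<bar>s - t\<bar>\<close>. The absolute value of \<open>C\<close> is taken
  because a Lipschitz constant is not assumed nonnegative.\<close>

lemma \<alpha>_lipschitz:
  obtains C where "\<And>e s t. \<lbrakk>e \<in> arcs G; s \<in> {0..len e}; t \<in> {0..len e}\<rbrakk> \<Longrightarrow> \<bar>\<alpha> e s - \<alpha> e t\<bar> \<le> C * \<bar>s - t\<bar>"
proof -
  obtain C where C: "\<forall>p\<in>gpoints G len. \<forall>q\<in>gpoints G len. \<bar>a p - a q\<bar> \<le> C * gdist G len p q"
    using lip unfolding lipschitz_graph_def by blast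
  have "\<bar>\<alpha> e s - \<alpha> e t\<bar> \<le> \<bar>C\<bar> * \<bar>s - t\<bar>" if e: "e \<in> arcs G" "s \<in> {0..len e}" "t \<in> {0..len e}" for e s t
  proof -
    let ?p = "edge_pt G len e s" and ?q = "edge_pt G len e t"
    let ?S = "{r. path_length G len ?p ?q r}"
    have bdd: "bdd_below ?S" using path_length_nonneg by (intro bdd_belowI[of _ 0]) auto
    have "path_length G len ?p ?q (\<bar>s - t\<bar> + 0)"
      by (rule path_length.segment[where G=G and len=len and e=e, OF e])
        (rule path_length.stay[OF edge_pt_in[OF e(1,3)]])
    then have mem: "\<bar>s - t\<bar> \<in> ?S" by simp
    have le: "gdist G len ?p ?q \<le> \<bar>s - t\<bar>" unfolding gdist_def by (rule cInf_lower[OF mem bdd])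
    have ge: "0 \<le> gdist G len ?p ?q"
      unfolding gdist_def using mem path_length_nonneg by (intro cInf_greatest) auto
    have "\<bar>\<alpha> e s - \<alpha> e t\<bar> \<le> C * gdist G len ?p ?q" using C edge_pt_in e by blast
    also have "\<dots> \<le> \<bar>C\<bar> * gdist G len ?p ?q" using ge by (intro mult_right_mono) auto
    also have "\<dots> \<le> \<bar>C\<bar> * \<bar>s - t\<bar>" using le by (intro mult_left_mono) auto
    finally show ?thesis .
  qed
  then show thesis using that by blast
qed

text \<open>The reciprocal is Lipschitz because the coefficient is at least \<open>a0\<close>. The
  coefficient is needed to form the flux, its reciprocal to recover the derivative from the
  flux.\<close>

lemma \<alpha>_H1rep:
  assumes e: "e \<in> arcs G"
  shows "\<exists>h. H1rep (len e) (\<alpha> e) h" "\<exists>h. H1rep (len e) (\<lambda>t. 1 / \<alpha> e t) h"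
proof -
  obtain C where C: "\<And>s t. \<lbrakk>s \<in> {0..len e}; t \<in> {0..len e}\<rbrakk> \<Longrightarrow> \<bar>\<alpha> e s - \<alpha> e t\<bar> \<le> C * \<bar>s - t\<bar>"
    by (rule \<alpha>_lipschitz) (use e in blast)
  show "\<exists>h. H1rep (len e) (\<alpha> e) h"
  proof (rule Lipschitz_imp_H1rep[OF fin(4)[OF e], of "\<alpha> e" C])
    show "\<bar>\<alpha> e s - \<alpha> e t\<bar> \<le> C * \<bar>s - t\<bar>" if "s \<in> {0..len e}" "t \<in> {0..len e}" for s t
      by (rule C[OF that])
  qed (rule exI)
  have inv: "\<bar>1 / \<alpha> e s - 1 / \<alpha> e t\<bar> \<le> (C / a0\<^sup>2) * \<bar>s - t\<bar>" if st: "s \<in> {0..len e}" "t \<in> {0..len e}" for s t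
  proof -
    note ge = \<alpha>_ge[OF e st(1)] \<alpha>_ge[OF e st(2)]
    then have pos: "0 < \<alpha> e s" "0 < \<alpha> e t" using a0_pos by auto
    have prod: "a0\<^sup>2 \<le> \<alpha> e s * \<alpha> e t"
      unfolding power2_eq_square using ge a0_pos pos by (intro mult_mono) auto
    have "1 / \<alpha> e s - 1 / \<alpha> e t = (\<alpha> e t - \<alpha> e s) / (\<alpha> e s * \<alpha> e t)"
      using pos by (simp add: field_simps)
    then have "\<bar>1 / \<alpha> e s - 1 / \<alpha> e t\<bar> = \<bar>\<alpha> e t - \<alpha> e s\<bar> / (\<alpha> e s * \<alpha> e t)"
      using pos by (simp only: abs_divide abs_mult abs_of_pos)
    then have "\<bar>1 / \<alpha> e s - 1 / \<alpha> e t\<bar> = \<bar>\<alpha> e s - \<alpha> e t\<bar> / (\<alpha> e s * \<alpha> e t)"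
      by (simp only: abs_minus_commute)
    also have "\<dots> \<le> \<bar>\<alpha> e s - \<alpha> e t\<bar> / a0\<^sup>2"
      using prod a0_pos pos by (intro divide_left_mono) auto
    also have "\<dots> \<le> (C * \<bar>s - t\<bar>) / a0\<^sup>2" using C[OF st] by (intro divide_right_mono) auto
    finally show ?thesis by simp
  qed
  show "\<exists>h. H1rep (len e) (\<lambda>t. 1 / \<alpha> e t) h"
  proof (rule Lipschitz_imp_H1rep[OF fin(4)[OF e], of "\<lambda>t. 1 / \<alpha> e t" "C / a0\<^sup>2"])
    show "\<bar>1 / \<alpha> e s - 1 / \<alpha> e t\<bar> \<le> (C / a0\<^sup>2) * \<bar>s - t\<bar>"
      if "s \<in> {0..len e}" "t \<in> {0..len e}" for s t
      by (rule inv[OF that])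
  qed (rule exI)
qed

lemma \<alpha>_measurable: "e \<in> arcs G \<Longrightarrow> \<alpha> e \<in> borel_measurable (leb (len e))"
  using \<alpha>_H1rep(1) H1rep_continuous continuous_imp_measurable_leb by blast

lemma \<alpha>_bounded: "\<exists>C. \<forall>e\<in>arcs G. \<forall>t\<in>{0..len e}. \<bar>\<alpha> e t\<bar> \<le> C"
proof -
  have "\<exists>C. \<forall>t\<in>{0..len e}. \<bar>\<alpha> e t\<bar> \<le> C" if e: "e \<in> arcs G" for e
  proof -
    obtain h where h: "H1rep (len e) (\<alpha> e) h" using \<alpha>_H1rep(1)[OF e] by (elim exE)
    show ?thesis by (rule continuous_on_bounded_interval[OF H1rep_continuous[OF h]]) blast
  qed
  then have "\<forall>e. \<exists>C. e \<in> arcs G \<longrightarrow> (\<forall>t\<in>{0..len e}. \<bar>\<alpha> e t\<bar> \<le> C)" by blast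
  from choice[OF this] obtain C where C: "\<forall>e. e \<in> arcs G \<longrightarrow> (\<forall>t\<in>{0..len e}. \<bar>\<alpha> e t\<bar> \<le> C e)" by blast
  have "C e \<le> Max (C ` arcs G)" if "e \<in> arcs G" for e using that fin(1) by (intro Max_ge) auto
  then show ?thesis using C by (intro exI[of _ "Max (C ` arcs G)"]) (meson order_trans)
qed

lemma kappa_bounded: "\<exists>C. \<forall>e\<in>arcs G. AE x in leb (len e). (\<kappa> e x)\<^sup>2 \<le> C"
proof -
  have "\<exists>C. AE x in leb (len e). (\<kappa> e x)\<^sup>2 \<le> C" if e: "e \<in> arcs G" for e
  proof -
    obtain C where "AE x in leb (len e). \<bar>\<kappa> e x\<bar> \<le> C"
      using kappa_Linf[rule_format, OF e] by auto
    then have "AE x in leb (len e). (\<kappa> e x)\<^sup>2 \<le> C\<^sup>2"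
      by eventually_elim (metis abs_ge_zero power2_abs power_mono)
    then show ?thesis by blast
  qed
  then have "\<forall>e. \<exists>C. e \<in> arcs G \<longrightarrow> (AE x in leb (len e). (\<kappa> e x)\<^sup>2 \<le> C)" by blast
  from choice[OF this] obtain C where C: "\<forall>e. e \<in> arcs G \<longrightarrow> (AE x in leb (len e). (\<kappa> e x)\<^sup>2 \<le> C e)" by blast
  have "AE x in leb (len e). (\<kappa> e x)\<^sup>2 \<le> Max (C ` arcs G)" if "e \<in> arcs G" for e
  proof -
    have "C e \<le> Max (C ` arcs G)" using that fin(1) by (intro Max_ge) auto
    moreover have "AE x in leb (len e). (\<kappa> e x)\<^sup>2 \<le> C e" using C that by blast
    ultimately show ?thesis by (auto elim!: eventually_mono)
  qed
  then show ?thesis by blast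
qed

lemma \<kappa>2_measurable: "e \<in> arcs G \<Longrightarrow> (\<lambda>x. (\<kappa> e x)\<^sup>2) \<in> borel_measurable (leb (len e))"
  using kappa_Linf by auto

lemma \<alpha>_L2: "e \<in> arcs G \<Longrightarrow> L2_on (len e) g \<Longrightarrow> L2_on (len e) (\<lambda>x. \<alpha> e x * g x)"
proof -
  assume e: "e \<in> arcs G" and g: "L2_on (len e) g"
  obtain C where "\<forall>e\<in>arcs G. \<forall>t\<in>{0..len e}. \<bar>\<alpha> e t\<bar> \<le> C" using \<alpha>_bounded by blast
  then have "AE x in leb (len e). \<bar>\<alpha> e x\<bar> \<le> C" using e by (intro AE_I2) auto
  then show ?thesis by (rule L2_on_bounded_mult[OF g \<alpha>_measurable[OF e]])
qed

lemma \<kappa>2_L2: "e \<in> arcs G \<Longrightarrow> L2_on (len e) g \<Longrightarrow> L2_on (len e) (\<lambda>x. (\<kappa> e x)\<^sup>2 * g x)"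
proof -
  assume e: "e \<in> arcs G" and g: "L2_on (len e) g"
  obtain C where "\<forall>e\<in>arcs G. AE x in leb (len e). (\<kappa> e x)\<^sup>2 \<le> C" using kappa_bounded by blast
  then have "AE x in leb (len e). \<bar>(\<kappa> e x)\<^sup>2\<bar> \<le> C" using e by auto
  then show ?thesis by (rule L2_on_bounded_mult[OF g \<kappa>2_measurable[OF e]])
qed

section \<open>Boundary values and the form domain\<close>

definition ev :: "('e \<Rightarrow> real \<Rightarrow> real) \<Rightarrow> 'e \<times> bool \<Rightarrow> real" where
  "ev u p = u (fst p) (if snd p then len (fst p) else 0)"

definition bval :: "('e \<Rightarrow> real \<Rightarrow> real) \<Rightarrow> 'v \<Rightarrow> nat \<Rightarrow> real" where
  "bval u v i = ev u (enum v i)"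

abbreviation "Rv v \<equiv> range_mat (transpose_mat (B v))"
abbreviation "vf v \<equiv> vertex_conditions.vform (deg G v) (A v) (B v)"
abbreviation "bvec u v \<equiv> Matrix.vec (deg G v) (bval u v)"

text \<open>Every edge end belongs to exactly one vertex. The two ends of a loop are different
  pairs, so a loop is counted twice without special treatment.\<close>

lemma vertex_sum:
  "(\<Sum>v\<in>verts G. \<Sum>i<deg G v. f (enum v i)) = (\<Sum>e\<in>arcs G. f (e, False) + f (e, True))"
proof -
  have "(\<Sum>v\<in>verts G. \<Sum>i<deg G v. f (enum v i)) = (\<Sum>v\<in>verts G. \<Sum>p\<in>edge_ends G v. f p)"
    using enum by (intro sum.cong refl sum.reindex_bij_betw) auto
  also have "\<dots> = (\<Sum>p\<in>(\<Union>v\<in>verts G. edge_ends G v). f p)"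
  proof (rule sum.UNION_disjoint[symmetric])
    show "finite (verts G)" by (rule fin(2))
    show "\<forall>v\<in>verts G. finite (edge_ends G v)"
    proof
      fix v show "finite (edge_ends G v)"
        by (rule finite_subset[of _ "arcs G \<times> UNIV"]) (use fin(1) in \<open>auto simp: edge_ends_def\<close>)
    qed
  qed (auto simp: edge_ends_def)
  also have "(\<Union>v\<in>verts G. edge_ends G v) = arcs G \<times> UNIV"
    using fin(5,6) by (auto simp: edge_ends_def)
  also have "(\<Sum>p\<in>arcs G \<times> UNIV. f p) = (\<Sum>e\<in>arcs G. \<Sum>b\<in>UNIV. f (e, b))"
    by (simp add: sum.cartesian_product)
  also have "\<dots> = (\<Sum>e\<in>arcs G. f (e, False) + f (e, True))"
    by (simp add: UNIV_bool add.commute)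
  finally show ?thesis .
qed

text \<open>Elements are pairs of a function and a derivative. For representatives the derivative is
  not determined pointwise by the function; carrying it along makes \<open>qf\<close> a plain
  formula in the pair, free of choice operators.\<close>

definition Vf :: "(('e \<Rightarrow> real \<Rightarrow> real) \<times> ('e \<Rightarrow> real \<Rightarrow> real)) set" where
  "Vf = {(u, g). (\<forall>e\<in>arcs G. H1rep (len e) (u e) (g e)) \<and> (\<forall>v\<in>verts G. bvec u v \<in> Rv v)}"

definition qf where
  "qf P Q = (\<Sum>e\<in>arcs G. ip2 (len e) (\<lambda>x. \<alpha> e x * snd P e x) (snd Q e)
        + ip2 (len e) (\<lambda>x. (\<kappa> e x)\<^sup>2 * fst P e x) (fst Q e))
      - (\<Sum>v\<in>verts G. vf v (bval (fst P) v) (bval (fst Q) v))"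

definition ipV where "ipV P Q = ipG (fst P) (fst Q)"

definition NV where
  "NV P = (\<Sum>e\<in>arcs G. ip2 (len e) (fst P e) (fst P e) + ip2 (len e) (snd P e) (snd P e))"

lemma Vf_D:
  assumes "P \<in> Vf"
  shows "e \<in> arcs G \<Longrightarrow> H1rep (len e) (fst P e) (snd P e)"
    "e \<in> arcs G \<Longrightarrow> L2_on (len e) (fst P e)" "e \<in> arcs G \<Longrightarrow> L2_on (len e) (snd P e)"
    "v \<in> verts G \<Longrightarrow> bvec (fst P) v \<in> Rv v" "fst P \<in> HG"
  using assms H1rep_L2 H1rep_L2_self unfolding Vf_def by (fastforce simp: HG_iff)+

lemma bval_linear: "bval (u + w) v = bval u v + bval w v" "bval (c *\<^sub>R u) v = c *\<^sub>R bval u v"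
  by (auto simp: bval_def ev_def fun_eq_iff)

lemma Vf_subspace: "Real_Vector_Spaces.subspace Vf"
  unfolding Real_Vector_Spaces.subspace_def
proof (intro conjI ballI allI)
  have sub: "Real_Vector_Spaces.subspace {x. Matrix.vec (deg G v) x \<in> Rv v}" if "v \<in> verts G" for v
    by (rule vertex_conditions.R_subspace[OF vc[OF that]])
  have "bvec 0 v \<in> Rv v" if "v \<in> verts G" for v
  proof -
    have "bval 0 v = 0" by (auto simp: bval_def ev_def fun_eq_iff)
    then show ?thesis using real_vector.subspace_0[OF sub[OF that]] by simp
  qed
  then show "0 \<in> Vf"
    unfolding Vf_def zero_prod_def using H1rep_const[of _ 0] by (auto simp: zero_fun_def)
  show "P + Q \<in> Vf" if "P \<in> Vf" "Q \<in> Vf" for P Q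
  proof -
    have "bvec (fst P + fst Q) v \<in> Rv v" if v: "v \<in> verts G" for v
      using real_vector.subspace_add[OF sub[OF v], of "bval (fst P) v" "bval (fst Q) v"]
        Vf_D(4)[OF \<open>P \<in> Vf\<close> v] Vf_D(4)[OF \<open>Q \<in> Vf\<close> v] by (simp add: bval_linear)
    moreover have "H1rep (len e) ((fst P + fst Q) e) ((snd P + snd Q) e)" if "e \<in> arcs G" for e
      using H1rep_add[OF Vf_D(1)[OF \<open>P \<in> Vf\<close> that] Vf_D(1)[OF \<open>Q \<in> Vf\<close> that]] by (simp add: plus_fun_def)
    ultimately show ?thesis unfolding Vf_def by (simp add: plus_prod_def)
  qed
  show "c *\<^sub>R P \<in> Vf" if "P \<in> Vf" for c P
  proof -
    have "bvec (c *\<^sub>R fst P) v \<in> Rv v" if v: "v \<in> verts G" for v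
      using real_vector.subspace_scale[OF sub[OF v], of "bval (fst P) v" c]
        Vf_D(4)[OF \<open>P \<in> Vf\<close> v] by (simp add: bval_linear)
    moreover have "H1rep (len e) ((c *\<^sub>R fst P) e) ((c *\<^sub>R snd P) e)" if "e \<in> arcs G" for e
      using H1rep_scale[OF Vf_D(1)[OF \<open>P \<in> Vf\<close> that]] by (simp add: scaleR_fun_def)
    ultimately show ?thesis unfolding Vf_def by (simp add: scaleR_prod_def)
  qed
qed

lemma ipV_semi_inner: "semi_inner Vf ipV"
proof -
  interpret semi_inner HG ipG by (rule ipG_semi_inner)
  show ?thesis
    by unfold_locales (use Vf_subspace Vf_D(5) in \<open>auto simp: ipV_def add_left scale_left nonneg intro: sym\<close>)
qed

lemma dotn_bval: "(\<Sum>v\<in>verts G. dotn (deg G v) (bval u v) (bval w v)) =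
    (\<Sum>e\<in>arcs G. u e 0 * w e 0 + u e (len e) * w e (len e))"
  using vertex_sum[of "\<lambda>p. ev u p * ev w p"] by (simp add: dotn_def bval_def ev_def)

lemma qf_bilinear:
  assumes P: "P \<in> Vf" and Q: "Q \<in> Vf"
  shows "qf P Q = qf Q P" "P' \<in> Vf \<Longrightarrow> qf (P + P') Q = qf P Q + qf P' Q" "qf (c *\<^sub>R P) Q = c * qf P Q"
proof -
  have vsym: "vf v (bval (fst P) v) (bval (fst Q) v) = vf v (bval (fst Q) v) (bval (fst P) v)"
    if "P \<in> Vf" "Q \<in> Vf" "v \<in> verts G" for P Q v
    using vertex_conditions.vform_sym[OF vc[OF that(3)]] Vf_D(4) that by blast
  have e1: "ip2 (len e) (\<lambda>x. k x * f x) h = ip2 (len e) (\<lambda>x. k x * h x) f" for e k f h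
    unfolding ip2_def by (simp add: mult_ac)
  show "qf P Q = qf Q P"
    unfolding qf_def using vsym[OF P Q]
    by (intro arg_cong2[where f="(-)"] sum.cong refl) (auto simp: e1[of _ _ "snd P _" "snd Q _"] e1[of _ _ "fst P _" "fst Q _"])
  have vright: "vf v (bval (fst Q) v) (x + y) = vf v (bval (fst Q) v) x + vf v (bval (fst Q) v) y"
     "vf v (bval (fst Q) v) (c *\<^sub>R y) = c * vf v (bval (fst Q) v) y"
    if "v \<in> verts G" for v x y c
    using vertex_conditions.vform_right[OF vc[OF that] Vf_D(4)[OF Q that]] by auto
  show "qf (P + P') Q = qf P Q + qf P' Q" if P': "P' \<in> Vf"
  proof -
    note V = real_vector.subspace_add[OF Vf_subspace P P']
    have "vf v (bval (fst (P + P')) v) (bval (fst Q) v) = vf v (bval (fst P) v) (bval (fst Q) v) + vf v (bval (fst P') v) (bval (fst Q) v)"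
      if v: "v \<in> verts G" for v
      unfolding vsym[OF V Q v] vsym[OF P Q v] vsym[OF P' Q v] by (simp add: bval_linear vright[OF v])
    moreover have "ip2 (len e) (\<lambda>x. k x * (f x + f' x)) h = ip2 (len e) (\<lambda>x. k x * f x) h + ip2 (len e) (\<lambda>x. k x * f' x) h"
      if "L2_on (len e) (\<lambda>x. k x * f x)" "L2_on (len e) (\<lambda>x. k x * f' x)" "L2_on (len e) h" for e k f f' h
      using semi_inner.add_left[OF ip2_semi_inner, of "\<lambda>x. k x * f x" "len e" "\<lambda>x. k x * f' x" h] that
      by (simp add: plus_fun_def distrib_left)
    ultimately show ?thesis
      unfolding qf_def using Vf_D[OF P] Vf_D[OF P'] Vf_D[OF Q] \<alpha>_L2 \<kappa>2_L2
      by (simp add: sum.distrib sum_subtractf)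
  qed
  show "qf (c *\<^sub>R P) Q = c * qf P Q"
  proof -
    note V = real_vector.subspace_scale[OF Vf_subspace P, of c]
    have "vf v (bval (fst (c *\<^sub>R P)) v) (bval (fst Q) v) = c * vf v (bval (fst P) v) (bval (fst Q) v)"
      if v: "v \<in> verts G" for v
      unfolding vsym[OF V Q v] vsym[OF P Q v] by (simp add: bval_linear vright[OF v])
    moreover have "ip2 (len e) (\<lambda>x. k x * (c * f x)) h = c * ip2 (len e) (\<lambda>x. k x * f x) h" for e k f h
      unfolding ip2_def by (simp add: mult.left_commute mult.assoc)
    ultimately show ?thesis
      unfolding qf_def by (simp add: right_diff_distrib sum_distrib_left distrib_left)
  qed
qed

lemma NV_terms:
  assumes "e \<in> arcs G"
  shows "ip2 (len e) (fst P e) (fst P e) + ip2 (len e) (snd P e) (snd P e) \<le> NV P"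
  unfolding NV_def using assms fin(1)
  by (intro member_le_sum[where f="\<lambda>e. ip2 (len e) (fst P e) (fst P e) + ip2 (len e) (snd P e) (snd P e)"])
    (auto simp: ip2_def)

lemma NV_ge:
  assumes "e \<in> arcs G"
  shows "ip2 (len e) (fst P e) (fst P e) \<le> NV P" "ip2 (len e) (snd P e) (snd P e) \<le> NV P" "0 \<le> NV P"
proof -
  have "0 \<le> ip2 (len e) (fst P e) (fst P e)" "0 \<le> ip2 (len e) (snd P e) (snd P e)" by (auto simp: ip2_def)
  then show "ip2 (len e) (fst P e) (fst P e) \<le> NV P" "ip2 (len e) (snd P e) (snd P e) \<le> NV P" "0 \<le> NV P"
    using NV_terms[OF assms, of P] by linarith+
qed

text \<open>Continuity of the form in the H1 norm. Combined with \<open>qf_lower\<close> it makes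
  \<open>qf\<close> and \<open>NV\<close> equivalent, so that completeness can be checked edge by
  edge.\<close>

lemma qf_upper: "\<exists>C\<ge>0. \<forall>P\<in>Vf. qf P P \<le> C * NV P"
proof -
  obtain Ca where Ca: "\<forall>e\<in>arcs G. \<forall>t\<in>{0..len e}. \<bar>\<alpha> e t\<bar> \<le> Ca" using \<alpha>_bounded by blast
  obtain Ck where Ck: "\<forall>e\<in>arcs G. AE x in leb (len e). (\<kappa> e x)\<^sup>2 \<le> Ck" using kappa_bounded by blast
  have "\<forall>v. \<exists>C. v \<in> verts G \<longrightarrow> 0 \<le> C \<and> (\<forall>x y. Matrix.vec (deg G v) x \<in> Rv v \<longrightarrow> Matrix.vec (deg G v) y \<in> Rv v \<longrightarrow>
    \<bar>vf v x y\<bar> \<le> C * (sqrt (dotn (deg G v) x x) * sqrt (dotn (deg G v) y y)))"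
    using vertex_conditions.vform_bounded[OF vc] by blast
  from choice[OF this] obtain Cv where Cv: "\<And>v x y. v \<in> verts G \<Longrightarrow> Matrix.vec (deg G v) x \<in> Rv v \<Longrightarrow> Matrix.vec (deg G v) y \<in> Rv v \<Longrightarrow>
    \<bar>vf v x y\<bar> \<le> Cv v * (sqrt (dotn (deg G v) x x) * sqrt (dotn (deg G v) y y))" "\<And>v. v \<in> verts G \<Longrightarrow> 0 \<le> Cv v" by blast
  define M where "M = (\<Sum>v\<in>verts G. Cv v)"
  have M: "Cv v \<le> M" if "v \<in> verts G" for v
    unfolding M_def using that Cv(2) fin(2) by (intro member_le_sum) auto
  have M0: "0 \<le> M" unfolding M_def using Cv(2) by (intro sum_nonneg) auto
  \<comment> \<open>The traces at both ends of an edge, with \<open>s = len e\<close>, contribute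
    the coefficients \<open>4 / len e\<close> and \<open>2 * len e\<close>; the sum over all edges
    dominates each of them.\<close>
  define T where "T = (\<Sum>e\<in>arcs G. 4 / len e + 2 * len e)"
  have T0: "0 \<le> T" unfolding T_def using fin(4) by (intro sum_nonneg) (auto simp: less_imp_le)
  have Te: "4 / len e + 2 * len e \<le> T" if "e \<in> arcs G" for e
    unfolding T_def using that fin(1,4)
    by (intro member_le_sum[where f="\<lambda>e. 4 / len e + 2 * len e"]) (auto simp: less_imp_le)
  define C where "C = \<bar>Ca\<bar> + \<bar>Ck\<bar> + M * T"
  have "qf P P \<le> C * NV P" if P: "P \<in> Vf" for P
  proof -
    define U where "U e = ip2 (len e) (fst P e) (fst P e)" for e
    define W where "W e = ip2 (len e) (snd P e) (snd P e)" for e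
    have UW: "0 \<le> U e" "0 \<le> W e" for e by (auto simp: U_def W_def ip2_def)
    have t1: "ip2 (len e) (\<lambda>x. \<alpha> e x * snd P e x) (snd P e) \<le> \<bar>Ca\<bar> * W e" if e: "e \<in> arcs G" for e
    proof -
      have "ip2 (len e) (\<lambda>x. \<alpha> e x * snd P e x) (snd P e) \<le> integral\<^sup>L (leb (len e)) (\<lambda>x. \<bar>Ca\<bar> * (snd P e x)\<^sup>2)"
        unfolding ip2_def
      proof (rule integral_mono)
        show "integrable (leb (len e)) (\<lambda>x. \<alpha> e x * snd P e x * snd P e x)"
          using L2_on_mult_integrable[OF \<alpha>_L2[OF e Vf_D(3)[OF P e]] Vf_D(3)[OF P e]] .
        show "integrable (leb (len e)) (\<lambda>x. \<bar>Ca\<bar> * (snd P e x)\<^sup>2)"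
          using L2_on_integrable_sq[OF Vf_D(3)[OF P e]] by auto
        fix x assume "x \<in> space (leb (len e))"
        then have "\<bar>\<alpha> e x\<bar> \<le> Ca" using Ca e by simp
        then have "\<alpha> e x \<le> \<bar>Ca\<bar>" by (rule order_trans[OF abs_ge_self order_trans[OF _ abs_ge_self]])
        then show "\<alpha> e x * snd P e x * snd P e x \<le> \<bar>Ca\<bar> * (snd P e x)\<^sup>2"
          by (simp add: power2_eq_square mult.assoc mult_right_mono)
      qed
      then show ?thesis by (simp add: W_def ip2_def power2_eq_square)
    qed
    have t2: "ip2 (len e) (\<lambda>x. (\<kappa> e x)\<^sup>2 * fst P e x) (fst P e) \<le> \<bar>Ck\<bar> * U e" if e: "e \<in> arcs G" for e
    proof -
      have "ip2 (len e) (\<lambda>x. (\<kappa> e x)\<^sup>2 * fst P e x) (fst P e) \<le> integral\<^sup>L (leb (len e)) (\<lambda>x. \<bar>Ck\<bar> * (fst P e x)\<^sup>2)"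
        unfolding ip2_def
      proof (rule integral_mono_AE)
        show "integrable (leb (len e)) (\<lambda>x. (\<kappa> e x)\<^sup>2 * fst P e x * fst P e x)"
          using L2_on_mult_integrable[OF \<kappa>2_L2[OF e Vf_D(2)[OF P e]] Vf_D(2)[OF P e]] .
        show "integrable (leb (len e)) (\<lambda>x. \<bar>Ck\<bar> * (fst P e x)\<^sup>2)"
          using L2_on_integrable_sq[OF Vf_D(2)[OF P e]] by auto
        have "AE x in leb (len e). (\<kappa> e x)\<^sup>2 \<le> Ck" using Ck e by blast
        then show "AE x in leb (len e). (\<kappa> e x)\<^sup>2 * fst P e x * fst P e x \<le> \<bar>Ck\<bar> * (fst P e x)\<^sup>2"
        proof eventually_elim
          case (elim x)
          then have "(\<kappa> e x)\<^sup>2 \<le> \<bar>Ck\<bar>" by simp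
          then show ?case by (simp add: power2_eq_square[of "fst P e x"] mult.assoc mult_right_mono)
        qed
      qed
      then show ?thesis by (simp add: U_def ip2_def power2_eq_square)
    qed
    have "(\<Sum>v\<in>verts G. - vf v (bval (fst P) v) (bval (fst P) v)) \<le> (\<Sum>v\<in>verts G. M * dotn (deg G v) (bval (fst P) v) (bval (fst P) v))"
    proof (rule sum_mono)
      fix v assume v: "v \<in> verts G"
      let ?x = "bval (fst P) v"
      have d0: "0 \<le> dotn (deg G v) ?x ?x" unfolding dotn_def by (intro sum_nonneg) auto
      have "- vf v ?x ?x \<le> \<bar>vf v ?x ?x\<bar>" by simp
      also have "\<dots> \<le> Cv v * dotn (deg G v) ?x ?x"
        using Cv(1)[OF v Vf_D(4)[OF P v] Vf_D(4)[OF P v]] d0 by simp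
      also have "\<dots> \<le> M * dotn (deg G v) ?x ?x" using M[OF v] d0 by (intro mult_right_mono)
      finally show "- vf v ?x ?x \<le> M * dotn (deg G v) ?x ?x" .
    qed
    also have "\<dots> = M * (\<Sum>e\<in>arcs G. fst P e 0 * fst P e 0 + fst P e (len e) * fst P e (len e))"
      by (simp add: dotn_bval sum_distrib_left[symmetric])
    also have "\<dots> \<le> M * (\<Sum>e\<in>arcs G. T * (U e + W e))"
    proof (intro mult_left_mono[OF _ M0] sum_mono)
      fix e assume e: "e \<in> arcs G"
      have le: "0 < len e" by (rule fin(4)[OF e])
      have "fst P e 0 * fst P e 0 + fst P e (len e) * fst P e (len e) \<le> 2 * (2 / len e * U e + len e * W e)"
        using H1rep_trace[OF Vf_D(1)[OF P e] le order_refl] by (simp add: U_def W_def power2_eq_square)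
      also have "\<dots> = 4 / len e * U e + 2 * len e * W e" by simp
      also have "\<dots> \<le> T * U e + T * W e"
        using Te[OF e] le UW[of e] by (intro add_mono mult_right_mono) (auto intro: order_trans[rotated])
      finally show "fst P e 0 * fst P e 0 + fst P e (len e) * fst P e (len e) \<le> T * (U e + W e)"
        by (simp add: distrib_left)
    qed
    finally have vb: "- (\<Sum>v\<in>verts G. vf v (bval (fst P) v) (bval (fst P) v)) \<le> M * T * (\<Sum>e\<in>arcs G. U e + W e)"
      by (simp add: sum_negf sum_distrib_left[symmetric] mult.assoc)
    have "(\<Sum>e\<in>arcs G. ip2 (len e) (\<lambda>x. \<alpha> e x * snd P e x) (snd P e) + ip2 (len e) (\<lambda>x. (\<kappa> e x)\<^sup>2 * fst P e x) (fst P e))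
        \<le> (\<Sum>e\<in>arcs G. (\<bar>Ca\<bar> + \<bar>Ck\<bar>) * (U e + W e))"
    proof (rule sum_mono)
      fix e assume e: "e \<in> arcs G"
      have "0 \<le> \<bar>Ca\<bar> * U e" "0 \<le> \<bar>Ck\<bar> * W e" using UW by auto
      then show "ip2 (len e) (\<lambda>x. \<alpha> e x * snd P e x) (snd P e) + ip2 (len e) (\<lambda>x. (\<kappa> e x)\<^sup>2 * fst P e x) (fst P e)
          \<le> (\<bar>Ca\<bar> + \<bar>Ck\<bar>) * (U e + W e)"
        using t1[OF e] t2[OF e] by (simp add: algebra_simps)
    qed
    then show ?thesis
      using vb unfolding qf_def C_def NV_def U_def[symmetric] W_def[symmetric]
      by (simp add: sum_distrib_left[symmetric] distrib_right)
  qed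
  moreover have "0 \<le> C" unfolding C_def using M0 T0 by simp
  ultimately show ?thesis by blast
qed

lemma vanishing_boundary_in_Vf:
  assumes "\<And>e. e \<in> arcs G \<Longrightarrow> H1rep (len e) (u e) (g e)" "\<And>e. e \<in> arcs G \<Longrightarrow> u e 0 = 0 \<and> u e (len e) = 0"
  shows "(u, g) \<in> Vf" "v \<in> verts G \<Longrightarrow> i < deg G v \<Longrightarrow> bval u v i = 0"
proof -
  show z: "bval u v i = 0" if "v \<in> verts G" "i < deg G v" for v i
  proof -
    have "enum v i \<in> edge_ends G v" using enum that by (auto dest: bij_betwE)
    then have "fst (enum v i) \<in> arcs G" by (auto simp: edge_ends_def split: prod.splits)
    then show ?thesis using assms(2) by (auto simp: bval_def ev_def)
  qed
  have "bvec u v \<in> Rv v" if v: "v \<in> verts G" for v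
  proof -
    have "bvec u v = Matrix.vec (deg G v) (0 :: nat \<Rightarrow> real)" using z[OF v] by (intro eq_vecI) auto
    then show ?thesis using real_vector.subspace_0[OF vertex_conditions.R_subspace[OF vc[OF v]]] by simp
  qed
  then show "(u, g) \<in> Vf" unfolding Vf_def using assms(1) by auto
qed

end

text \<open>Subsequences are refined one edge at a time. The assumption speaks of every subsequence
  \<open>s\<close>, so extraction on a new edge can start from the one already found, and the
  earlier uniform limits persist.\<close>

lemma finite_common_subsequence:
  fixes u :: "nat \<Rightarrow> 'e \<Rightarrow> real \<Rightarrow> real"
  assumes "finite E"
    and ex: "\<And>e s. \<lbrakk>e \<in> E; strict_mono (s :: nat \<Rightarrow> nat)\<rbrakk> \<Longrightarrow>
      \<exists>r w. strict_mono (r :: nat \<Rightarrow> nat) \<and> uniform_limit (X e) (\<lambda>n. u (s (r n)) e) w sequentially"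
  shows "\<exists>r. strict_mono (r :: nat \<Rightarrow> nat) \<and> (\<forall>e\<in>E. \<exists>w. uniform_limit (X e) (\<lambda>n. u (r n) e) w sequentially)"
  using assms
proof (induction E)
  case empty
  show ?case by (rule exI[of _ id]) (auto simp: strict_mono_def)
next
  case (insert e E)
  have "\<exists>r. strict_mono (r :: nat \<Rightarrow> nat) \<and> (\<forall>e\<in>E. \<exists>w. uniform_limit (X e) (\<lambda>n. u (r n) e) w sequentially)"
    by (rule insert.IH) (rule insert.prems, auto)
  then obtain s :: "nat \<Rightarrow> nat" where s: "strict_mono s"
    "\<forall>e\<in>E. \<exists>w. uniform_limit (X e) (\<lambda>n. u (s n) e) w sequentially" by blast
  obtain r :: "nat \<Rightarrow> nat" and w where r: "strict_mono r" "uniform_limit (X e) (\<lambda>n. u (s (r n)) e) w sequentially"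
    using insert.prems[of e s] s(1) by blast
  have "strict_mono (s \<circ> r)" using s(1) r(1) by (rule strict_mono_o)
  moreover have "\<exists>w. uniform_limit (X e') (\<lambda>n. u ((s \<circ> r) n) e') w sequentially" if "e' \<in> insert e E" for e'
  proof (cases "e' = e")
    case True
    then show ?thesis using r(2) by auto
  next
    case False
    then have "e' \<in> E" using that by simp
    with s(2) obtain w' where w': "uniform_limit (X e') (\<lambda>n. u (s n) e') w' sequentially" by blast
    have "filterlim r sequentially sequentially" by (rule filterlim_subseq[OF r(1)])
    from filterlim_compose[OF w' this] show ?thesis by auto
  qed
  ultimately show ?case by blast
qed

section \<open>Coercivity, completeness and compactness of the form\<close>

locale coercive_graph = quantum_graph G len enum a a0 \<kappa> \<kappa>0 A B
  for G :: "('v,'e) pre_digraph" and len enum a a0 \<kappa> \<kappa>0 A B +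
  fixes S :: real
  assumes S_def: "S = Max ((\<lambda>v. Lam_norm (A v) (B v)) ` verts G)"
    and A1_or_A2: "(4 * S / Min (len ` arcs G) < \<kappa>0\<^sup>2 \<and> 2 * S * Max (len ` arcs G) \<le> a0) \<or>
           (\<forall>v\<in>verts G. Lam_nonpos (A v) (B v))"
begin

lemma Lam_le_S: "v \<in> verts G \<Longrightarrow> Lam_norm (A v) (B v) \<le> S"
  unfolding S_def using fin(2) by (intro Max_ge) auto

lemma S_nonneg: "0 \<le> S"
proof -
  obtain e where "e \<in> arcs G" using fin(3) by blast
  then have v: "tail G e \<in> verts G" by (rule fin(5))
  show ?thesis using vertex_conditions.Lam_norm_nonneg[OF vc[OF v]] Lam_le_S[OF v] by simp
qed

lemma a_term_ge:
  assumes e: "e \<in> arcs G" and g: "L2_on (len e) g"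
  shows "a0 * ip2 (len e) g g \<le> ip2 (len e) (\<lambda>x. \<alpha> e x * g x) g"
proof -
  have "integral\<^sup>L (leb (len e)) (\<lambda>x. a0 * (g x)\<^sup>2) \<le> ip2 (len e) (\<lambda>x. \<alpha> e x * g x) g"
    unfolding ip2_def
  proof (rule integral_mono)
    show "integrable (leb (len e)) (\<lambda>x. a0 * (g x)\<^sup>2)" using L2_on_integrable_sq[OF g] by auto
    show "integrable (leb (len e)) (\<lambda>x. \<alpha> e x * g x * g x)" by (rule L2_on_mult_integrable[OF \<alpha>_L2[OF e g] g])
    show "a0 * (g x)\<^sup>2 \<le> \<alpha> e x * g x * g x" if "x \<in> space (leb (len e))" for x
      using \<alpha>_ge[OF e, of x] that by (simp add: power2_eq_square mult.assoc mult_right_mono)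
  qed
  then show ?thesis by (simp add: ip2_def power2_eq_square)
qed

lemma kappa_term_ge:
  assumes e: "e \<in> arcs G" and u: "L2_on (len e) u"
  shows "\<kappa>0\<^sup>2 * ip2 (len e) u u \<le> ip2 (len e) (\<lambda>x. (\<kappa> e x)\<^sup>2 * u x) u"
proof -
  have "integral\<^sup>L (leb (len e)) (\<lambda>x. \<kappa>0\<^sup>2 * (u x)\<^sup>2) \<le> ip2 (len e) (\<lambda>x. (\<kappa> e x)\<^sup>2 * u x) u"
    unfolding ip2_def
  proof (rule integral_mono_AE)
    show "integrable (leb (len e)) (\<lambda>x. \<kappa>0\<^sup>2 * (u x)\<^sup>2)" using L2_on_integrable_sq[OF u] by auto
    show "integrable (leb (len e)) (\<lambda>x. (\<kappa> e x)\<^sup>2 * u x * u x)" by (rule L2_on_mult_integrable[OF \<kappa>2_L2[OF e u] u])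
    have "AE x in leb (len e). \<kappa>0 \<le> \<kappa> e x" using kappa_ge e by blast
    then show "AE x in leb (len e). \<kappa>0\<^sup>2 * (u x)\<^sup>2 \<le> (\<kappa> e x)\<^sup>2 * u x * u x"
    proof eventually_elim
      case (elim x)
      then have "\<kappa>0\<^sup>2 \<le> (\<kappa> e x)\<^sup>2" using kappa_pos by (intro power_mono) auto
      then show ?case by (simp add: power2_eq_square[of "u x"] mult.assoc mult_right_mono)
    qed
  qed
  then show ?thesis by (simp add: ip2_def power2_eq_square)
qed

text \<open>Under (A1) the trace inequality is used on a subinterval of relative length \<open>\<theta> < 1\<close>; the strict
  inequality for \<open>\<kappa>\<^sub>0\<close> leaves room for such a \<open>\<theta>\<close>, which makes the gradient term strictly positive.\<close>

lemma qf_lower: "\<exists>\<delta>>0. \<forall>P\<in>Vf. \<delta> * NV P \<le> qf P P"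
proof -
  \<comment> \<open>The common outcome of (A1) and (A2): the vertex terms are dominated with
    coefficients strictly below \<open>\<kappa>0\<^sup>2\<close> and \<open>a0\<close>, and the
    smaller of the two gaps becomes \<open>\<delta>\<close>. Under (A2) both coefficients are
    0.\<close>
  have "\<exists>c1 c2. c1 < \<kappa>0\<^sup>2 \<and> c2 < a0 \<and> (\<forall>P\<in>Vf. (\<Sum>v\<in>verts G. vf v (bval (fst P) v) (bval (fst P) v))
      \<le> (\<Sum>e\<in>arcs G. c1 * ip2 (len e) (fst P e) (fst P e) + c2 * ip2 (len e) (snd P e) (snd P e)))"
    using A1_or_A2
  proof
    assume A2: "\<forall>v\<in>verts G. Lam_nonpos (A v) (B v)"
    have "(\<Sum>v\<in>verts G. vf v (bval (fst P) v) (bval (fst P) v)) \<le> 0" if "P \<in> Vf" for P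
      using A2 vertex_conditions.vform_nonpos[OF vc] Vf_D(4)[OF that] by (intro sum_nonpos) auto
    then show ?thesis using kappa_pos a0_pos by (intro exI[of _ 0]) auto
  next
    assume A1: "4 * S / Min (len ` arcs G) < \<kappa>0\<^sup>2 \<and> 2 * S * Max (len ` arcs G) \<le> a0"
    define Lm where "Lm = Min (len ` arcs G)"
    define LM where "LM = Max (len ` arcs G)"
    have Lm0: "0 < Lm" unfolding Lm_def using fin by (subst Min_gr_iff) auto
    have Lmm: "Lm \<le> len e" "len e \<le> LM" if "e \<in> arcs G" for e
      unfolding Lm_def LM_def using that fin(1) by (auto intro: Min_le Max_ge)
    obtain e0 where "e0 \<in> arcs G" using fin(3) by blast
    then have LM0: "0 < LM" using Lmm[of e0] Lm0 by linarith
    \<comment> \<open>\<open>r\<close> is the quotient of the two sides of the first inequality of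
      (A1), so \<open>r < 1\<close>. With \<open>\<theta>\<close> halfway between \<open>r\<close>
      and 1, the bound \<open>r < \<theta>\<close> keeps \<open>c1\<close> below
      \<open>\<kappa>0\<^sup>2\<close> while \<open>\<theta> < 1\<close> brings \<open>c2\<close>
      below \<open>a0\<close>.\<close>
    define r where "r = 4 * S / (Lm * \<kappa>0\<^sup>2)"
    have r: "0 \<le> r" "r < 1"
      using A1 S_nonneg Lm0 kappa_pos unfolding r_def Lm_def[symmetric] by (auto simp: field_simps)
    define \<theta> where "\<theta> = (1 + r) / 2"
    have \<theta>: "0 < \<theta>" "\<theta> < 1" "r < \<theta>" using r unfolding \<theta>_def by auto
    define c1 where "c1 = 4 * S / (\<theta> * Lm)"
    define c2 where "c2 = 2 * S * (\<theta> * LM)"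
    have c1: "c1 < \<kappa>0\<^sup>2"
    proof -
      have "c1 = r * \<kappa>0\<^sup>2 / \<theta>" unfolding c1_def r_def using \<theta> Lm0 kappa_pos by (simp add: field_simps)
      also have "\<dots> < \<kappa>0\<^sup>2" using \<theta> kappa_pos by (simp add: field_simps)
      finally show ?thesis .
    qed
    have c2: "c2 < a0"
    \<comment> \<open>For \<open>S = 0\<close> the factor \<open>\<theta>\<close> gains nothing, but
      then \<open>c2 = 0\<close>.\<close>
    proof (cases "S = 0")
      case True then show ?thesis using a0_pos by (simp add: c2_def)
    next
      case False
      then have "0 < 2 * S * LM" using S_nonneg LM0 by simp
      then have "\<theta> * (2 * S * LM) < 1 * (2 * S * LM)" using \<theta> by (intro mult_strict_right_mono)
      then show ?thesis using A1 unfolding c2_def LM_def[symmetric] by (simp add: mult_ac)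
    qed
    have "(\<Sum>v\<in>verts G. vf v (bval (fst P) v) (bval (fst P) v))
      \<le> (\<Sum>e\<in>arcs G. c1 * ip2 (len e) (fst P e) (fst P e) + c2 * ip2 (len e) (snd P e) (snd P e))" if P: "P \<in> Vf" for P
    proof -
      have "(\<Sum>v\<in>verts G. vf v (bval (fst P) v) (bval (fst P) v)) \<le> (\<Sum>v\<in>verts G. S * dotn (deg G v) (bval (fst P) v) (bval (fst P) v))"
      proof (rule sum_mono)
        fix v assume v: "v \<in> verts G"
        let ?x = "bval (fst P) v"
        have d0: "0 \<le> dotn (deg G v) ?x ?x" unfolding dotn_def by (intro sum_nonneg) auto
        have "vf v ?x ?x \<le> Lam_norm (A v) (B v) * dotn (deg G v) ?x ?x"
          by (rule vertex_conditions.vform_le_Lam_norm[OF vc[OF v] Vf_D(4)[OF P v]])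
        also have "\<dots> \<le> S * dotn (deg G v) ?x ?x" using Lam_le_S[OF v] d0 by (rule mult_right_mono)
        finally show "vf v ?x ?x \<le> S * dotn (deg G v) ?x ?x" .
      qed
      also have "\<dots> = (\<Sum>e\<in>arcs G. S * ((fst P e 0)\<^sup>2 + (fst P e (len e))\<^sup>2))"
        by (simp add: dotn_bval sum_distrib_left[symmetric] power2_eq_square)
      also have "\<dots> \<le> (\<Sum>e\<in>arcs G. c1 * ip2 (len e) (fst P e) (fst P e) + c2 * ip2 (len e) (snd P e) (snd P e))"
      proof (rule sum_mono)
        fix e assume e: "e \<in> arcs G"
        define U where "U = ip2 (len e) (fst P e) (fst P e)"
        define W where "W = ip2 (len e) (snd P e) (snd P e)"
        have UW: "0 \<le> U" "0 \<le> W" by (auto simp: U_def W_def ip2_def)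
        define s where "s = \<theta> * len e"
        have s: "0 < s" "s \<le> len e" using \<theta> fin(4)[OF e] unfolding s_def by (auto simp: mult_le_cancel_right1)
        have "(fst P e 0)\<^sup>2 + (fst P e (len e))\<^sup>2 \<le> 2 * (2 / s * U + s * W)"
          using H1rep_trace[OF Vf_D(1)[OF P e] s] by (simp add: U_def W_def)
        then have "S * ((fst P e 0)\<^sup>2 + (fst P e (len e))\<^sup>2) \<le> S * (2 * (2 / s * U + s * W))"
          using S_nonneg by (intro mult_left_mono)
        also have "\<dots> = 4 * S / s * U + 2 * S * s * W" using s by (simp add: field_simps)
        also have "\<dots> \<le> c1 * U + c2 * W"
        proof (intro add_mono mult_right_mono UW)
          show "4 * S / s \<le> c1"
            unfolding c1_def s_def using S_nonneg \<theta> Lm0 Lmm[OF e] fin(4)[OF e]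
            by (intro divide_left_mono mult_left_mono mult_pos_pos) auto
          show "2 * S * s \<le> c2"
            unfolding c2_def s_def using S_nonneg \<theta> Lmm[OF e] by (intro mult_left_mono) auto
        qed
        finally show "S * ((fst P e 0)\<^sup>2 + (fst P e (len e))\<^sup>2)
            \<le> c1 * ip2 (len e) (fst P e) (fst P e) + c2 * ip2 (len e) (snd P e) (snd P e)"
          unfolding U_def W_def .
      qed
      finally show ?thesis .
    qed
    then show ?thesis using c1 c2 by blast
  qed
  then obtain c1 c2 where c: "c1 < \<kappa>0\<^sup>2" "c2 < a0" "\<And>P. P \<in> Vf \<Longrightarrow> (\<Sum>v\<in>verts G. vf v (bval (fst P) v) (bval (fst P) v))
      \<le> (\<Sum>e\<in>arcs G. c1 * ip2 (len e) (fst P e) (fst P e) + c2 * ip2 (len e) (snd P e) (snd P e))" by blast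
  define \<delta> where "\<delta> = min (\<kappa>0\<^sup>2 - c1) (a0 - c2)"
  have "\<delta> * NV P \<le> qf P P" if P: "P \<in> Vf" for P
  proof -
    have "\<delta> * NV P + (\<Sum>e\<in>arcs G. c1 * ip2 (len e) (fst P e) (fst P e) + c2 * ip2 (len e) (snd P e) (snd P e))
      = (\<Sum>e\<in>arcs G. \<delta> * (ip2 (len e) (fst P e) (fst P e) + ip2 (len e) (snd P e) (snd P e)) +
          (c1 * ip2 (len e) (fst P e) (fst P e) + c2 * ip2 (len e) (snd P e) (snd P e)))"
      unfolding NV_def sum_distrib_left sum.distrib[symmetric] ..
    also have "\<dots> \<le> (\<Sum>e\<in>arcs G. ip2 (len e) (\<lambda>x. \<alpha> e x * snd P e x) (snd P e)
        + ip2 (len e) (\<lambda>x. (\<kappa> e x)\<^sup>2 * fst P e x) (fst P e))"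
    proof (rule sum_mono)
      fix e assume e: "e \<in> arcs G"
      define U where "U = ip2 (len e) (fst P e) (fst P e)"
      define W where "W = ip2 (len e) (snd P e) (snd P e)"
      have UW: "0 \<le> U" "0 \<le> W" by (auto simp: U_def W_def ip2_def)
      have "(\<delta> + c1) * U \<le> \<kappa>0\<^sup>2 * U" "(\<delta> + c2) * W \<le> a0 * W"
        using UW by (auto simp: \<delta>_def intro!: mult_right_mono)
      then show "\<delta> * (ip2 (len e) (fst P e) (fst P e) + ip2 (len e) (snd P e) (snd P e)) +
          (c1 * ip2 (len e) (fst P e) (fst P e) + c2 * ip2 (len e) (snd P e) (snd P e))
          \<le> ip2 (len e) (\<lambda>x. \<alpha> e x * snd P e x) (snd P e) + ip2 (len e) (\<lambda>x. (\<kappa> e x)\<^sup>2 * fst P e x) (fst P e)"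
        using a_term_ge[OF e Vf_D(3)[OF P e]] kappa_term_ge[OF e Vf_D(2)[OF P e]]
        unfolding U_def[symmetric] W_def[symmetric] by (simp add: distrib_left distrib_right)
    qed
    finally show ?thesis using c(3)[OF P] unfolding qf_def by linarith
  qed
  moreover have "\<delta> > 0" unfolding \<delta>_def using c by simp
  ultimately show ?thesis by blast
qed

lemma NV_nonneg: "0 \<le> NV P"
  unfolding NV_def by (intro sum_nonneg) (auto simp: ip2_def)

lemma ipV_le_NV: "ipV P P \<le> NV P"
  unfolding ipV_def ipG_eq NV_def by (intro sum_mono) (auto simp: ip2_def)

lemma qf_semi_inner: "semi_inner Vf qf"
proof -
  obtain \<delta> where \<delta>: "\<delta> > 0" "\<forall>P\<in>Vf. \<delta> * NV P \<le> qf P P" using qf_lower by blast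
  show ?thesis
  proof
    show "0 \<le> qf P P" if "P \<in> Vf" for P
      using \<delta> that NV_nonneg[of P] by (meson less_imp_le mult_nonneg_nonneg order_trans)
  qed (use Vf_subspace qf_bilinear in auto)
qed

lemma Vf_trace:
  assumes P: "P \<in> Vf" and e: "e \<in> arcs G"
  shows "(fst P e 0)\<^sup>2 \<le> (2 / len e + len e) * NV P"
proof -
  have le: "0 < len e" by (rule fin(4)[OF e])
  have "(fst P e 0)\<^sup>2 \<le> 2 / len e * ip2 (len e) (fst P e) (fst P e) + len e * ip2 (len e) (snd P e) (snd P e)"
    by (rule H1rep_trace(1)[OF Vf_D(1)[OF P e] le order_refl])
  also have "\<dots> \<le> 2 / len e * NV P + len e * NV P"
    using le NV_ge[OF e] by (intro add_mono mult_left_mono) auto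
  finally show ?thesis by (simp add: distrib_right)
qed

text \<open>The limit is assembled from the L2 limit of the derivatives and the limit of the values
  at 0, so it is a primitive by construction. The Hoelder bound then gives convergence at every
  point of an edge, which carries the boundary vectors into the closed spaces
  \<open>Rv v\<close>.\<close>

lemma qf_complete: "complete_semi_inner Vf qf"
proof -
  obtain \<delta> where \<delta>: "\<delta> > 0" "\<forall>P\<in>Vf. \<delta> * NV P \<le> qf P P" using qf_lower by blast
  obtain C where C: "C \<ge> 0" "\<forall>P\<in>Vf. qf P P \<le> C * NV P" using qf_upper by blast
  interpret semi_inner Vf qf by (rule qf_semi_inner)
  show ?thesis
  proof
    fix f :: "nat \<Rightarrow> ('e \<Rightarrow> real \<Rightarrow> real) \<times> ('e \<Rightarrow> real \<Rightarrow> real)"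
    assume f: "\<And>n. f n \<in> Vf" and Cq: "\<And>e. 0 < e \<Longrightarrow> \<exists>N. \<forall>m\<ge>N. \<forall>n\<ge>N. qf (f m - f n) (f m - f n) < e"
    have CN: "\<exists>N. \<forall>m\<ge>N. \<forall>n\<ge>N. NV (f m - f n) < \<epsilon>" if \<epsilon>: "0 < \<epsilon>" for \<epsilon>
    proof -
      have "0 < \<delta> * \<epsilon>" using \<delta>(1) \<epsilon> by simp
      from Cq[OF this] obtain N where N: "\<forall>m\<ge>N. \<forall>n\<ge>N. qf (f m - f n) (f m - f n) < \<delta> * \<epsilon>" by blast
      have "NV (f m - f n) < \<epsilon>" if "m \<ge> N" "n \<ge> N" for m n
      proof -
        have "\<delta> * NV (f m - f n) < \<delta> * \<epsilon>"
          using \<delta>(2) mem(4)[OF f f, of m n] N that by (meson le_less_trans)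
        then show ?thesis using \<delta>(1) by simp
      qed
      then show ?thesis by blast
    qed
    have "\<exists>c g. L2_on (len e) g \<and> (\<lambda>n. fst (f n) e 0) \<longlonglongrightarrow> c \<and>
        (\<lambda>n. ip2 (len e) (snd (f n) e - g) (snd (f n) e - g)) \<longlonglongrightarrow> 0" if e: "e \<in> arcs G" for e
    proof -
      interpret e: complete_semi_inner "{u. L2_on (len e) u}" "ip2 (len e)" by (rule ip2_complete)
      have "\<exists>x\<in>{u. L2_on (len e) u}. (\<lambda>n. ip2 (len e) (snd (f n) e - x) (snd (f n) e - x)) \<longlonglongrightarrow> 0"
      proof (rule e.complete)
        show "snd (f n) e \<in> {u. L2_on (len e) u}" for n using Vf_D(3)[OF f e] by simp
        fix \<epsilon> :: real assume "0 < \<epsilon>"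
        then obtain N where N: "\<forall>m\<ge>N. \<forall>n\<ge>N. NV (f m - f n) < \<epsilon>" using CN by blast
        have "ip2 (len e) (snd (f m) e - snd (f n) e) (snd (f m) e - snd (f n) e) \<le> NV (f m - f n)" for m n
          using NV_ge(2)[OF e, of "f m - f n"] by (simp add: snd_diff)
        then show "\<exists>N. \<forall>m\<ge>N. \<forall>n\<ge>N. ip2 (len e) (snd (f m) e - snd (f n) e) (snd (f m) e - snd (f n) e) < \<epsilon>"
          using N le_less_trans by blast
      qed
      then obtain g where g: "L2_on (len e) g" "(\<lambda>n. ip2 (len e) (snd (f n) e - g) (snd (f n) e - g)) \<longlonglongrightarrow> 0" by blast
      have "Cauchy (\<lambda>n. fst (f n) e 0)"
      proof (rule metric_CauchyI)
        fix \<epsilon> :: real assume \<epsilon>: "0 < \<epsilon>"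
        define T where "T = 2 / len e + len e"
        have T: "0 < T" unfolding T_def using fin(4)[OF e] by (intro add_pos_pos divide_pos_pos) auto
        then have "0 < \<epsilon>\<^sup>2 / T" using \<epsilon> by simp
        then obtain N where N: "\<forall>m\<ge>N. \<forall>n\<ge>N. NV (f m - f n) < \<epsilon>\<^sup>2 / T" using CN by blast
        have "dist (fst (f m) e 0) (fst (f n) e 0) < \<epsilon>" if "m \<ge> N" "n \<ge> N" for m n
        proof -
          have "(fst (f m) e 0 - fst (f n) e 0)\<^sup>2 \<le> T * NV (f m - f n)"
            using Vf_trace[OF mem(4)[OF f f, of m n] e] by (simp add: T_def fst_diff)
          also have "\<dots> < T * (\<epsilon>\<^sup>2 / T)" using N that T by (intro mult_strict_left_mono) auto
          finally have "(fst (f m) e 0 - fst (f n) e 0)\<^sup>2 < \<epsilon>\<^sup>2" using T by simp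
          then show ?thesis using \<epsilon> unfolding dist_real_def
            by (metis power2_abs power2_less_imp_less less_imp_le)
        qed
        then show "\<exists>M. \<forall>m\<ge>M. \<forall>n\<ge>M. dist (fst (f m) e 0) (fst (f n) e 0) < \<epsilon>" by blast
      qed
      then obtain c where "(\<lambda>n. fst (f n) e 0) \<longlonglongrightarrow> c" using Cauchy_convergent_iff convergent_def by blast
      then show ?thesis using g by blast
    qed
    then have "\<forall>e. \<exists>cg. e \<in> arcs G \<longrightarrow> L2_on (len e) (snd cg) \<and> (\<lambda>n. fst (f n) e 0) \<longlonglongrightarrow> fst cg \<and>
        (\<lambda>n. ip2 (len e) (snd (f n) e - snd cg) (snd (f n) e - snd cg)) \<longlonglongrightarrow> 0" by simp
    from choice[OF this] obtain cg where cg: "\<forall>e. e \<in> arcs G \<longrightarrow> L2_on (len e) (snd (cg e)) \<and>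
        (\<lambda>n. fst (f n) e 0) \<longlonglongrightarrow> fst (cg e) \<and>
        (\<lambda>n. ip2 (len e) (snd (f n) e - snd (cg e)) (snd (f n) e - snd (cg e))) \<longlonglongrightarrow> 0" by blast
    define g where "g e = snd (cg e)" for e
    define u where "u e x = fst (cg e) + integral {0..x} (g e)" for e x
    have g: "L2_on (len e) (g e)" "(\<lambda>n. fst (f n) e 0 - u e 0) \<longlonglongrightarrow> 0"
      "(\<lambda>n. ip2 (len e) (snd (f n) e - g e) (snd (f n) e - g e)) \<longlonglongrightarrow> 0" if "e \<in> arcs G" for e
    proof -
      have u0: "u e 0 = fst (cg e)" by (simp add: u_def)
      show "L2_on (len e) (g e)" "(\<lambda>n. fst (f n) e 0 - u e 0) \<longlonglongrightarrow> 0"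
        "(\<lambda>n. ip2 (len e) (snd (f n) e - g e) (snd (f n) e - g e)) \<longlonglongrightarrow> 0"
        using cg that unfolding u0 g_def by (auto simp: LIM_zero_iff)
    qed
    have H: "H1rep (len e) (u e) (g e)" if "e \<in> arcs G" for e
      unfolding u_def using H1rep_primitive[OF g(1)[OF that]] .
    have HD: "H1rep (len e) (\<lambda>x. fst (f n) e x - u e x) (snd (f n) e - g e)" if "e \<in> arcs G" for e n
      using H1rep_diff[OF Vf_D(1)[OF f that] H[OF that]] by (simp add: fun_diff_def)
    have pt: "(\<lambda>n. fst (f n) e t) \<longlonglongrightarrow> u e t" if e: "e \<in> arcs G" and t: "t \<in> {0..len e}" for e t
    proof -
      let ?D = "\<lambda>n x. fst (f n) e x - u e x"
      have "(\<lambda>n. ?D n t - ?D n 0) \<longlonglongrightarrow> 0"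
      proof -
        have "(\<lambda>n. (?D n t - ?D n 0)\<^sup>2) \<longlonglongrightarrow> 0"
        proof (rule tendsto_sandwich[OF _ _ tendsto_const])
          show "\<forall>\<^sub>F n in sequentially. (?D n t - ?D n 0)\<^sup>2 \<le> \<bar>t - 0\<bar> * ip2 (len e) (snd (f n) e - g e) (snd (f n) e - g e)"
            using t fin(4)[OF e] by (intro always_eventually allI H1rep_Hoelder[OF HD[OF e]]) auto
          show "(\<lambda>n. \<bar>t - 0\<bar> * ip2 (len e) (snd (f n) e - g e) (snd (f n) e - g e)) \<longlonglongrightarrow> 0"
            using tendsto_mult_right_zero[OF g(3)[OF e]] .
        qed simp
        then show ?thesis by simp
      qed
      from tendsto_add[OF this g(2)[OF e]] show ?thesis by (simp add: LIM_zero_iff)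
    qed
    have PV: "(u, g) \<in> Vf"
    proof -
      have "bvec u v \<in> Rv v" if v: "v \<in> verts G" for v
      proof (rule vertex_conditions.R_closed[OF vc[OF v]])
        show "bvec (fst (f n)) v \<in> Rv v" for n using Vf_D(4)[OF f v] .
        fix i assume i: "i < deg G v"
        have "enum v i \<in> edge_ends G v" using enum v i by (auto dest: bij_betwE)
        then have "fst (enum v i) \<in> arcs G" by (auto simp: edge_ends_def split: prod.splits)
        then show "(\<lambda>n. bval (fst (f n)) v i) \<longlonglongrightarrow> bval u v i"
          unfolding bval_def ev_def using fin(4) by (intro pt) (auto simp: less_imp_le)
      qed
      then show ?thesis unfolding Vf_def using H by auto
    qed
    have "(\<lambda>n. NV (f n - (u, g))) \<longlonglongrightarrow> 0"
    proof -
      have "(\<lambda>n. NV (f n - (u, g))) \<longlonglongrightarrow> (\<Sum>e\<in>arcs G. 0 + 0)"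
        unfolding NV_def
      proof (intro tendsto_sum tendsto_add)
        fix e assume e: "e \<in> arcs G"
        show W: "(\<lambda>n. ip2 (len e) (snd (f n - (u, g)) e) (snd (f n - (u, g)) e)) \<longlonglongrightarrow> 0"
          using g(3)[OF e] by (simp add: snd_diff)
        have D: "fst (f n - (u, g)) e = (\<lambda>x. fst (f n) e x - u e x)" for n by (simp add: fst_diff fun_diff_def)
        show "(\<lambda>n. ip2 (len e) (fst (f n - (u, g)) e) (fst (f n - (u, g)) e)) \<longlonglongrightarrow> 0"
        proof (rule tendsto_sandwich[OF _ _ tendsto_const])
          show "\<forall>\<^sub>F n in sequentially. 0 \<le> ip2 (len e) (fst (f n - (u, g)) e) (fst (f n - (u, g)) e)"
            by (simp add: ip2_def)
          show "\<forall>\<^sub>F n in sequentially. ip2 (len e) (fst (f n - (u, g)) e) (fst (f n - (u, g)) e)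
              \<le> 2 * len e * (fst (f n) e 0 - u e 0)\<^sup>2 + 2 * (len e)\<^sup>2 * ip2 (len e) (snd (f n) e - g e) (snd (f n) e - g e)"
            unfolding D by (intro always_eventually allI H1rep_ip2_le[OF HD[OF e] fin(4)[OF e]])
          have "(\<lambda>n. 2 * len e * (fst (f n) e 0 - u e 0)\<^sup>2 + 2 * (len e)\<^sup>2 * ip2 (len e) (snd (f n) e - g e) (snd (f n) e - g e))
              \<longlonglongrightarrow> 2 * len e * 0\<^sup>2 + 2 * (len e)\<^sup>2 * 0"
            by (intro tendsto_intros g(2,3) e)
          then show "(\<lambda>n. 2 * len e * (fst (f n) e 0 - u e 0)\<^sup>2 + 2 * (len e)\<^sup>2 * ip2 (len e) (snd (f n) e - g e) (snd (f n) e - g e))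
              \<longlonglongrightarrow> 0" by simp
        qed
      qed
      then show ?thesis by simp
    qed
    from tendsto_mult_right_zero[OF this, of C] have lim: "(\<lambda>n. C * NV (f n - (u, g))) \<longlonglongrightarrow> 0" .
    have "(\<lambda>n. qf (f n - (u, g)) (f n - (u, g))) \<longlonglongrightarrow> 0"
    proof (rule tendsto_sandwich[OF _ _ tendsto_const lim])
      show "\<forall>\<^sub>F n in sequentially. 0 \<le> qf (f n - (u, g)) (f n - (u, g))"
        by (intro always_eventually allI nonneg mem f PV)
      show "\<forall>\<^sub>F n in sequentially. qf (f n - (u, g)) (f n - (u, g)) \<le> C * NV (f n - (u, g))"
        using C(2) mem(4)[OF f PV] by (intro always_eventually) auto
    qed
    then show "\<exists>x\<in>Vf. (\<lambda>n. qf (f n - x) (f n - x)) \<longlonglongrightarrow> 0" using PV by blast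
  qed
qed

text \<open>The uniform limit \<open>w\<close> is known only to be continuous, not to lie in
  \<open>Vf\<close>. It is used inside \<open>HG\<close> as a common centre from which the Cauchy
  estimate follows.\<close>

lemma Vf_compact:
  assumes f: "\<And>n. f n \<in> Vf" and K: "\<And>n. qf (f n) (f n) \<le> K"
  shows "\<exists>r. strict_mono (r :: nat \<Rightarrow> nat) \<and>
    (\<forall>e>0. \<exists>N. \<forall>m\<ge>N. \<forall>n\<ge>N. ipV (f (r m) - f (r n)) (f (r m) - f (r n)) < e)"
proof -
  obtain \<delta> where \<delta>: "\<delta> > 0" "\<forall>P\<in>Vf. \<delta> * NV P \<le> qf P P" using qf_lower by blast
  have NK: "NV (f n) \<le> K / \<delta>" for n
  proof -
    have "\<delta> * NV (f n) \<le> K" using \<delta>(2) f K order_trans by blast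
    then show ?thesis using \<delta>(1) by (simp add: field_simps)
  qed
  have "\<exists>r. strict_mono (r :: nat \<Rightarrow> nat) \<and>
      (\<forall>e\<in>arcs G. \<exists>w. uniform_limit {0..len e} (\<lambda>n. fst (f (r n)) e) w sequentially)"
  proof (rule finite_common_subsequence[OF fin(1)])
    fix e and s :: "nat \<Rightarrow> nat" assume e: "e \<in> arcs G"
    define T where "T = 2 / len e + len e"
    have T: "0 < T" unfolding T_def using fin(4)[OF e] by (intro add_pos_pos divide_pos_pos) auto
    define M where "M = max (sqrt (T * (K / \<delta>))) (K / \<delta>)"
    have "\<bar>fst (f (s n)) e 0\<bar> \<le> M" for n
    proof -
      have "(fst (f (s n)) e 0)\<^sup>2 \<le> T * NV (f (s n))" using Vf_trace[OF f e] by (simp add: T_def)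
      also have "\<dots> \<le> T * (K / \<delta>)" using T NK by (intro mult_left_mono) auto
      finally show ?thesis unfolding M_def by (intro max.coboundedI1) (simp add: real_le_rsqrt)
    qed
    moreover have "ip2 (len e) (snd (f (s n)) e) (snd (f (s n)) e) \<le> M" for n
      using NV_ge(2)[OF e, of "f (s n)"] NK[of "s n"] unfolding M_def by (intro max.coboundedI2) linarith
    ultimately obtain w r where "strict_mono (r :: nat \<Rightarrow> nat)"
      "uniform_limit {0..len e} (\<lambda>n. fst (f (s (r n))) e) w sequentially"
      by (rule H1rep_compact[OF Vf_D(1)[OF f e] _ _ fin(4)[OF e]])
    then show "\<exists>r w. strict_mono (r :: nat \<Rightarrow> nat) \<and>
        uniform_limit {0..len e} (\<lambda>n. fst (f (s (r n))) e) w sequentially" by blast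
  qed
  then obtain r :: "nat \<Rightarrow> nat" where r: "strict_mono r"
    "\<forall>e\<in>arcs G. \<exists>w. uniform_limit {0..len e} (\<lambda>n. fst (f (r n)) e) w sequentially" by blast
  then have "\<forall>e. \<exists>w. e \<in> arcs G \<longrightarrow> uniform_limit {0..len e} (\<lambda>n. fst (f (r n)) e) w sequentially" by blast
  from choice[OF this] obtain w where w: "\<And>e. e \<in> arcs G \<Longrightarrow>
    uniform_limit {0..len e} (\<lambda>n. fst (f (r n)) e) (w e) sequentially" by blast
  have wc: "continuous_on {0..len e} (w e)" if e: "e \<in> arcs G" for e
    by (rule uniform_limit_theorem[OF _ w[OF e]])
      (use H1rep_continuous[OF Vf_D(1)[OF f e]] in auto)
  have wH: "w \<in> HG" unfolding HG_iff using continuous_imp_L2_on wc by blast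
  interpret semi_inner HG ipG by (rule ipG_semi_inner)
  have lim: "(\<lambda>n. ipG (fst (f (r n)) - w) (fst (f (r n)) - w)) \<longlonglongrightarrow> 0"
  proof -
    have "(\<lambda>n. ipG (fst (f (r n)) - w) (fst (f (r n)) - w)) \<longlonglongrightarrow> (\<Sum>e\<in>arcs G. 0)"
      unfolding ipG_eq
    proof (rule tendsto_sum)
      fix e assume e: "e \<in> arcs G"
      have le: "0 < len e" by (rule fin(4)[OF e])
      show "(\<lambda>n. ip2 (len e) ((fst (f (r n)) - w) e) ((fst (f (r n)) - w) e)) \<longlonglongrightarrow> 0"
      proof (rule LIMSEQ_I)
        fix \<epsilon> :: real assume \<epsilon>: "0 < \<epsilon>"
        \<comment> \<open>A uniform distance below \<open>\<eta>\<close> costs at most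
          \<open>len e * \<eta>\<^sup>2\<close>, that is \<open>\<epsilon> / 2\<close>, in the
          squared L2 norm.\<close>
        define \<eta> where "\<eta> = sqrt (\<epsilon> / (2 * len e))"
        have \<eta>: "0 < \<eta>" "\<eta>\<^sup>2 = \<epsilon> / (2 * len e)" unfolding \<eta>_def using \<epsilon> le by auto
        from w[OF e, unfolded uniform_limit_sequentially_iff, rule_format, OF \<eta>(1)]
        obtain N where N: "\<And>n x. n \<ge> N \<Longrightarrow> x \<in> {0..len e} \<Longrightarrow> dist (fst (f (r n)) e x) (w e x) < \<eta>" by blast
        have "norm (ip2 (len e) ((fst (f (r n)) - w) e) ((fst (f (r n)) - w) e) - 0) < \<epsilon>" if n: "n \<ge> N" for n
        proof -
          define D where "D = (fst (f (r n)) - w) e"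
          have DL: "L2_on (len e) D" using mem(4)[OF Vf_D(5)[OF f] wH] e unfolding D_def HG_iff by blast
          have "ip2 (len e) D D = integral {0..len e} (\<lambda>x. (D x)\<^sup>2)"
            using ip2_eq_integral[OF DL DL] by (simp add: power2_eq_square)
          also have "\<dots> \<le> integral {0..len e} (\<lambda>x. \<eta>\<^sup>2)"
          proof (rule integral_le)
            show "(\<lambda>x. (D x)\<^sup>2) integrable_on {0..len e}" using L2_on_imp_integrable_on(2)[OF DL, of 0 "len e"] by simp
            show "(\<lambda>x. \<eta>\<^sup>2) integrable_on {0..len e}" by (intro integrable_continuous_real continuous_intros)
            fix x assume "x \<in> {0..len e}"
            then have "\<bar>D x\<bar> < \<eta>" using N[OF n] by (simp add: D_def dist_real_def)
            then show "(D x)\<^sup>2 \<le> \<eta>\<^sup>2" by (metis abs_ge_zero less_imp_le power2_abs power_mono)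
          qed
          also have "\<dots> = \<epsilon> / 2" using le \<eta>(2) by simp
          finally have "ip2 (len e) D D < \<epsilon>" using \<epsilon> by simp
          moreover have "0 \<le> ip2 (len e) D D" by (simp add: ip2_def)
          ultimately show ?thesis unfolding D_def[symmetric] by simp
        qed
        then show "\<exists>N. \<forall>n\<ge>N. norm (ip2 (len e) ((fst (f (r n)) - w) e) ((fst (f (r n)) - w) e) - 0) < \<epsilon>" by blast
      qed
    qed
    then show ?thesis by simp
  qed
  have "\<exists>N. \<forall>m\<ge>N. \<forall>n\<ge>N. ipV (f (r m) - f (r n)) (f (r m) - f (r n)) < \<epsilon>" if \<epsilon>: "0 < \<epsilon>" for \<epsilon>
  proof -
    have "\<forall>\<^sub>F n in sequentially. ipG (fst (f (r n)) - w) (fst (f (r n)) - w) < \<epsilon> / 4"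
      by (rule order_tendstoD(2)[OF lim]) (use \<epsilon> in simp)
    then obtain N where N: "\<And>n. n \<ge> N \<Longrightarrow> ipG (fst (f (r n)) - w) (fst (f (r n)) - w) < \<epsilon> / 4"
      unfolding eventually_sequentially by blast
    have "ipV (f (r m) - f (r n)) (f (r m) - f (r n)) < \<epsilon>" if "m \<ge> N" "n \<ge> N" for m n
    proof -
      have "ipV (f (r m) - f (r n)) (f (r m) - f (r n)) =
          ipG ((fst (f (r m)) - w) - (fst (f (r n)) - w)) ((fst (f (r m)) - w) - (fst (f (r n)) - w))"
        by (simp add: ipV_def fst_diff)
      also have "\<dots> \<le> 2 * ipG (fst (f (r m)) - w) (fst (f (r m)) - w) + 2 * ipG (fst (f (r n)) - w) (fst (f (r n)) - w)"
        by (intro sq_diff_le mem Vf_D(5) f wH)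
      finally show ?thesis using N[OF that(1)] N[OF that(2)] by linarith
    qed
    then show ?thesis by blast
  qed
  then show ?thesis using r(1) by blast
qed

lemma Vf_infinite_dim:
  "\<exists>\<psi>. (\<forall>i. \<psi> i \<in> Vf \<and> 0 < ipV (\<psi> i) (\<psi> i)) \<and> (\<forall>i j. i \<noteq> (j::nat) \<longrightarrow> ipV (\<psi> i) (\<psi> j) = 0)"
proof -
  obtain e0 where e0: "e0 \<in> arcs G" using fin(3) by blast
  define l where "l = len e0"
  have l: "0 < l" unfolding l_def by (rule fin(4)[OF e0])
  \<comment> \<open>The intervals from \<open>l / (i + 2)\<close> to \<open>l / (i + 1)\<close>
    overlap at most in endpoints and leave room for infinitely many tents on one edge. The tents are
    1-Lipschitz and vanish at the ends, hence lie in the form domain.\<close>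
  define s where "s i = l / real (i + 2)" for i
  define t where "t i = l / real (i + 1)" for i
  have st: "0 < s i" "s i < t i" "t i \<le> l" for i
    unfolding s_def t_def using l by (auto simp: field_simps)
  have tm: "t j \<le> s i" if "i < j" for i j
    unfolding s_def t_def using l that by (intro divide_left_mono) auto
  define h where "h i x = max 0 (min (x - s i) (t i - x))" for i x
  have h0: "h i x = 0" if "x \<le> s i \<or> t i \<le> x" for i x using that unfolding h_def by (auto simp: max_def min_def)
  have hlip: "\<bar>h i x - h i y\<bar> \<le> 1 * \<bar>x - y\<bar>" for i x y unfolding h_def by (auto simp: max_def min_def abs_if)
  have "\<forall>i. \<exists>g. H1rep l (h i) g"
  proof
    fix i show "\<exists>g. H1rep l (h i) g" by (rule Lipschitz_imp_H1rep[OF l hlip]) (rule exI)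
  qed
  from choice[OF this] obtain h' where h': "\<And>i. H1rep l (h i) (h' i)" by blast
  define u where "u i = (\<lambda>e. if e = e0 then h i else (\<lambda>x. 0))" for i
  define g where "g i = (\<lambda>e. if e = e0 then h' i else (\<lambda>x. 0))" for i
  have V: "(u i, g i) \<in> Vf" for i
  proof (rule vanishing_boundary_in_Vf)
    show "H1rep (len e) (u i e) (g i e)" for e using h' by (simp add: u_def g_def l_def)
    show "u i e 0 = 0 \<and> u i e (len e) = 0" for e
      using h0[of 0 i] h0[of l i] st[of i] by (auto simp: u_def l_def)
  qed
  have ip: "ipV (u i, g i) (u j, g j) = ip2 l (h i) (h j)" for i j
  proof -
    have "ipV (u i, g i) (u j, g j) = (\<Sum>e\<in>arcs G. if e = e0 then ip2 l (h i) (h j) else 0)"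
      unfolding ipV_def ipG_eq by (intro sum.cong refl) (auto simp: u_def l_def ip2_def)
    then show ?thesis using e0 fin(1) by simp
  qed
  have "0 < ip2 l (h i) (h i)" for i
  proof (rule ccontr)
    have hc: "continuous_on {0..l} (h i)" by (rule H1rep_continuous[OF h'])
    assume "\<not> ?thesis"
    moreover have "0 \<le> ip2 l (h i) (h i)" by (simp add: ip2_def)
    ultimately have "integral {0..l} (\<lambda>x. h i x * h i x) = 0"
      using ip2_eq_integral[of l "h i" "h i"] continuous_imp_L2_on[OF hc] by simp
    then have "\<forall>x\<in>{0..l}. h i x * h i x = 0"
      using l hc by (subst (asm) integral_eq_0_iff) (auto intro!: continuous_intros)
    moreover have "(s i + t i) / 2 \<in> {0..l}" using st[of i] by auto
    ultimately have "h i ((s i + t i) / 2) = 0" by auto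
    moreover have "0 < h i ((s i + t i) / 2)" using st[of i] unfolding h_def by (auto simp: max_def min_def field_simps)
    ultimately show False by simp
  qed
  moreover have "ip2 l (h i) (h j) = 0" if "i \<noteq> j" for i j
  proof -
    have "h i x * h j x = 0" for x
    proof (cases "i < j")
      case True
      then show ?thesis using tm[of i j] h0[of x i] h0[of x j] by (cases "x \<le> s i") auto
    next
      case False
      then have "j < i" using that by simp
      then show ?thesis using tm[of j i] h0[of x i] h0[of x j] by (cases "x \<le> s j") auto
    qed
    then show ?thesis unfolding ip2_def by (simp only: Bochner_Integration.integral_zero)
  qed
  ultimately show ?thesis using V ip by (intro exI[of _ "\<lambda>i. (u i, g i)"]) auto
qed

lemma coercive_form_Vf:
  assumes \<delta>: "0 < \<delta>" "\<And>P. P \<in> Vf \<Longrightarrow> \<delta> * NV P \<le> qf P P"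
  shows "coercive_form Vf ipV qf \<delta>"
proof -
  interpret i: semi_inner Vf ipV by (rule ipV_semi_inner)
  interpret q: complete_semi_inner Vf qf by (rule qf_complete)
  show ?thesis
  proof
    show "\<delta> * ipV P P \<le> qf P P" if "P \<in> Vf" for P
    proof -
      have "\<delta> * ipV P P \<le> \<delta> * NV P" using \<delta>(1) ipV_le_NV by (intro mult_left_mono) auto
      then show ?thesis using \<delta>(2)[OF that] by linarith
    qed
    show "\<exists>r. strict_mono (r :: nat \<Rightarrow> nat) \<and>
        (\<forall>e>0. \<exists>N. \<forall>m\<ge>N. \<forall>n\<ge>N. ipV (f (r m) - f (r n)) (f (r m) - f (r n)) < e)"
      if "\<And>n. f n \<in> Vf" "\<And>n. qf (f n) (f n) \<le> K" for f K
      by (rule Vf_compact[OF that])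
  qed (rule \<delta>(1), rule Vf_infinite_dim)
qed

end

section \<open>Regularity and the eigenbasis\<close>

context quantum_graph
begin

text \<open>At an edge end the coefficient takes its value at the vertex, independently of the edge.
  The boundary terms of integration by parts therefore carry a common weight at each vertex.\<close>

lemma enum_end:
  assumes "v \<in> verts G" "i < deg G v"
  shows "fst (enum v i) \<in> arcs G"
    "a (edge_pt G len (fst (enum v i)) (if snd (enum v i) then len (fst (enum v i)) else 0)) = a (Vertex v)"
proof -
  have m: "enum v i \<in> edge_ends G v" using enum assms by (auto dest: bij_betwE)
  then show e: "fst (enum v i) \<in> arcs G" by (auto simp: edge_ends_def split: prod.splits)
  have "(if snd (enum v i) then head G (fst (enum v i)) else tail G (fst (enum v i))) = v"
    using m by (auto simp: edge_ends_def split: prod.splits)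
  then show "a (edge_pt G len (fst (enum v i)) (if snd (enum v i) then len (fst (enum v i)) else 0)) = a (Vertex v)"
    using fin(4)[OF e] by (auto simp: edge_pt_def split: if_splits)
qed

text \<open>The argument is a derivative along the edge, not the function itself; the sign turns its
  end values into derivatives away from the vertex.\<close>

definition dval :: "('e \<Rightarrow> real \<Rightarrow> real) \<Rightarrow> 'v \<Rightarrow> nat \<Rightarrow> real" where
  "dval w v i = (if snd (enum v i) then -1 else 1) * ev w (enum v i)"

text \<open>Integration by parts on each edge with the flux \<open>\<alpha> e t * D e t\<close>,
  whose derivative is \<open>p e\<close>. The end terms are regrouped by vertices, and the
  orientation sign is absorbed into \<open>dval\<close>.\<close>

lemma Green:
  assumes w: "\<And>e. e \<in> arcs G \<Longrightarrow> H1rep (len e) (\<lambda>t. \<alpha> e t * D e t) (p e)"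
    and h: "\<And>e. e \<in> arcs G \<Longrightarrow> H1rep (len e) (u e) (g e)"
  shows "(\<Sum>e\<in>arcs G. ip2 (len e) (\<lambda>t. \<alpha> e t * D e t) (g e)) =
    - (\<Sum>e\<in>arcs G. ip2 (len e) (p e) (u e)) - (\<Sum>v\<in>verts G. a (Vertex v) * dotn (deg G v) (dval D v) (bval u v))"
proof -
  define f where "f q = (if snd q then -1 else 1) *
      (\<alpha> (fst q) (if snd q then len (fst q) else 0) * ev D q * ev u q)" for q
  have "(\<Sum>v\<in>verts G. a (Vertex v) * dotn (deg G v) (dval D v) (bval u v)) = (\<Sum>v\<in>verts G. \<Sum>i<deg G v. f (enum v i))"
    unfolding dotn_def sum_distrib_left
    by (intro sum.cong refl) (simp add: f_def enum_end(2) dval_def bval_def)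
  also have "\<dots> = (\<Sum>e\<in>arcs G. f (e, False) + f (e, True))" by (rule vertex_sum)
  also have "\<dots> = (\<Sum>e\<in>arcs G. - ip2 (len e) (p e) (u e) - ip2 (len e) (\<lambda>t. \<alpha> e t * D e t) (g e))"
  proof (rule sum.cong[OF refl])
    fix e assume e: "e \<in> arcs G"
    have "0 \<le> len e" using fin(4)[OF e] by simp
    from H1rep_by_parts[OF w[OF e] h[OF e] this]
    show "f (e, False) + f (e, True) = - ip2 (len e) (p e) (u e) - ip2 (len e) (\<lambda>t. \<alpha> e t * D e t) (g e)"
      by (simp add: f_def ev_def)
  qed
  finally show ?thesis by (simp add: sum_subtractf sum_negf)
qed

text \<open>On each edge the end values are interpolated affinely, with value 0 at the ends that do
  not belong to \<open>v\<close>; a loop at \<open>v\<close> receives both of its values from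
  \<open>y\<close>.\<close>

lemma exists_boundary_values:
  assumes v: "v \<in> verts G" and y: "Matrix.vec (deg G v) y \<in> Rv v"
  obtains P where "P \<in> Vf" "\<And>i. i < deg G v \<Longrightarrow> bval (fst P) v i = y i"
    "\<And>v' i. v' \<in> verts G \<Longrightarrow> v' \<noteq> v \<Longrightarrow> i < deg G v' \<Longrightarrow> bval (fst P) v' i = 0"
proof -
  have bij: "bij_betw (enum v) {..<deg G v} (edge_ends G v)" using enum v by blast
  define c where "c q = (if q \<in> edge_ends G v then y (inv_into {..<deg G v} (enum v) q) else 0)" for q
  define u where "u e x = c (e, False) + (c (e, True) - c (e, False)) / len e * x" for e x
  define g where "g e x = (c (e, True) - c (e, False)) / len e" for e and x :: real
  have H: "H1rep (len e) (u e) (g e)" if "e \<in> arcs G" for e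
    unfolding u_def g_def using fin(4)[OF that]
    by (intro H1rep_C1) (auto intro!: derivative_eq_intros continuous_intros)
  have evc: "ev u q = c q" if "fst q \<in> arcs G" for q
    using fin(4)[OF that] by (cases q) (auto simp: ev_def u_def)
  have b1: "bval u v i = y i" if i: "i < deg G v" for i
  proof -
    have "enum v i \<in> edge_ends G v" using bij i by (auto dest: bij_betwE)
    moreover have "inv_into {..<deg G v} (enum v) (enum v i) = i"
      using bij i by (intro inv_into_f_f) (auto simp: bij_betw_def)
    ultimately show ?thesis unfolding bval_def using evc[OF enum_end(1)[OF v i]] by (simp add: c_def)
  qed
  have b0: "bval u v' i = 0" if v': "v' \<in> verts G" "v' \<noteq> v" "i < deg G v'" for v' i
  proof -
    have "enum v' i \<in> edge_ends G v'" using enum v' by (auto dest: bij_betwE)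
    then have "enum v' i \<notin> edge_ends G v" using v'(2)
      by (cases "enum v' i") (auto simp: edge_ends_def split: if_splits)
    then show ?thesis unfolding bval_def using evc[OF enum_end(1)[OF v'(1,3)]] by (simp add: c_def)
  qed
  have "bvec u v' \<in> Rv v'" if v': "v' \<in> verts G" for v'
  proof (cases "v' = v")
    case True
    have "bvec u v = Matrix.vec (deg G v) y" using b1 by (intro eq_vecI) auto
    then show ?thesis using y True by simp
  next
    case False
    have "bvec u v' = Matrix.vec (deg G v') (0 :: nat \<Rightarrow> real)" using b0[OF v' False] by (intro eq_vecI) auto
    then show ?thesis using real_vector.subspace_0[OF vertex_conditions.R_subspace[OF vc[OF v']]] by simp
  qed
  then have "(u, g) \<in> Vf" unfolding Vf_def using H by auto
  then show thesis using that[of "(u, g)"] b1 b0 by simp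
qed

lemma vf_zero_right:
  assumes "v \<in> verts G" "Matrix.vec (deg G v) x \<in> Rv v" "\<And>i. i < deg G v \<Longrightarrow> y i = 0"
  shows "vf v x y = 0"
proof -
  have "vf v x y = vf v x (0 *\<^sub>R 0)"
    by (rule vertex_conditions.vform_cong[OF vc[OF assms(1)]]) (use assms(3) in auto)
  also have "\<dots> = 0 * vf v x 0" by (rule vertex_conditions.vform_right(2)[OF vc[OF assms(1)] assms(2)])
  finally show ?thesis by simp
qed

text \<open>The bridge from the choice-based vectors in the definition of the domain to the values
  of representatives at the ends.\<close>

lemma dom_L_vectors:
  assumes v: "v \<in> verts G"
    and w: "\<And>e. e \<in> arcs G \<Longrightarrow> H1rep (len e) (w e) (D e)" "\<And>e. e \<in> arcs G \<Longrightarrow> H1rep (len e) (D e) (k e)"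
    and u: "\<And>e. e \<in> arcs G \<Longrightarrow> u e \<in> borel_measurable (leb (len e))" "\<And>e. e \<in> arcs G \<Longrightarrow> AE x in leb (len e). u e x = w e x"
  shows "F_vec G len enum u v = bvec w v" "F'_vec G len enum u v = Matrix.vec (deg G v) (dval D v)"
proof -
  have 1: "end_value len u q = ev w q" if e: "fst q \<in> arcs G" for q
    using pt_value_eq[OF H1rep_continuous[OF w(1)[OF e]] u(2)[OF e] fin(4)[OF e]] fin(4)[OF e]
    by (cases q) (auto simp: end_value_def ev_def)
  have 2: "end_deriv len u q = (if snd q then -1 else 1) * ev D q" if e: "fst q \<in> arcs G" for q
    using pt_value_eq[OF H1rep_continuous[OF w(2)[OF e]] wderiv_AE_eq(2)[OF w(1)[OF e] u(1)[OF e] u(2)[OF e] fin(4)[OF e]] fin(4)[OF e]] fin(4)[OF e]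
    by (cases q) (auto simp: end_deriv_def ev_def)
  show "F_vec G len enum u v = bvec w v"
    unfolding F_vec_def bval_def using 1 enum_end(1)[OF v] by (intro eq_vecI) auto
  show "F'_vec G len enum u v = Matrix.vec (deg G v) (dval D v)"
    unfolding F'_vec_def dval_def using 2 enum_end(1)[OF v] by (intro eq_vecI) auto
qed

lemma eigenvector_regular:
  assumes P: "P \<in> Vf" and eig: "\<And>W. W \<in> Vf \<Longrightarrow> qf P W = \<mu> * ipV P W"
  shows "fst P \<in> dom_L G len enum a A B" "ae_eq G len (op_L G len a \<kappa> (fst P)) (\<lambda>e x. \<mu> * fst P e x)"
proof -
  let ?u = "fst P" and ?g = "snd P"
  \<comment> \<open>By the eigenvalue equation this is what the derivative of the flux has to
    be.\<close>
  define h where "h e x = (\<kappa> e x)\<^sup>2 * ?u e x - \<mu> * ?u e x" for e x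
  have uH: "H1rep (len e) (?u e) (?g e)" if "e \<in> arcs G" for e using Vf_D(1)[OF P that] .
  have hL: "L2_on (len e) (h e)" if e: "e \<in> arcs G" for e
    unfolding h_def using \<kappa>2_L2[OF e Vf_D(2)[OF P e]] Vf_D(2)[OF P e] by auto
  have "\<exists>p. H1rep (len e) p (h e) \<and> (AE x in leb (len e). \<alpha> e x * ?g e x = p x)" if e: "e \<in> arcs G" for e
  proof -
    have gL: "L2_on (len e) (?g e)" and uL: "L2_on (len e) (?u e)" using Vf_D[OF P] e by auto
    have "weak_deriv_on (len e) (\<lambda>x. \<alpha> e x * ?g e x) (h e)"
      unfolding weak_deriv_on_def
    proof (intro allI impI)
      fix \<phi> assume t: "test_fun (len e) \<phi>"
      note \<phi> = test_fun_H1rep[OF t]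
      define z where "z = (\<lambda>e'. if e' = e then \<phi> else (\<lambda>x. 0))"
      define dz where "dz = (\<lambda>e'. if e' = e then deriv \<phi> else (\<lambda>x. 0))"
      have H: "H1rep (len e') (z e') (dz e')" for e' using \<phi>(1) by (simp add: z_def dz_def)
      have z0: "z e' 0 = 0 \<and> z e' (len e') = 0" for e' using \<phi>(3,4) by (simp add: z_def)
      have W: "(z, dz) \<in> Vf" by (rule vanishing_boundary_in_Vf[OF H z0])
      have vz: "(\<Sum>v\<in>verts G. vf v (bval ?u v) (bval z v)) = 0"
      proof (rule sum.neutral, rule ballI)
        fix v assume v: "v \<in> verts G"
        show "vf v (bval ?u v) (bval z v) = 0"
          using vanishing_boundary_in_Vf(2)[OF H z0 v] by (intro vf_zero_right[OF v Vf_D(4)[OF P v]])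
      qed
      have "qf P (z, dz) = (\<Sum>e'\<in>arcs G. if e' = e then ip2 (len e) (\<lambda>x. \<alpha> e x * ?g e x) (deriv \<phi>)
          + ip2 (len e) (\<lambda>x. (\<kappa> e x)\<^sup>2 * ?u e x) \<phi> else 0)"
        unfolding qf_def fst_conv snd_conv vz diff_0_right
        by (intro sum.cong refl) (auto simp: z_def dz_def ip2_def)
      also have "\<dots> = ip2 (len e) (\<lambda>x. \<alpha> e x * ?g e x) (deriv \<phi>) + ip2 (len e) (\<lambda>x. (\<kappa> e x)\<^sup>2 * ?u e x) \<phi>"
        using e fin(1) by simp
      finally have q: "qf P (z, dz) = \<dots>" .
      have "ipV P (z, dz) = (\<Sum>e'\<in>arcs G. if e' = e then ip2 (len e) (?u e) \<phi> else 0)"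
        unfolding ipV_def ipG_eq by (intro sum.cong refl) (auto simp: z_def ip2_def)
      then have i: "ipV P (z, dz) = ip2 (len e) (?u e) \<phi>" using e fin(1) by simp
      interpret semi_inner "{u. L2_on (len e) u}" "ip2 (len e)" by (rule ip2_semi_inner)
      have \<phi>L: "L2_on (len e) \<phi>" by (rule H1rep_L2_self[OF \<phi>(1)])
      have "ip2 (len e) (h e) \<phi> = ip2 (len e) (\<lambda>x. (\<kappa> e x)\<^sup>2 * ?u e x) \<phi> - \<mu> * ip2 (len e) (?u e) \<phi>"
      proof -
        have "h e = (\<lambda>x. (\<kappa> e x)\<^sup>2 * ?u e x) - \<mu> *\<^sub>R ?u e" by (auto simp: h_def fun_eq_iff)
        moreover have "\<mu> *\<^sub>R ?u e \<in> {u. L2_on (len e) u}" using mem(3)[of "?u e" \<mu>] uL by simp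
        ultimately show ?thesis
          using diff_left[of "\<lambda>x. (\<kappa> e x)\<^sup>2 * ?u e x" "\<mu> *\<^sub>R ?u e" \<phi>] scale_left[of "?u e" \<phi> \<mu>] uL \<phi>L \<kappa>2_L2[OF e uL] by simp
      qed
      then have "ip2 (len e) (\<lambda>x. \<alpha> e x * ?g e x) (deriv \<phi>) = - ip2 (len e) (h e) \<phi>"
        using eig[OF W] q i by simp
      then show "integral\<^sup>L (leb (len e)) (\<lambda>x. \<alpha> e x * ?g e x * deriv \<phi> x) = - integral\<^sup>L (leb (len e)) (\<lambda>x. h e x * \<phi> x)"
        by (simp add: ip2_def)
    qed
    from weak_deriv_imp_H1rep[OF \<alpha>_L2[OF e gL] hL[OF e] fin(4)[OF e] this]
    obtain p where "H1rep (len e) p (h e)" "AE x in leb (len e). \<alpha> e x * ?g e x = p x" .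
    then show ?thesis by blast
  qed
  then have "\<forall>e. \<exists>p. e \<in> arcs G \<longrightarrow> H1rep (len e) p (h e) \<and> (AE x in leb (len e). \<alpha> e x * ?g e x = p x)" by blast
  from choice[OF this] obtain p where p: "\<And>e. e \<in> arcs G \<Longrightarrow> H1rep (len e) (p e) (h e)"
    "\<And>e. e \<in> arcs G \<Longrightarrow> AE x in leb (len e). \<alpha> e x * ?g e x = p e x" by blast
  \<comment> \<open>Dividing the representative \<open>p e\<close> of the flux by the coefficient
    gives a version of the derivative that is again a primitive, by the product rule. This supplies
    both H2 regularity and end values of the derivative.\<close>
  define D where "D e x = p e x * (1 / \<alpha> e x)" for e x
  have "\<exists>k. H1rep (len e) (D e) k" if e: "e \<in> arcs G" for e
  proof -
    obtain k where "H1rep (len e) (\<lambda>t. 1 / \<alpha> e t) k" using \<alpha>_H1rep(2)[OF e] by (elim exE)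
    from H1rep_mult[OF p(1)[OF e] this] show ?thesis unfolding D_def by blast
  qed
  then have "\<forall>e. \<exists>k. e \<in> arcs G \<longrightarrow> H1rep (len e) (D e) k" by blast
  from choice[OF this] obtain k where k: "\<And>e. e \<in> arcs G \<Longrightarrow> H1rep (len e) (D e) (k e)" by blast
  have \<alpha>D: "\<alpha> e x * D e x = p e x" if "e \<in> arcs G" "x \<in> {0..len e}" for e x
    using \<alpha>_ge[OF that] a0_pos unfolding D_def by simp
  have gD: "AE x in leb (len e). ?g e x = D e x" if e: "e \<in> arcs G" for e
    using p(2)[OF e] AE_space
  proof eventually_elim
    case (elim x)
    then have "0 < \<alpha> e x" using \<alpha>_ge[OF e, of x] a0_pos by simp
    then show ?case using elim(1) unfolding D_def by (simp add: field_simps)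
  qed
  have uD: "H1rep (len e) (?u e) (D e)" if e: "e \<in> arcs G" for e
    by (rule H1rep_AE_cong[OF uH[OF e] L2_on_measurable[OF H1rep_L2_self[OF k[OF e]]] gD[OF e]])
  have um: "?u e \<in> borel_measurable (leb (len e))" if "e \<in> arcs G" for e
    by (rule L2_on_measurable[OF Vf_D(2)[OF P that]])
  have pH: "H1rep (len e) (\<lambda>t. \<alpha> e t * D e t) (h e)" if e: "e \<in> arcs G" for e
  proof (rule H1repI[OF hL[OF e]])
    fix x assume x: "x \<in> {0..len e}"
    then have "0 \<in> {0..len e}" by auto
    from \<alpha>D[OF e x] \<alpha>D[OF e this] H1repD[OF p(1)[OF e] x]
    show "\<alpha> e x * D e x = \<alpha> e 0 * D e 0 + integral {0..x} (h e)" by simp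
  qed
  have bc: "A v *\<^sub>v bvec ?u v + a (Vertex v) \<cdot>\<^sub>v (B v *\<^sub>v Matrix.vec (deg G v) (dval D v)) = 0\<^sub>v (deg G v)"
    if v: "v \<in> verts G" for v
    unfolding vertex_conditions.boundary_condition_iff[OF vc[OF v]]
  proof (intro conjI allI impI)
    show "bvec ?u v \<in> Rv v" by (rule Vf_D(4)[OF P v])
    fix y assume y: "Matrix.vec (deg G v) y \<in> Rv v"
    obtain W where W: "W \<in> Vf" "\<And>i. i < deg G v \<Longrightarrow> bval (fst W) v i = y i"
      "\<And>v' i. v' \<in> verts G \<Longrightarrow> v' \<noteq> v \<Longrightarrow> i < deg G v' \<Longrightarrow> bval (fst W) v' i = 0"
      by (rule exists_boundary_values[OF v y]) blast
    have L: "L2_on (len e) (fst W e)" "L2_on (len e) (snd W e)" "L2_on (len e) (?u e)" "L2_on (len e) (?g e)" "L2_on (len e) (D e)"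
      if "e \<in> arcs G" for e
      using Vf_D(2,3)[OF W(1) that] Vf_D(2,3)[OF P that] H1rep_L2_self[OF k[OF that]] by auto
    have "qf P W + (\<Sum>v\<in>verts G. vf v (bval ?u v) (bval (fst W) v)) =
        (\<Sum>e\<in>arcs G. ip2 (len e) (\<lambda>x. \<alpha> e x * D e x) (snd W e)) + (\<Sum>e\<in>arcs G. ip2 (len e) (\<lambda>x. (\<kappa> e x)\<^sup>2 * ?u e x) (fst W e))"
    proof -
      have "ip2 (len e) (\<lambda>x. \<alpha> e x * ?g e x) (snd W e) = ip2 (len e) (\<lambda>x. \<alpha> e x * D e x) (snd W e)" if e: "e \<in> arcs G" for e
        using gD[OF e] by (intro ip2_AE_cong \<alpha>_L2[OF e] L[OF e]) (auto elim!: eventually_mono)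
      then show ?thesis unfolding qf_def by (simp add: sum.distrib)
    qed
    also have "\<dots> = (\<Sum>e\<in>arcs G. ip2 (len e) (\<lambda>x. (\<kappa> e x)\<^sup>2 * ?u e x) (fst W e) - ip2 (len e) (h e) (fst W e))
        - (\<Sum>v\<in>verts G. a (Vertex v) * dotn (deg G v) (dval D v) (bval (fst W) v))"
      using Green[OF pH Vf_D(1)[OF W(1)]] by (simp add: sum_subtractf)
    also have "(\<Sum>e\<in>arcs G. ip2 (len e) (\<lambda>x. (\<kappa> e x)\<^sup>2 * ?u e x) (fst W e) - ip2 (len e) (h e) (fst W e)) = \<mu> * ipV P W"
      unfolding ipV_def ipG_eq sum_distrib_left
    proof (rule sum.cong[OF refl])
      fix e assume e: "e \<in> arcs G"
      interpret semi_inner "{u. L2_on (len e) u}" "ip2 (len e)" by (rule ip2_semi_inner)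
      have "(\<lambda>x. (\<kappa> e x)\<^sup>2 * ?u e x) - h e = \<mu> *\<^sub>R ?u e" by (auto simp: h_def fun_eq_iff)
      then show "ip2 (len e) (\<lambda>x. (\<kappa> e x)\<^sup>2 * ?u e x) (fst W e) - ip2 (len e) (h e) (fst W e) = \<mu> * ip2 (len e) (?u e) (fst W e)"
        using diff_left[of "\<lambda>x. (\<kappa> e x)\<^sup>2 * ?u e x" "h e" "fst W e"] scale_left[of "?u e" "fst W e" \<mu>] L[OF e] \<kappa>2_L2[OF e L(3)[OF e]] hL[OF e] by simp
    qed
    finally have eq: "(\<Sum>v\<in>verts G. vf v (bval ?u v) (bval (fst W) v)) = - (\<Sum>v\<in>verts G. a (Vertex v) * dotn (deg G v) (dval D v) (bval (fst W) v))"
      using eig[OF W(1)] by simp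
    \<comment> \<open>As \<open>W\<close> vanishes at all other vertices, the identity summed over
      vertices reduces to the single vertex \<open>v\<close>.\<close>
    have "(\<Sum>v'\<in>verts G. vf v' (bval ?u v') (bval (fst W) v')) = (\<Sum>v'\<in>verts G. if v' = v then vf v (bval ?u v) y else 0)"
    proof (rule sum.cong[OF refl])
      fix v' assume v': "v' \<in> verts G"
      show "vf v' (bval ?u v') (bval (fst W) v') = (if v' = v then vf v (bval ?u v) y else 0)"
      proof (cases "v' = v")
        case True
        then show ?thesis using vertex_conditions.vform_cong[OF vc[OF v] refl W(2)] by simp
      next
        case False
        then show ?thesis using vf_zero_right[OF v' Vf_D(4)[OF P v'] W(3)[OF v' False]] by simp
      qed
    qed
    then have e1: "(\<Sum>v'\<in>verts G. vf v' (bval ?u v') (bval (fst W) v')) = vf v (bval ?u v) y" using v fin(2) by simp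
    have "(\<Sum>v'\<in>verts G. a (Vertex v') * dotn (deg G v') (dval D v') (bval (fst W) v')) =
        (\<Sum>v'\<in>verts G. if v' = v then a (Vertex v) * dotn (deg G v) (dval D v) y else 0)"
      using W(2,3) by (intro sum.cong refl) (auto simp: dotn_def)
    then have e2: "(\<Sum>v'\<in>verts G. a (Vertex v') * dotn (deg G v') (dval D v') (bval (fst W) v')) =
        a (Vertex v) * dotn (deg G v) (dval D v) y" using v fin(2) by simp
    show "a (Vertex v) * dotn (deg G v) (dval D v) y = - vf v (bval ?u v) y" using eq unfolding e1 e2 by simp
  qed
  show "fst P \<in> dom_L G len enum a A B"
    unfolding dom_L_def
  proof (intro CollectI conjI ballI)
    show "H2_on (len e) (?u e)" if "e \<in> arcs G" for e by (rule H2_onI[OF uD[OF that] k[OF that] fin(4)[OF that]])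
    fix v assume v: "v \<in> verts G"
    have "F_vec G len enum ?u v = bvec ?u v" "F'_vec G len enum ?u v = Matrix.vec (deg G v) (dval D v)"
      by (rule dom_L_vectors[OF v uD k um]; simp)+
    then show "A v *\<^sub>v F_vec G len enum ?u v + a (Vertex v) \<cdot>\<^sub>v (B v *\<^sub>v F'_vec G len enum ?u v) = 0\<^sub>v (deg G v)"
      using bc[OF v] by simp
  qed
  show "ae_eq G len (op_L G len a \<kappa> (fst P)) (\<lambda>e x. \<mu> * fst P e x)"
    unfolding ae_eq_def
  proof
    fix e assume e: "e \<in> arcs G"
    note wd = wderiv_AE_eq[OF uD[OF e] um[OF e] AE_I2[OF refl] fin(4)[OF e]]
    have m: "(\<lambda>t. \<alpha> e t * wderiv (len e) (?u e) t) \<in> borel_measurable (leb (len e))"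
      using \<alpha>_measurable[OF e] L2_on_measurable[OF wd(1)] by (rule borel_measurable_times)
    have "AE x in leb (len e). \<alpha> e x * wderiv (len e) (?u e) x = \<alpha> e x * D e x"
      using wd(2) by eventually_elim simp
    from wderiv_AE_eq(2)[OF pH[OF e] m this fin(4)[OF e]]
    show "AE x in leb (len e). op_L G len a \<kappa> ?u e x = \<mu> * ?u e x"
      by eventually_elim (simp add: op_L_def h_def)
  qed
qed

text \<open>\<open>u\<close> is replaced by its regular representative and Green's formula is run
  backwards. The vertex condition, tested with the boundary values of the representative itself,
  cancels the boundary term against the vertex term of \<open>qf\<close>.\<close>

lemma eigenvalue_form:
  assumes b: "u \<in> dom_L G len enum a A B" and eq: "ae_eq G len (op_L G len a \<kappa> u) (\<lambda>e x. \<mu> * u e x)"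
  obtains P where "P \<in> Vf" "qf P P = \<mu> * ipG u u" "ipV P P = ipG u u"
proof -
  have "\<forall>e. \<exists>wDk. e \<in> arcs G \<longrightarrow> L2_on (len e) (u e) \<and> H1rep (len e) (fst wDk) (fst (snd wDk)) \<and>
      H1rep (len e) (fst (snd wDk)) (snd (snd wDk)) \<and> (AE x in leb (len e). u e x = fst wDk x)"
  proof
    fix e show "\<exists>wDk. e \<in> arcs G \<longrightarrow> L2_on (len e) (u e) \<and> H1rep (len e) (fst wDk) (fst (snd wDk)) \<and>
      H1rep (len e) (fst (snd wDk)) (snd (snd wDk)) \<and> (AE x in leb (len e). u e x = fst wDk x)"
    proof (cases "e \<in> arcs G")
      case True
      have "H2_on (len e) (u e)" using b True unfolding dom_L_def by blast
      then obtain w D k where "L2_on (len e) (u e)" "H1rep (len e) w D" "H1rep (len e) D k" "AE x in leb (len e). u e x = w x"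
        by (rule H2_onD[OF _ fin(4)[OF True]])
      then show ?thesis by (intro exI[of _ "(w, D, k)"]) simp
    qed simp
  qed
  from choice[OF this] obtain F where F: "\<forall>e. e \<in> arcs G \<longrightarrow> L2_on (len e) (u e) \<and> H1rep (len e) (fst (F e)) (fst (snd (F e))) \<and>
      H1rep (len e) (fst (snd (F e))) (snd (snd (F e))) \<and> (AE x in leb (len e). u e x = fst (F e) x)" by blast
  define w where "w e = fst (F e)" for e
  define D where "D e = fst (snd (F e))" for e
  define k where "k e = snd (snd (F e))" for e
  have w: "H1rep (len e) (w e) (D e)" "H1rep (len e) (D e) (k e)" "L2_on (len e) (u e)" "AE x in leb (len e). u e x = w e x"
    if "e \<in> arcs G" for e
    using F that unfolding w_def D_def k_def by auto
  have um: "u e \<in> borel_measurable (leb (len e))" if "e \<in> arcs G" for e by (rule L2_on_measurable[OF w(3)[OF that]])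
  have bc: "bvec w v \<in> Rv v \<and> (\<forall>y. Matrix.vec (deg G v) y \<in> Rv v \<longrightarrow>
      a (Vertex v) * dotn (deg G v) (dval D v) y = - vf v (bval w v) y)" if v: "v \<in> verts G" for v
  proof -
    have "F_vec G len enum u v = bvec w v" "F'_vec G len enum u v = Matrix.vec (deg G v) (dval D v)"
      by (rule dom_L_vectors[OF v w(1,2) um w(4)]; simp)+
    moreover have "A v *\<^sub>v F_vec G len enum u v + a (Vertex v) \<cdot>\<^sub>v (B v *\<^sub>v F'_vec G len enum u v) = 0\<^sub>v (deg G v)"
      using b v unfolding dom_L_def by blast
    ultimately show ?thesis
      using vertex_conditions.boundary_condition_iff[OF vc[OF v], of "bval w v" "a (Vertex v)" "dval D v"] by simp
  qed
  have PV: "(w, D) \<in> Vf" unfolding Vf_def using w(1) bc by auto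
  have "\<exists>p. H1rep (len e) (\<lambda>t. \<alpha> e t * D e t) p" if e: "e \<in> arcs G" for e
  proof -
    obtain h where "H1rep (len e) (\<alpha> e) h" using \<alpha>_H1rep(1)[OF e] by (elim exE)
    from H1rep_mult[OF this w(2)[OF e]] show ?thesis by blast
  qed
  then have "\<forall>e. \<exists>p. e \<in> arcs G \<longrightarrow> H1rep (len e) (\<lambda>t. \<alpha> e t * D e t) p" by blast
  from choice[OF this] obtain p where p: "\<And>e. e \<in> arcs G \<Longrightarrow> H1rep (len e) (\<lambda>t. \<alpha> e t * D e t) (p e)" by blast
  have pe: "AE x in leb (len e). - p e x + (\<kappa> e x)\<^sup>2 * w e x = \<mu> * w e x" if e: "e \<in> arcs G" for e
  proof -
    note wd = wderiv_AE_eq[OF w(1)[OF e] um[OF e] w(4)[OF e] fin(4)[OF e]]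
    have m: "(\<lambda>t. \<alpha> e t * wderiv (len e) (u e) t) \<in> borel_measurable (leb (len e))"
      using \<alpha>_measurable[OF e] L2_on_measurable[OF wd(1)] by (rule borel_measurable_times)
    have "AE x in leb (len e). \<alpha> e x * wderiv (len e) (u e) x = \<alpha> e x * D e x"
      using wd(2) by eventually_elim simp
    from wderiv_AE_eq(2)[OF p[OF e] m this fin(4)[OF e]]
    have 1: "AE x in leb (len e). wderiv (len e) (\<lambda>t. \<alpha> e t * wderiv (len e) (u e) t) x = p e x" .
    have 2: "AE x in leb (len e). op_L G len a \<kappa> u e x = \<mu> * u e x" using eq e unfolding ae_eq_def by blast
    show ?thesis using 1 2 w(4)[OF e] by eventually_elim (simp add: op_L_def)
  qed
  have "qf (w, D) (w, D) = - (\<Sum>e\<in>arcs G. ip2 (len e) (p e) (w e)) - (\<Sum>v\<in>verts G. a (Vertex v) * dotn (deg G v) (dval D v) (bval w v))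
      + (\<Sum>e\<in>arcs G. ip2 (len e) (\<lambda>x. (\<kappa> e x)\<^sup>2 * w e x) (w e)) - (\<Sum>v\<in>verts G. vf v (bval w v) (bval w v))"
    unfolding qf_def using Green[OF p w(1)] by (simp add: sum.distrib)
  also have "(\<Sum>v\<in>verts G. a (Vertex v) * dotn (deg G v) (dval D v) (bval w v)) = (\<Sum>v\<in>verts G. - vf v (bval w v) (bval w v))"
    using bc by (intro sum.cong refl) blast
  finally have "qf (w, D) (w, D) = (\<Sum>e\<in>arcs G. ip2 (len e) (\<lambda>x. (\<kappa> e x)\<^sup>2 * w e x) (w e) - ip2 (len e) (p e) (w e))"
    by (simp add: sum_negf sum_subtractf)
  also have "\<dots> = (\<Sum>e\<in>arcs G. \<mu> * ip2 (len e) (u e) (u e))"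
  proof (rule sum.cong[OF refl])
    fix e assume e: "e \<in> arcs G"
    interpret semi_inner "{u. L2_on (len e) u}" "ip2 (len e)" by (rule ip2_semi_inner)
    have L: "L2_on (len e) (w e)" "L2_on (len e) (p e)" "L2_on (len e) (\<lambda>x. (\<kappa> e x)\<^sup>2 * w e x)"
      using H1rep_L2_self[OF w(1)[OF e]] H1rep_L2[OF p[OF e]] \<kappa>2_L2[OF e] by auto
    have "ip2 (len e) (\<lambda>x. (\<kappa> e x)\<^sup>2 * w e x) (w e) - ip2 (len e) (p e) (w e) = ip2 (len e) (\<lambda>x. (\<kappa> e x)\<^sup>2 * w e x - p e x) (w e)"
      using diff_left[of "\<lambda>x. (\<kappa> e x)\<^sup>2 * w e x" "p e" "w e"] L by (simp add: fun_diff_def)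
    also have "\<dots> = ip2 (len e) (\<lambda>x. \<mu> * u e x) (u e)"
    proof (rule ip2_AE_cong)
      show "AE x in leb (len e). (\<kappa> e x)\<^sup>2 * w e x - p e x = \<mu> * u e x"
        using pe[OF e] w(4)[OF e] by eventually_elim simp
      show "AE x in leb (len e). w e x = u e x" using w(4)[OF e] by eventually_elim simp
    qed (use L w(3)[OF e] in auto)
    also have "\<dots> = \<mu> * ip2 (len e) (u e) (u e)" by (simp add: ip2_def mult.assoc)
    finally show "ip2 (len e) (\<lambda>x. (\<kappa> e x)\<^sup>2 * w e x) (w e) - ip2 (len e) (p e) (w e) = \<mu> * ip2 (len e) (u e) (u e)" .
  qed
  also have "\<dots> = \<mu> * ipG u u" by (simp add: ipG_eq sum_distrib_left)
  finally have q: "qf (w, D) (w, D) = \<mu> * ipG u u" .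
  have "ipV (w, D) (w, D) = ipG u u"
    unfolding ipV_def ipG_eq
  proof (rule sum.cong[OF refl])
    fix e assume e: "e \<in> arcs G"
    have "AE x in leb (len e). w e x = u e x" using w(4)[OF e] by eventually_elim simp
    then show "ip2 (len e) (fst (w, D) e) (fst (w, D) e) = ip2 (len e) (u e) (u e)"
      using H1rep_L2_self[OF w(1)[OF e]] w(3)[OF e] by (intro ip2_AE_cong) auto
  qed
  then show thesis using that PV q by blast
qed

end

section \<open>The eigenbasis and the fractional equation\<close>

context coercive_graph
begin

text \<open>Expansions are given only on the form domain. For general \<open>u\<close> the Fourier
  series has a sum \<open>w\<close> by Riesz-Fischer; \<open>u - w\<close> is orthogonal to the
  basis, hence to \<open>Vf\<close>, in particular to bumps inside the edges, and therefore vanishes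
  almost everywhere.\<close>

lemma orthonormal_basisI:
  assumes \<psi>: "\<And>k. P k \<in> Vf" "\<And>j k. ipG (fst (P j)) (fst (P k)) = (if j = k then 1 else 0)"
    and dense: "\<And>W. W \<in> Vf \<Longrightarrow>
      (\<lambda>n. ipV (W - (\<Sum>k<n. ipV W (P k) *\<^sub>R P k)) (W - (\<Sum>k<n. ipV W (P k) *\<^sub>R P k))) \<longlonglongrightarrow> 0"
  shows "orthonormal_basis G len (\<lambda>k. fst (P k))"
  unfolding orthonormal_basis_def
proof (intro conjI allI ballI)
  interpret complete_semi_inner HG ipG by (rule ipG_complete)
  let ?b = "\<lambda>k. fst (P k)"
  show bH: "?b k \<in> HG" for k by (rule Vf_D(5)[OF \<psi>(1)])
  show "ipG (?b j) (?b k) = (if j = k then 1 else 0)" for j k by (rule \<psi>(2))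
  have on: "orthonormal_upto n ?b" for n unfolding orthonormal_upto_def using bH \<psi>(2) by auto
  fix u assume u: "u \<in> HG"
  define c where "c k = ipG u (?b k)" for k
  obtain w where w: "w \<in> HG" "\<And>k. ipG w (?b k) = c k"
    "(\<lambda>n. ipG (w - (\<Sum>k<n. c k *\<^sub>R ?b k)) (w - (\<Sum>k<n. c k *\<^sub>R ?b k))) \<longlonglongrightarrow> 0"
    using Riesz_Fischer[OF on, of c] Bessel_summable[OF on u] unfolding c_def by blast
  define r where "r = u - w"
  have rH: "r \<in> HG" unfolding r_def using u w(1) by auto
  have rb: "ipG r (?b k) = 0" for k unfolding r_def using u w(1,2) bH by (simp add: diff_left c_def)
  have rV: "ipG r (fst W) = 0" if W: "W \<in> Vf" for W
  proof -
    define s where "s n = (\<Sum>k<n. ipV W (P k) *\<^sub>R ?b k)" for n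
    have sH: "s n \<in> HG" for n unfolding s_def using bH by auto
    have fs: "fst (W - (\<Sum>k<n. ipV W (P k) *\<^sub>R P k)) = fst W - s n" for n
      by (simp add: s_def fst_sum)
    have "(\<lambda>n. ipG (fst W - s n) (fst W - s n)) \<longlonglongrightarrow> 0"
    proof -
      have "(\<lambda>n. ipG (fst W - s n) (fst W - s n)) =
          (\<lambda>n. ipV (W - (\<Sum>k<n. ipV W (P k) *\<^sub>R P k)) (W - (\<Sum>k<n. ipV W (P k) *\<^sub>R P k)))"
        by (rule ext) (simp only: fs[symmetric] ipV_def)
      then show ?thesis using dense[OF W] by simp
    qed
    then have "(\<lambda>n. ipG (s n - fst W) (s n - fst W)) \<longlonglongrightarrow> 0"
      using sH Vf_D(5)[OF W] by (simp add: sq_diff_commute)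
    from tendsto_left[OF sH Vf_D(5)[OF W] rH this]
    have "(\<lambda>n. ipG (s n) r) \<longlonglongrightarrow> ipG (fst W) r" .
    moreover have "ipG (s n) r = 0" for n
    proof -
      have "ipG (s n) r = (\<Sum>k<n. ipV W (P k) * ipG (?b k) r)"
        unfolding s_def using bH rH by (subst sum_left) (auto simp: scale_left)
      also have "\<dots> = 0" using rb sym[OF bH rH] by simp
      finally show ?thesis .
    qed
    ultimately have "ipG (fst W) r = 0" by (simp add: LIMSEQ_const_iff)
    then show ?thesis using sym[OF rH Vf_D(5)[OF W]] by simp
  qed
  have "AE x in leb (len e). r e x = 0" if e: "e \<in> arcs G" for e
  proof -
    have rL: "L2_on (len e) (r e)" using rH e unfolding HG_iff by blast
    \<comment> \<open>Orthogonality to all test functions says that \<open>r e\<close> is a weak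
      derivative of the zero function, so uniqueness of derivatives yields \<open>r e = 0\<close>
      almost everywhere.\<close>
    have "weak_deriv_on (len e) (\<lambda>x. 0) (r e)"
      unfolding weak_deriv_on_def
    proof (intro allI impI)
      fix \<phi> assume t: "test_fun (len e) \<phi>"
      note \<phi> = test_fun_H1rep[OF t]
      define z where "z = (\<lambda>e'. if e' = e then \<phi> else (\<lambda>x. 0))"
      define dz where "dz = (\<lambda>e'. if e' = e then deriv \<phi> else (\<lambda>x. 0))"
      have W: "(z, dz) \<in> Vf"
        by (rule vanishing_boundary_in_Vf) (use \<phi> in \<open>auto simp: z_def dz_def\<close>)
      have "ipG r z = (\<Sum>e'\<in>arcs G. if e' = e then ip2 (len e) (r e) \<phi> else 0)"
        unfolding ipG_eq by (intro sum.cong refl) (auto simp: z_def ip2_def)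
      then have "ipG r z = ip2 (len e) (r e) \<phi>" using e fin(1) by simp
      then show "integral\<^sup>L (leb (len e)) (\<lambda>x. 0 * deriv \<phi> x) = - integral\<^sup>L (leb (len e)) (\<lambda>x. r e x * \<phi> x)"
        using rV[OF W] by (simp add: ip2_def)
    qed
    from weak_deriv_imp_H1rep[OF L2_on_const rL fin(4)[OF e] this]
    obtain v where v: "H1rep (len e) v (r e)" "AE x in leb (len e). 0 = v x" .
    have "AE x in leb (len e). v x = 0" using v(2) by eventually_elim simp
    from H1rep_unique(2)[OF v(1) H1rep_const this fin(4)[OF e]] show ?thesis .
  qed
  then have r0: "ipG r r = 0" using ipG_zero_iff[OF rH] by blast
  have cH: "c k *\<^sub>R ?b k \<in> HG" for k using bH by auto
  have "(\<lambda>n. ipG (u - (\<Sum>k<n. c k *\<^sub>R ?b k)) (u - (\<Sum>k<n. c k *\<^sub>R ?b k))) \<longlonglongrightarrow> 0"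
  proof (rule tendsto_sandwich[OF _ _ tendsto_const])
    have sH: "(\<Sum>k<n. c k *\<^sub>R ?b k) \<in> HG" for n using cH by auto
    show "\<forall>\<^sub>F n in sequentially. 0 \<le> ipG (u - (\<Sum>k<n. c k *\<^sub>R ?b k)) (u - (\<Sum>k<n. c k *\<^sub>R ?b k))"
      using u sH by (intro always_eventually allI nonneg mem(4))
    show "\<forall>\<^sub>F n in sequentially. ipG (u - (\<Sum>k<n. c k *\<^sub>R ?b k)) (u - (\<Sum>k<n. c k *\<^sub>R ?b k))
        \<le> 2 * ipG (w - (\<Sum>k<n. c k *\<^sub>R ?b k)) (w - (\<Sum>k<n. c k *\<^sub>R ?b k))"
    proof (intro always_eventually allI)
      fix n
      have eq: "u - (\<Sum>k<n. c k *\<^sub>R ?b k) = r + (w - (\<Sum>k<n. c k *\<^sub>R ?b k))" unfolding r_def by simp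
      show "ipG (u - (\<Sum>k<n. c k *\<^sub>R ?b k)) (u - (\<Sum>k<n. c k *\<^sub>R ?b k))
          \<le> 2 * ipG (w - (\<Sum>k<n. c k *\<^sub>R ?b k)) (w - (\<Sum>k<n. c k *\<^sub>R ?b k))"
        unfolding eq using sq_add_le[OF rH mem(4)[OF w(1) sH], of n] r0 by simp
    qed
    show "(\<lambda>n. 2 * ipG (w - (\<Sum>k<n. c k *\<^sub>R ?b k)) (w - (\<Sum>k<n. c k *\<^sub>R ?b k))) \<longlonglongrightarrow> 0"
      using tendsto_mult_right_zero[OF w(3), of 2] .
  qed
  then have "L2_sums G len (\<lambda>k. c k *\<^sub>R ?b k) u" using L2_sums_iff[OF cH u] by simp
  then show "L2_sums G len (\<lambda>k e x. ipG u (?b k) * ?b k e x) u"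
    by (simp add: c_def scaleR_fun_def)
qed

lemma eigenbasis_exists: "\<exists>b lam. eigenbasis G len enum a \<kappa> A B b lam"
proof -
  obtain \<delta> where \<delta>: "0 < \<delta>" "\<forall>P\<in>Vf. \<delta> * NV P \<le> qf P P" using qf_lower by blast
  interpret C: coercive_form Vf ipV qf \<delta> by (rule coercive_form_Vf) (use \<delta> in auto)
  obtain P mu where P: "\<And>n. C.ip.orthonormal_upto n P" "\<And>k. \<delta> \<le> mu k"
    "\<And>k W. W \<in> Vf \<Longrightarrow> qf (P k) W = mu k * ipV (P k) W"
    "\<And>W. W \<in> Vf \<Longrightarrow> (\<lambda>n. ipV (C.ip.residual n P W) (C.ip.residual n P W)) \<longlonglongrightarrow> 0"
    using C.spectral by blast
  have PV: "P k \<in> Vf" for k using P(1)[of "Suc k"] unfolding C.ip.orthonormal_upto_def by auto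
  have on: "ipG (fst (P j)) (fst (P k)) = (if j = k then 1 else 0)" for j k
    using P(1)[of "Suc (max j k)"] unfolding C.ip.orthonormal_upto_def ipV_def by (simp add: less_Suc_eq_le)
  have "orthonormal_basis G len (\<lambda>k. fst (P k))"
    by (rule orthonormal_basisI[OF PV on]) (use P(4) in \<open>simp add: C.ip.residual_def\<close>)
  moreover have "0 < mu k" for k using P(2)[of k] \<delta>(1) by simp
  ultimately have "eigenbasis G len enum a \<kappa> A B (\<lambda>k. fst (P k)) mu"
    unfolding eigenbasis_def using eigenvector_regular[OF PV P(3)] by auto
  then show ?thesis by blast
qed

text \<open>The bound is a property of the form alone, so one \<open>\<delta>\<close> serves every
  eigenbasis and not merely the one constructed variationally.\<close>

lemma eigenvalue_lower_bound:
  obtains \<delta> where "0 < \<delta>" "\<And>b lam k. eigenbasis G len enum a \<kappa> A B b lam \<Longrightarrow> \<delta> \<le> lam k"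
proof -
  obtain \<delta> where \<delta>: "0 < \<delta>" "\<forall>P\<in>Vf. \<delta> * NV P \<le> qf P P" using qf_lower by blast
  have "\<delta> \<le> lam k" if e: "eigenbasis G len enum a \<kappa> A B b lam" for b lam k
  proof -
    have b: "b k \<in> dom_L G len enum a A B" "ae_eq G len (op_L G len a \<kappa> (b k)) (\<lambda>e x. lam k * b k e x)"
      "ipG (b k) (b k) = 1"
      using e unfolding eigenbasis_def orthonormal_basis_def by auto
    obtain P where P: "P \<in> Vf" "qf P P = lam k * ipG (b k) (b k)" "ipV P P = ipG (b k) (b k)"
      by (rule eigenvalue_form[OF b(1,2)])
    have "\<delta> * ipV P P \<le> \<delta> * NV P" using \<delta>(1) ipV_le_NV by (intro mult_left_mono) auto
    also have "\<dots> \<le> qf P P" using \<delta>(2) P(1) by blast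
    finally show ?thesis using P b(3) by simp
  qed
  then show thesis using that \<delta>(1) by blast
qed

text \<open>For uniqueness, pairing the L2-convergent series with \<open>b j\<close> shows that
  every solution has the same coefficients, and an L2 function with zero coefficients is null by its
  own expansion. With the weight exponent \<open>2 * \<beta>\<close> the weighted squared
  coefficients of \<open>u\<close> are exactly the squared coefficients of \<open>f\<close>.\<close>

lemma fractional_equation:
  assumes eb: "eigenbasis G len enum a \<kappa> A B b lam" and f: "f \<in> HG" and \<beta>: "0 < \<beta>"
  shows "\<exists>u\<in>Hdot G len b lam (2 * \<beta>). frac_power_eq G len b lam \<beta> u f \<and>
          (\<forall>w\<in>Hdot G len b lam (2 * \<beta>). frac_power_eq G len b lam \<beta> w f \<longrightarrow> ae_eq G len w u)"
proof -
  interpret complete_semi_inner HG ipG by (rule ipG_complete)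
  obtain \<delta> where \<delta>: "0 < \<delta>" "\<And>k. \<delta> \<le> lam k" using eigenvalue_lower_bound eb by metis
  have lam: "0 < lam k" for k using \<delta>(1) \<delta>(2)[of k] by simp
  have ob: "orthonormal_basis G len b" using eb unfolding eigenbasis_def by blast
  have bH: "b k \<in> HG" for k using ob unfolding orthonormal_basis_def by blast
  have bb: "ipG (b j) (b k) = (if j = k then 1 else 0)" for j k using ob unfolding orthonormal_basis_def by blast
  have on: "orthonormal_upto n b" for n unfolding orthonormal_upto_def using bH bb by auto
  have expand: "(\<lambda>n. ipG (u - (\<Sum>k<n. ipG u (b k) *\<^sub>R b k)) (u - (\<Sum>k<n. ipG u (b k) *\<^sub>R b k))) \<longlonglongrightarrow> 0"
    if u: "u \<in> HG" for u
  proof -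
    have "L2_sums G len (\<lambda>k e x. ipG u (b k) * b k e x) u" using ob u unfolding orthonormal_basis_def by blast
    then have "L2_sums G len (\<lambda>k. ipG u (b k) *\<^sub>R b k) u" by (simp add: scaleR_fun_def)
    then show ?thesis using L2_sums_iff[of "\<lambda>k. ipG u (b k) *\<^sub>R b k" u] bH u by auto
  qed
  have frac: "frac_power_eq G len b lam \<beta> u f \<longleftrightarrow>
      (\<lambda>n. ipG (f - (\<Sum>k<n. (lam k powr \<beta> * ipG u (b k)) *\<^sub>R b k)) (f - (\<Sum>k<n. (lam k powr \<beta> * ipG u (b k)) *\<^sub>R b k))) \<longlonglongrightarrow> 0" for u
  proof -
    have "(\<lambda>k e x. lam k powr \<beta> * ipG u (b k) * b k e x) = (\<lambda>k. (lam k powr \<beta> * ipG u (b k)) *\<^sub>R b k)"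
      by (simp add: scaleR_fun_def)
    then show ?thesis
      unfolding frac_power_eq_def using L2_sums_iff[of "\<lambda>k. (lam k powr \<beta> * ipG u (b k)) *\<^sub>R b k" f] bH f by auto
  qed
  define c where "c k = ipG f (b k) / lam k powr \<beta>" for k
  have fs: "summable (\<lambda>k. (ipG f (b k))\<^sup>2)" by (rule Bessel_summable[OF on f])
  \<comment> \<open>Positivity of each eigenvalue would not suffice here: the uniform bound
    \<open>\<delta>\<close> keeps the factors \<open>1 / lam k powr \<beta>\<close> bounded in
    \<open>k\<close>.\<close>
  have c2: "(c k)\<^sup>2 \<le> (1 / \<delta> powr \<beta>)\<^sup>2 * (ipG f (b k))\<^sup>2" for k
  proof -
    have "\<delta> powr \<beta> \<le> lam k powr \<beta>" using \<delta> \<beta> by (intro powr_mono2) (auto simp: less_imp_le)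
    then have "(\<delta> powr \<beta>)\<^sup>2 \<le> (lam k powr \<beta>)\<^sup>2" by (intro power_mono) auto
    then have "(ipG f (b k))\<^sup>2 / (lam k powr \<beta>)\<^sup>2 \<le> (ipG f (b k))\<^sup>2 / (\<delta> powr \<beta>)\<^sup>2"
      using \<delta>(1) lam[of k] by (intro divide_left_mono) auto
    then show ?thesis unfolding c_def by (simp add: power_divide)
  qed
  have "summable (\<lambda>k. (c k)\<^sup>2)"
    by (rule summable_comparison_test'[OF summable_mult[OF fs, of "(1 / \<delta> powr \<beta>)\<^sup>2"], of 0]) (use c2 in auto)
  from Riesz_Fischer[OF on this] obtain u where u: "u \<in> HG" "\<And>k. ipG u (b k) = c k" by blast
  have lc: "lam k powr \<beta> * c k = ipG f (b k)" for k unfolding c_def using lam[of k] by simp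
  show ?thesis
  proof (intro bexI conjI ballI impI)
    have "lam k powr (2 * \<beta>) * (c k)\<^sup>2 = (ipG f (b k))\<^sup>2" for k
    proof -
      have "lam k powr (2 * \<beta>) = (lam k powr \<beta>)\<^sup>2"
        by (simp add: power2_eq_square powr_add[symmetric])
      then show ?thesis using lc[of k] by (simp add: power_mult_distrib[symmetric])
    qed
    then show "u \<in> Hdot G len b lam (2 * \<beta>)" unfolding Hdot_def using u fs by simp
    show "frac_power_eq G len b lam \<beta> u f" unfolding frac u(2) lc by (rule expand[OF f])
    fix w assume w: "w \<in> Hdot G len b lam (2 * \<beta>)" and eq: "frac_power_eq G len b lam \<beta> w f"
    have wH: "w \<in> HG" using w unfolding Hdot_def by blast
    have wc: "ipG w (b j) = c j" for j
    proof -
      define s where "s n = (\<Sum>k<n. (lam k powr \<beta> * ipG w (b k)) *\<^sub>R b k)" for n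
      have sH: "s n \<in> HG" for n unfolding s_def using bH by auto
      have "(\<lambda>n. ipG (s n - f) (s n - f)) \<longlonglongrightarrow> 0"
        using eq unfolding frac s_def[symmetric] by (simp add: sq_diff_commute[OF sH f])
      from tendsto_left[OF sH f bH this] have l1: "(\<lambda>n. ipG (s n) (b j)) \<longlonglongrightarrow> ipG f (b j)" .
      have "\<forall>\<^sub>F n in sequentially. ipG (s n) (b j) = lam j powr \<beta> * ipG w (b j)"
        using eventually_gt_at_top[of j] by eventually_elim (simp add: s_def orthonormal_sum[OF on])
      then have l2: "(\<lambda>n. ipG (s n) (b j)) \<longlonglongrightarrow> lam j powr \<beta> * ipG w (b j)" by (rule tendsto_eventually)
      have "lam j powr \<beta> * ipG w (b j) = lam j powr \<beta> * c j" using LIMSEQ_unique[OF l2 l1] lc by simp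
      then show ?thesis using lam[of j] by simp
    qed
    have dH: "w - u \<in> HG" using wH u(1) by auto
    have "ipG (w - u) (b k) = 0" for k using wH u bH wc by (simp add: diff_left)
    then have "(\<lambda>n::nat. ipG (w - u) (w - u)) \<longlonglongrightarrow> 0" using expand[OF dH] by simp
    then have "ipG (w - u) (w - u) = 0" by (simp add: LIMSEQ_const_iff)
    then have "\<forall>e\<in>arcs G. AE x in leb (len e). (w - u) e x = 0" using ipG_zero_iff[OF dH] by blast
    then show "ae_eq G len w u" unfolding ae_eq_def by (auto elim!: eventually_mono)
  qed
qed

end

text \<open>Existence of an eigenbasis is part of the conclusion, which keeps the second conjunct
  from being vacuous; quantifying over all eigenbases makes the solvability statement independent of
  the chosen one.\<close>

theorem proposition3p1:
  fixes G :: "('v,'e) pre_digraph" and len :: "'e \<Rightarrow> real"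
    and enum :: "'v \<Rightarrow> nat \<Rightarrow> 'e \<times> bool"
    and a :: "('v,'e) gpoint \<Rightarrow> real" and a0 :: real
    and \<kappa> :: "'e \<Rightarrow> real \<Rightarrow> real" and \<kappa>0 :: real
    and A B :: "'v \<Rightarrow> real Matrix.mat" and S :: real
  assumes "compact_metric_graph G len" and "Digraph_Component.connected G"
    and "\<forall>v\<in>verts G. bij_betw (enum v) {..<deg G v} (edge_ends G v)"
    and kappa_Linf: "\<forall>e\<in>arcs G. \<kappa> e \<in> borel_measurable (lebesgue_on {0..len e}) \<and>
           (\<exists>C. AE x in lebesgue_on {0..len e}. \<bar>\<kappa> e x\<bar> \<le> C)"
    and kappa_ge: "\<forall>e\<in>arcs G. AE x in lebesgue_on {0..len e}. \<kappa>0 \<le> \<kappa> e x"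
    and "0 < \<kappa>0"
    and "lipschitz_graph G len a"
    and a0_min: "\<exists>p\<in>gpoints G len. a p = a0" "\<forall>p\<in>gpoints G len. a0 \<le> a p"
    and "0 < a0"
    and "admissible_vertex_conditions G A B"
    and S_def: "S = Max ((\<lambda>v. Lam_norm (A v) (B v)) ` verts G)"
    and A1_or_A2: "(4 * S / Min (len ` arcs G) < \<kappa>0\<^sup>2 \<and> 2 * S * Max (len ` arcs G) \<le> a0) \<or>
           (\<forall>v\<in>verts G. Lam_nonpos (A v) (B v))"
  shows "(\<exists>b lam. eigenbasis G len enum a \<kappa> A B b lam) \<and>
    (\<forall>b lam. eigenbasis G len enum a \<kappa> A B b lam \<longrightarrow>
      (\<forall>f\<in>L2_graph G len. \<forall>\<beta>>0.
        \<exists>u\<in>Hdot G len b lam (2 * \<beta>). frac_power_eq G len b lam \<beta> u f \<and>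
          (\<forall>w\<in>Hdot G len b lam (2 * \<beta>). frac_power_eq G len b lam \<beta> w f \<longrightarrow> ae_eq G len w u)))"
proof -
  interpret coercive_graph G len enum a a0 \<kappa> \<kappa>0 A B S
    by unfold_locales (fact assms)+
  show ?thesis using eigenbasis_exists fractional_equation by blast
qed

end
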